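(* Let $N\ge 1$ be an integer, let $\alpha\in(0,\frac12]$, and let $\Omega\subset\mathbb{R}^N$ be a bounded domain which is of class $C^2$ if $N\ge 2$ and an open interval if $N=1$. Then for every $p>0$ the problem $$(-\Delta)^\alpha_\Omega u=u^p\quad\text{in }\Omega,\qquad u=0\quad\text{on }\partial\Omega$$ has no nonnegative nontrivial (i.e. not identically zero) viscosity solution $u\in C(\Omega)$.
   Context: Regional fractional Laplacian: for $x\in\Omega$, $$(-\Delta)^\alpha_\Omega u(x)=\lim_{\varepsilon\to0^+}c_{N,\alpha}\int_{\Omega\setminus B_\varepsilon(x)}\frac{u(x)-u(z)}{|z-x|^{N+2\alpha}}\,dz,$$ where $c_{N,\alpha}>0$ is the fixed normalization constant of the fractional Laplacian. Viscosity solution: a function $u\in C(\Omega)$ is a viscosity super-solution (resp. sub-solution) of $(-\Delta)^\alpha_\Omega u=f$ in $\Omega$ if for every point $x_0\in\Omega$ and some neighborhood $V$ of $x_0$ with $\bar V\subset\Omega$ and for any $\varphi\in C^2(\bar V)$ such that $u(x_0)=\varphi(x_0)$ and $x_0$ is a minimum (resp. maximum) point of $u-\varphi$ in $V$, the function $\tilde u$ defined by $\tilde u=\varphi$ in $V$ and $\tilde u=u$ in $\Omega\setminus V$ satisfies $(-\Delta)^\alpha_\Omega\tilde u(x_0)\ge f(x_0)$ (resp. $\le f(x_0)$). A viscosity solution is both a super- and a sub-solution; for the equation above this is applied with $f(x)=u(x)^p$. The boundary condition $u=0$ on $\partial\Omega$ means $\lim_{x\in\Omega,\,x\to\bar x}u(x)=0$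 for every $\bar x\in\partial\Omega$. *)

theory Defs
  imports "HOL-Analysis.Analysis"
begin

text \<open>The constant for which the fractional Laplacian on \<open>\<real>\<^sup>N\<close>, \<open>N = CARD('n)\<close>, has
  Fourier symbol \<open>|\<xi>|\<close> to the power \<open>2\<alpha>\<close> (\<open>0 < \<alpha> < 1\<close>).\<close>

definition frac_laplacian_const :: "'n::finite itself \<Rightarrow> real \<Rightarrow> real" where
  "frac_laplacian_const _ \<alpha> =
     4 powr \<alpha> * Gamma (real CARD('n) / 2 + \<alpha>) /
       (pi powr (real CARD('n) / 2) * \<bar>Gamma (- \<alpha>)\<bar>)"

text \<open>Relational form of \<open>(-\<Delta>)\<^sup>\<alpha>\<^sub>\<Omega> u(x) = L\<close>: the truncated integrals exist as Lebesgue
  integrals and converge to the real number \<open>L\<close>, so no junk value of a divergent integral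
  or limit can enter.\<close>

definition has_regional_frac_laplacian ::
    "(real ^ 'n) set \<Rightarrow> real \<Rightarrow> (real ^ 'n \<Rightarrow> real) \<Rightarrow> real ^ 'n \<Rightarrow> real \<Rightarrow> bool" where
  "has_regional_frac_laplacian \<Omega> \<alpha> u x L \<longleftrightarrow>
     (\<forall>\<epsilon>>0. set_integrable lborel (\<Omega> - ball x \<epsilon>)
        (\<lambda>z. (u x - u z) / norm (z - x) powr (real CARD('n) + 2 * \<alpha>))) \<and>
     ((\<lambda>\<epsilon>. frac_laplacian_const TYPE('n) \<alpha> *
        (LINT z:\<Omega> - ball x \<epsilon>|lborel.
           (u x - u z) / norm (z - x) powr (real CARD('n) + 2 * \<alpha>))) \<longlongrightarrow> L) (at_right 0)"

text \<open>\<open>C\<^sup>2\<close> up to the closure of an open set \<open>V\<close>: twice differentiable in \<open>V\<close>, where the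
  function, its gradient \<open>g\<close> and its Hessian \<open>H\<close> extend continuously to \<open>closure V\<close>.
  With \<open>V = UNIV\<close> this is the class \<open>C\<^sup>2\<close> on the whole space.\<close>

definition C2_upto_closure :: "(real ^ 'n) set \<Rightarrow> (real ^ 'n \<Rightarrow> real) \<Rightarrow> bool" where
  "C2_upto_closure V \<phi> \<longleftrightarrow>
     (\<exists>(g :: real ^ 'n \<Rightarrow> real ^ 'n) (H :: real ^ 'n \<Rightarrow> real ^ 'n ^ 'n).
        (\<forall>x\<in>V. (\<phi> has_derivative (\<lambda>h. g x \<bullet> h)) (at x)) \<and>
        (\<forall>x\<in>V. (g has_derivative (\<lambda>h. H x *v h)) (at x)) \<and>
        continuous_on (closure V) \<phi> \<and> continuous_on (closure V) g \<and>
        continuous_on (closure V) H)"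

text \<open>Near every boundary point, \<open>\<Omega>\<close> is the part of a ball lying above the graph of a \<open>C\<^sup>2\<close>
  function, in suitable Cartesian coordinates.  The vertical axis is the unit vector \<open>e\<close>; the
  graph function lives on the hyperplane orthogonal to \<open>e\<close> (a copy of \<open>\<real>\<close> to the power
  \<open>N - 1\<close>), and only the values of \<open>\<gamma>\<close> on that hyperplane are used.  A \<open>C\<^sup>2\<close> function on the
  hyperplane extends to the whole space by composing it with the orthogonal projection.\<close>

definition C2_boundary :: "(real ^ 'n) set \<Rightarrow> bool" where
  "C2_boundary \<Omega> \<longleftrightarrow>
     (\<forall>x0\<in>frontier \<Omega>. \<exists>r e \<gamma>. r > 0 \<and> norm e = 1 \<and> C2_upto_closure UNIV \<gamma> \<and>
        \<Omega> \<inter> ball x0 r = {y \<in> ball x0 r. \<gamma> (y - (y \<bullet> e) *\<^sub>R e) < y \<bullet> e})"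

text \<open>The neighbourhood \<open>V\<close> is quantified existentially, for each point \<open>x0\<close> and before the
  test function.\<close>

definition viscosity_supersolution ::
    "(real ^ 'n) set \<Rightarrow> real \<Rightarrow> (real ^ 'n \<Rightarrow> real) \<Rightarrow> (real ^ 'n \<Rightarrow> real) \<Rightarrow> bool" where
  "viscosity_supersolution \<Omega> \<alpha> f u \<longleftrightarrow>
     continuous_on \<Omega> u \<and>
     (\<forall>x0\<in>\<Omega>. \<exists>V. open V \<and> x0 \<in> V \<and> closure V \<subseteq> \<Omega> \<and>
        (\<forall>\<phi>. C2_upto_closure V \<phi> \<and> u x0 = \<phi> x0 \<and>
              (\<forall>y\<in>V. u x0 - \<phi> x0 \<le> u y - \<phi> y) \<longrightarrow>
           (\<exists>L. has_regional_frac_laplacian \<Omega> \<alpha> (\<lambda>y. if y \<in> V then \<phi> y else u y) x0 L \<and>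
                L \<ge> f x0)))"

definition viscosity_subsolution ::
    "(real ^ 'n) set \<Rightarrow> real \<Rightarrow> (real ^ 'n \<Rightarrow> real) \<Rightarrow> (real ^ 'n \<Rightarrow> real) \<Rightarrow> bool" where
  "viscosity_subsolution \<Omega> \<alpha> f u \<longleftrightarrow>
     continuous_on \<Omega> u \<and>
     (\<forall>x0\<in>\<Omega>. \<exists>V. open V \<and> x0 \<in> V \<and> closure V \<subseteq> \<Omega> \<and>
        (\<forall>\<phi>. C2_upto_closure V \<phi> \<and> u x0 = \<phi> x0 \<and>
              (\<forall>y\<in>V. u y - \<phi> y \<le> u x0 - \<phi> x0) \<longrightarrow>
           (\<exists>L. has_regional_frac_laplacian \<Omega> \<alpha> (\<lambda>y. if y \<in> V then \<phi> y else u y) x0 L \<and>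
                L \<le> f x0)))"

definition viscosity_solution ::
    "(real ^ 'n) set \<Rightarrow> real \<Rightarrow> (real ^ 'n \<Rightarrow> real) \<Rightarrow> (real ^ 'n \<Rightarrow> real) \<Rightarrow> bool" where
  "viscosity_solution \<Omega> \<alpha> f u \<longleftrightarrow>
     viscosity_supersolution \<Omega> \<alpha> f u \<and> viscosity_subsolution \<Omega> \<alpha> f u"

definition vanishes_on_boundary :: "(real ^ 'n) set \<Rightarrow> (real ^ 'n \<Rightarrow> real) \<Rightarrow> bool" where
  "vanishes_on_boundary \<Omega> u \<longleftrightarrow> (\<forall>xb\<in>frontier \<Omega>. (u \<longlongrightarrow> 0) (at xb within \<Omega>))"

end

theory Submission
  imports Defs
begin

text \<open>
  The censored stable process, whose generator is the negative of the regional operator, does not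
  reach the boundary of a \<open>C\<^sup>2\<close> domain when \<open>\<alpha> \<le> 1/2\<close>.  A bounded superharmonic function is then
  governed by its values inside, and it cannot be positive in \<open>\<Omega>\<close> and decay to \<open>0\<close> at the
  boundary.  The proof turns this into a comparison with a barrier: a function \<open>b\<close> that tends to
  infinity at \<open>\<partial>\<Omega>\<close> and is strictly superharmonic near \<open>\<partial>\<Omega>\<close>
  (\<open>barrier_strictly_superharmonic\<close>).

  A nontrivial solution \<open>u \<ge> 0\<close> is positive in \<open>\<Omega>\<close> (\<open>supersolution_positive\<close>), whereas its infimum
  is \<open>0\<close>.  For small \<open>\<epsilon>\<close> the function \<open>u + \<epsilon> b\<close> therefore attains its minimum at a point \<open>x\<close> of
  \<open>\<Omega>\<close> close to the boundary.  There \<open>u\<close> is touched from below by a paraboloid, so the truncated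
  integrals of \<open>u(x) - u(z)\<close> against the kernel are asymptotically nonnegative
  (\<open>supersolution_quadratic_test\<close>).  But \<open>u(x) - u(z) \<le> \<epsilon> (b(z) - b(x))\<close>, and the integrals of the
  right-hand side stay below a negative number.

  The barrier is \<open>b = ln (ln (e R / \<rho>))\<close>, where \<open>\<rho>\<close> is a smooth function of the distance to
  \<open>\<partial>\<Omega>\<close>.  Given \<open>x\<close> near the boundary, let \<open>ball c R\<close> be the inner ball that touches \<open>\<partial>\<Omega>\<close> at the
  point nearest to \<open>x\<close>.  On it \<open>\<rho>(z) \<ge> q(z) = (R\<^sup>2 - |z - c|\<^sup>2) / (2 R)\<close>, with equality at \<open>x\<close>.
  The projective involution of this ball that fixes \<open>x\<close> sends \<open>x + \<xi>\<close> to \<open>x - \<xi> / t\<close> with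
  \<open>t = 1 + \<xi> \<bullet> m\<close>.  It divides \<open>q\<close> by \<open>t\<^sup>2\<close> and multiplies the measure
  \<open>|\<xi>|\<close> to the power \<open>- N - 2 \<alpha>\<close> times \<open>d\<xi>\<close> by \<open>t\<close> to the power \<open>2 \<alpha> - 1\<close>, a factor that is at
  most \<open>1\<close> on the half \<open>t \<ge> 1\<close>: this is where \<open>\<alpha> \<le> 1/2\<close> enters.  With \<open>Y\<^sub>0 = ln (e R / \<rho>(x))\<close>, the
  inner logarithm takes the values \<open>Y\<^sub>0 - ln t\<close> and \<open>Y\<^sub>0 + ln t\<close> at paired points, up to a small
  defect, and since the outer logarithm is concave their contributions add up to at most
  \<open>- (ln t)\<^sup>2 / Y\<^sub>0\<^sup>2\<close>.  Let \<open>d\<close> be the distance of \<open>x\<close> from the boundary.  The gain is of order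
  \<open>d\<close> to the power \<open>- 2 \<alpha>\<close>, divided by \<open>Y\<^sub>0\<^sup>2\<close>.  The defect, and the thin lens between the ball and the
  boundary, cost at most a multiple of \<open>d\<close> to the power \<open>- 3 \<alpha> / 2\<close> plus a constant
  (\<open>barrier_integral_le\<close>).  For \<open>\<alpha> = 1/2\<close> the factor is
  exactly \<open>1\<close>, a single logarithm would gain nothing, and concavity of the second one is decisive.
\<close>

section \<open>Averaging formulas and power integrals\<close>

lemma sets_borel_balls [measurable, simp]:
  "cball (c::'a::metric_space) r \<in> sets borel" "ball c r \<in> sets borel"
  by (auto intro: borel_closed borel_open)

lemma nn_integral_translate:
  fixes f :: "'a::euclidean_space \<Rightarrow> ennreal"
  assumes [measurable]: "f \<in> borel_measurable borel"
  shows "(\<integral>\<^sup>+ x. f (x + c) \<partial>lborel) = (\<integral>\<^sup>+ x. f x \<partial>lborel)"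
proof -
  have "(\<integral>\<^sup>+ x. f x \<partial>lborel) = (\<integral>\<^sup>+ x. f x \<partial>distr lborel borel ((+) c))"
    by (simp add: lborel_distr_plus)
  also have "\<dots> = (\<integral>\<^sup>+ x. f (c + x) \<partial>lborel)"
    by (subst nn_integral_distr) auto
  finally show ?thesis by (simp add: add.commute)
qed

lemma nn_integral_dilate:
  fixes f :: "'a::euclidean_space \<Rightarrow> ennreal"
  assumes [measurable]: "f \<in> borel_measurable borel" and c: "c \<noteq> 0"
  shows "(\<integral>\<^sup>+ x. f x \<partial>lborel) = ennreal (\<bar>c\<bar> ^ DIM('a)) * (\<integral>\<^sup>+ x. f (c *\<^sub>R x) \<partial>lborel)"
proof -
  have "(\<integral>\<^sup>+ x. f x \<partial>lborel)
      = (\<integral>\<^sup>+ x. f x \<partial>density (distr lborel borel (\<lambda>x. 0 + c *\<^sub>R x)) (\<lambda>_. \<bar>c\<bar>^DIM('a)))"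
    by (rule arg_cong[where f="\<lambda>M. \<integral>\<^sup>+ x. f x \<partial>M", OF lborel_affine[OF c, of 0]])
  also have "\<dots> = (\<integral>\<^sup>+ x. ennreal (\<bar>c\<bar>^DIM('a)) * f (c *\<^sub>R x) \<partial>lborel)"
    by (subst nn_integral_density) (auto simp: nn_integral_distr)
  also have "\<dots> = ennreal (\<bar>c\<bar> ^ DIM('a)) * (\<integral>\<^sup>+ x. f (c *\<^sub>R x) \<partial>lborel)"
    by (rule nn_integral_cmult) auto
  finally show ?thesis .
qed

text \<open>Averaging over translates in a direction \<open>e\<close> replaces Fubini's theorem along \<open>e\<close>, without a choice
  of coordinates adapted to \<open>e\<close>.\<close>

lemma nn_integral_translation_average:
  fixes f :: "'a::euclidean_space \<Rightarrow> ennreal"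
  assumes [measurable]: "f \<in> borel_measurable borel" and l: "0 \<le> l"
  shows "ennreal l * (\<integral>\<^sup>+ x. f x \<partial>lborel)
     = (\<integral>\<^sup>+ x. (\<integral>\<^sup>+ t. f (x + t *\<^sub>R e) * indicator {0..l} t \<partial>lborel) \<partial>lborel)"
proof -
  have "(\<integral>\<^sup>+ x. (\<integral>\<^sup>+ t. f (x + t *\<^sub>R e) * indicator {0..l} t \<partial>lborel) \<partial>lborel)
     = (\<integral>\<^sup>+ t. (\<integral>\<^sup>+ x. f (x + t *\<^sub>R e) * indicator {0..l} t \<partial>lborel) \<partial>lborel)"
    by (rule lborel_pair.Fubini') measurable
  also have "\<dots> = (\<integral>\<^sup>+ t. (\<integral>\<^sup>+ x. f x \<partial>lborel) * indicator {0..l} t \<partial>lborel)"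
    by (intro nn_integral_cong) (auto simp: nn_integral_multc nn_integral_translate)
  also have "\<dots> = (\<integral>\<^sup>+ x. f x \<partial>lborel) * ennreal l"
    using l by (simp add: nn_integral_cmult)
  finally show ?thesis by (simp add: mult.commute)
qed

text \<open>Integration along rays.  Averaging the dilates of \<open>f\<close> against \<open>dl / l\<close> over the shell
  \<open>1 \<le> |v| \<le> 2\<close> plays the role of the surface measure; each point \<open>x \<noteq> 0\<close> is hit for
  \<open>|x| / 2 \<le> l \<le> |x|\<close>, which is where \<open>ln 2\<close> comes from.\<close>

lemma nn_integral_polar:
  fixes f :: "'a::euclidean_space \<Rightarrow> ennreal"
  assumes [measurable]: "f \<in> borel_measurable borel"
  shows "ennreal (ln 2) * (\<integral>\<^sup>+ x. f x \<partial>lborel)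
     = (\<integral>\<^sup>+ v. (\<integral>\<^sup>+ l. ennreal (l ^ (DIM('a) - 1)) * f (l *\<^sub>R v) * indicator {0<..} l \<partial>lborel)
          * indicator {v. 1 \<le> norm v \<and> norm v \<le> 2} v \<partial>lborel)"
proof -
  let ?A = "{v::'a. 1 \<le> norm v \<and> norm v \<le> 2}"
  have [measurable]: "?A \<in> sets borel" by measurable
  have D: "0 < DIM('a)" by simp
  have "(\<integral>\<^sup>+ v. (\<integral>\<^sup>+ l. ennreal (l ^ (DIM('a) - 1)) * f (l *\<^sub>R v) * indicator {0<..} l \<partial>lborel)
          * indicator ?A v \<partial>lborel)
     = (\<integral>\<^sup>+ v. (\<integral>\<^sup>+ l. ennreal (l ^ (DIM('a) - 1)) * f (l *\<^sub>R v) * indicator {0<..} l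
          * indicator ?A v \<partial>lborel) \<partial>lborel)"
    by (intro nn_integral_cong nn_integral_multc[symmetric]) measurable
  also have "\<dots> = (\<integral>\<^sup>+ l. (\<integral>\<^sup>+ v. ennreal (l ^ (DIM('a) - 1)) * f (l *\<^sub>R v) * indicator {0<..} l
          * indicator ?A v \<partial>lborel) \<partial>lborel)"
    by (rule lborel_pair.Fubini') measurable
  also have "\<dots> = (\<integral>\<^sup>+ l. (\<integral>\<^sup>+ x. f x * (ennreal (1 / l) * (if norm x / 2 \<le> l \<and> l \<le> norm x then 1 else 0)) * indicator {0<..} l \<partial>lborel) \<partial>lborel)"
  proof (rule nn_integral_cong)
    fix l :: real
    show "(\<integral>\<^sup>+ v. ennreal (l ^ (DIM('a) - 1)) * f (l *\<^sub>R v) * indicator {0<..} l * indicator ?A v \<partial>lborel)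
      = (\<integral>\<^sup>+ x. f x * (ennreal (1 / l) * (if norm x / 2 \<le> l \<and> l \<le> norm x then 1 else 0)) * indicator {0<..} l \<partial>lborel)"
    proof (cases "l > 0")
      case True
      have "(\<integral>\<^sup>+ x. f x * (ennreal (1 / l) * (if norm x / 2 \<le> l \<and> l \<le> norm x then 1 else 0)) * indicator {0<..} l \<partial>lborel)
        = ennreal (\<bar>l\<bar> ^ DIM('a)) * (\<integral>\<^sup>+ x. f (l *\<^sub>R x) * (ennreal (1 / l) * (if norm (l *\<^sub>R x) / 2 \<le> l \<and> l \<le> norm (l *\<^sub>R x) then 1 else 0)) * indicator {0<..} l \<partial>lborel)"
        using True by (intro nn_integral_dilate) auto
      also have "\<dots> = (\<integral>\<^sup>+ x. ennreal (\<bar>l\<bar> ^ DIM('a)) * (f (l *\<^sub>R x) * (ennreal (1 / l) * (if norm (l *\<^sub>R x) / 2 \<le> l \<and> l \<le> norm (l *\<^sub>R x) then 1 else 0)) * indicator {0<..} l) \<partial>lborel)"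
        by (rule nn_integral_cmult[symmetric]) measurable
      also have "\<dots> = (\<integral>\<^sup>+ v. ennreal (l ^ (DIM('a) - 1)) * f (l *\<^sub>R v) * indicator {0<..} l * indicator ?A v \<partial>lborel)"
      proof (intro nn_integral_cong)
        fix x :: 'a
        have "ennreal (\<bar>l\<bar> ^ DIM('a)) * ennreal (1 / l) = ennreal (l ^ (DIM('a) - 1))"
        proof -
          obtain n where n: "DIM('a) = Suc n" using D gr0_implies_Suc by blast
          show ?thesis using True unfolding n by (subst ennreal_mult[symmetric]) auto
        qed
        moreover have "(if norm (l *\<^sub>R x) / 2 \<le> l \<and> l \<le> norm (l *\<^sub>R x) then 1 else 0) = (indicator ?A x :: ennreal)"
          using True by (auto simp: indicator_def)
        moreover have "a * (F * (b * i1) * i0) = (a * b) * F * i0 * i1" for a b F i0 i1 :: ennreal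
          by (simp only: mult_ac)
        ultimately show "ennreal (\<bar>l\<bar> ^ DIM('a)) * (f (l *\<^sub>R x) * (ennreal (1 / l) * (if norm (l *\<^sub>R x) / 2 \<le> l \<and> l \<le> norm (l *\<^sub>R x) then 1 else 0)) * indicator {0<..} l)
          = ennreal (l ^ (DIM('a) - 1)) * f (l *\<^sub>R x) * indicator {0<..} l * indicator ?A x"
          by (simp only:)
      qed
      finally show ?thesis by (rule sym)
    next
      case False
      then have "indicator {0<..} l = (0::ennreal)" by (simp add: indicator_def)
      then show ?thesis by (simp only: mult_zero_right mult_zero_left)
    qed
  qed
  also have "\<dots> = (\<integral>\<^sup>+ x. (\<integral>\<^sup>+ l. f x * (ennreal (1 / l) * (if norm x / 2 \<le> l \<and> l \<le> norm x then 1 else 0)) * indicator {0<..} l \<partial>lborel) \<partial>lborel)"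
    by (rule lborel_pair.Fubini') (measurable)
  also have "\<dots> = (\<integral>\<^sup>+ x. f x * ennreal (ln 2) \<partial>lborel)"
  proof (rule nn_integral_cong_AE)
    have "AE x in lborel. x \<noteq> (0::'a)" by (simp add: AE_lborel_singleton)
    then show "AE x in lborel. (\<integral>\<^sup>+ l. f x * (ennreal (1 / l) * (if norm x / 2 \<le> l \<and> l \<le> norm x then 1 else 0)) * indicator {0<..} l \<partial>lborel) = f x * ennreal (ln 2)"
    proof eventually_elim
      fix x :: 'a assume "x \<noteq> 0"
      then have nx: "norm x > 0" by simp
      have "(\<integral>\<^sup>+ l. f x * (ennreal (1 / l) * (if norm x / 2 \<le> l \<and> l \<le> norm x then 1 else 0)) * indicator {0<..} l \<partial>lborel)
        = (\<integral>\<^sup>+ l. f x * (ennreal (1 / l) * (if norm x / 2 \<le> l \<and> l \<le> norm x then 1 else 0)) \<partial>lborel)"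
        using nx by (intro nn_integral_cong) (auto simp: indicator_def)
      also have "\<dots> = f x * (\<integral>\<^sup>+ l. ennreal (1 / l) * (if norm x / 2 \<le> l \<and> l \<le> norm x then 1 else 0) \<partial>lborel)"
        by (rule nn_integral_cmult) measurable
      also have "(\<integral>\<^sup>+ l. ennreal (1 / l) * (if norm x / 2 \<le> l \<and> l \<le> norm x then 1 else 0) \<partial>lborel)
        = (\<integral>\<^sup>+ l. ennreal (1 / l) * indicator {norm x / 2..norm x} l \<partial>lborel)"
        by (intro nn_integral_cong) (auto simp: indicator_def)
      also have "\<dots> = ennreal (ln (norm x) - ln (norm x / 2))"
        using nx by (intro nn_integral_FTC_Icc) (auto intro!: derivative_eq_intros simp del: zero_less_norm_iff)
      also have "ln (norm x) - ln (norm x / 2) = ln 2"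
        using nx by (simp add: ln_div)
      finally show "(\<integral>\<^sup>+ l. f x * (ennreal (1 / l) * (if norm x / 2 \<le> l \<and> l \<le> norm x then 1 else 0)) * indicator {0<..} l \<partial>lborel) = f x * ennreal (ln 2)" .
    qed
  qed
  also have "\<dots> = (\<integral>\<^sup>+ x. f x \<partial>lborel) * ennreal (ln 2)"
    by (rule nn_integral_multc) measurable
  finally show ?thesis by (simp add: mult.commute)
qed

text \<open>The power of the norm is dominated by the average of \<open>l powr (- s)\<close> over \<open>|x| \<le> l \<le> 2 |x|\<close> against
  \<open>dl / l\<close>; exchanging the integrals leaves only the volumes of \<open>S \<inter> cball 0 l\<close>.\<close>

lemma nn_integral_norm_powr_le:
  fixes S :: "'a::euclidean_space set"
  assumes S[measurable]: "S \<in> sets borel" and s: "s \<ge> -1" and A: "A \<ge> 0" and a: "a \<ge> 0"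
    and vol: "\<And>l. a \<le> l \<Longrightarrow> 0 < l \<Longrightarrow> l \<le> 2 * D \<Longrightarrow> emeasure lborel (S \<inter> cball 0 l) \<le> ennreal (A * l powr b)"
    and SD: "\<And>x. x \<in> S \<Longrightarrow> a \<le> norm x \<and> norm x \<le> D"
  shows "(\<integral>\<^sup>+ x. ennreal (norm x powr (-s)) * indicator S x \<partial>lborel)
    \<le> ennreal (2 powr (s + 1) * A) * (\<integral>\<^sup>+ l. ennreal (l powr (b - s - 1)) * indicator ({a..} \<inter> {0<..2 * D}) l \<partial>lborel)"
proof -
  let ?c = "2 powr (s + 1)"
  have pt: "ennreal (norm x powr (-s)) * indicator S x
     \<le> (\<integral>\<^sup>+ l. ennreal ?c * (ennreal (l powr (-s-1)) * (if norm x \<le> l \<and> l \<le> 2 * norm x \<and> x \<in> S \<and> 0 < l then 1 else 0)) \<partial>lborel)" for x :: 'a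
  proof (cases "x = 0 \<or> x \<notin> S")
    case False
    then have nx: "norm x > 0" and xS: "x \<in> S" by auto
    have "ennreal (norm x powr (-s)) = ennreal (?c * (2 * norm x) powr (-s-1) * norm x)"
    proof -
      have "?c * (2 * norm x) powr (-s-1) * norm x = (2 powr (s+1) * 2 powr (-s-1)) * (norm x powr (-s-1) * norm x)"
        using nx by (simp add: powr_mult)
      also have "\<dots> = norm x powr (-s)"
        using nx by (simp add: powr_add[symmetric] powr_diff)
      finally show ?thesis by simp
    qed
    also have "\<dots> = (\<integral>\<^sup>+ l. ennreal (?c * (2 * norm x) powr (-s-1)) * indicator {norm x..2 * norm x} l \<partial>lborel)"
      using nx by (simp add: nn_integral_cmult ennreal_mult)
    also have "\<dots> \<le> (\<integral>\<^sup>+ l. ennreal ?c * (ennreal (l powr (-s-1)) * (if norm x \<le> l \<and> l \<le> 2 * norm x \<and> x \<in> S \<and> 0 < l then 1 else 0)) \<partial>lborel)"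
    proof (rule nn_integral_mono)
      fix l
      have "(2 * norm x) powr (-s-1) \<le> l powr (-s-1)" if "norm x \<le> l" "l \<le> 2 * norm x"
        using that nx s by (intro powr_mono2') (auto simp del: zero_less_norm_iff)
      then show "ennreal (?c * (2 * norm x) powr (-s-1)) * indicator {norm x..2 * norm x} l
        \<le> ennreal ?c * (ennreal (l powr (-s-1)) * (if norm x \<le> l \<and> l \<le> 2 * norm x \<and> x \<in> S \<and> 0 < l then 1 else 0))"
        using nx xS by (auto simp: indicator_def ennreal_mult[symmetric] simp del: zero_less_norm_iff intro!: ennreal_leI mult_left_mono)
    qed
    finally show ?thesis using xS by simp
  qed auto
  have "(\<integral>\<^sup>+ x. ennreal (norm x powr (-s)) * indicator S x \<partial>lborel)
    \<le> (\<integral>\<^sup>+ x. (\<integral>\<^sup>+ l. ennreal ?c * (ennreal (l powr (-s-1)) * (if norm x \<le> l \<and> l \<le> 2 * norm x \<and> x \<in> S \<and> 0 < l then 1 else 0)) \<partial>lborel) \<partial>lborel)"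
    by (rule nn_integral_mono) (rule pt)
  also have "\<dots> = (\<integral>\<^sup>+ l. (\<integral>\<^sup>+ x. ennreal ?c * (ennreal (l powr (-s-1)) * (if norm x \<le> l \<and> l \<le> 2 * norm x \<and> x \<in> S \<and> 0 < l then 1 else 0)) \<partial>lborel) \<partial>lborel)"
    by (rule lborel_pair.Fubini') measurable
  also have "\<dots> \<le> (\<integral>\<^sup>+ l. ennreal (?c * A) * (ennreal (l powr (b - s - 1)) * indicator ({a..} \<inter> {0<..2 * D}) l) \<partial>lborel)"
  proof (rule nn_integral_mono)
    fix l :: real
    have "(\<integral>\<^sup>+ x. ennreal ?c * (ennreal (l powr (-s-1)) * (if norm x \<le> l \<and> l \<le> 2 * norm x \<and> x \<in> S \<and> 0 < l then 1 else 0)) \<partial>lborel)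
      \<le> (\<integral>\<^sup>+ x. ennreal (?c * l powr (-s-1)) * (indicator (S \<inter> cball 0 l) x * indicator ({a..} \<inter> {0<..2 * D}) l) \<partial>lborel)"
      by (rule nn_integral_mono) (use SD in \<open>fastforce simp: indicator_def ennreal_mult dist_norm\<close>)
    also have "\<dots> = ennreal (?c * l powr (-s-1)) * (emeasure lborel (S \<inter> cball 0 l) * indicator ({a..} \<inter> {0<..2 * D}) l)"
    proof -
      have [measurable]: "S \<inter> cball 0 l \<in> sets borel" using S by simp
      show ?thesis by (simp add: nn_integral_cmult nn_integral_multc)
    qed
    also have "\<dots> \<le> ennreal (?c * l powr (-s-1)) * (ennreal (A * l powr b) * indicator ({a..} \<inter> {0<..2 * D}) l)"
      by (intro mult_left_mono) (auto simp: indicator_def intro!: vol)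
    also have "\<dots> = ennreal (?c * A) * (ennreal (l powr (b - s - 1)) * indicator ({a..} \<inter> {0<..2 * D}) l)"
    proof -
      have "?c * l powr (-s-1) * (A * l powr b) = ?c * A * l powr (b - s - 1)"
        by (simp add: powr_add[symmetric] algebra_simps powr_diff powr_minus)
           (auto simp: field_simps powr_add powr_diff powr_minus)
      then show ?thesis
        using A by (auto simp: indicator_def ennreal_mult[symmetric])
    qed
    finally show "(\<integral>\<^sup>+ x. ennreal ?c * (ennreal (l powr (-s-1)) * (if norm x \<le> l \<and> l \<le> 2 * norm x \<and> x \<in> S \<and> 0 < l then 1 else 0)) \<partial>lborel)
      \<le> ennreal (?c * A) * (ennreal (l powr (b - s - 1)) * indicator ({a..} \<inter> {0<..2 * D}) l)" .
  qed
  also have "\<dots> = ennreal (?c * A) * (\<integral>\<^sup>+ l. ennreal (l powr (b - s - 1)) * indicator ({a..} \<inter> {0<..2 * D}) l \<partial>lborel)"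
    by (rule nn_integral_cmult) measurable
  finally show ?thesis .
qed

definition ball_vol :: "'a::euclidean_space itself \<Rightarrow> real" where
  "ball_vol _ = measure lborel (ball (0::'a) 1)"

lemma emeasure_cball_eq_ball_vol:
  fixes c :: "'a::euclidean_space"
  assumes "l > 0"
  shows "emeasure lborel (cball c l) = ennreal (ball_vol TYPE('a) * l powr real DIM('a))"
    and "emeasure lborel (ball c l) = ennreal (ball_vol TYPE('a) * l powr real DIM('a))"
    and "ball_vol TYPE('a) > 0"
proof -
  have 1: "ball_vol TYPE('a) = unit_ball_vol (real DIM('a))"
    by (simp add: ball_vol_def content_ball)
  show "emeasure lborel (cball c l) = ennreal (ball_vol TYPE('a) * l powr real DIM('a))"
    using assms by (simp add: 1 emeasure_cball powr_realpow)
  show "emeasure lborel (ball c l) = ennreal (ball_vol TYPE('a) * l powr real DIM('a))"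
    using assms by (simp add: 1 emeasure_ball powr_realpow)
  show "ball_vol TYPE('a) > 0" by (simp add: 1)
qed

lemma nn_integral_norm_powr_cball:
  assumes s: "s \<ge> -1" "s < real DIM('a)" and r: "r > 0"
  shows "(\<integral>\<^sup>+ x. ennreal (norm x powr (-s)) * indicator (cball (0::'a::euclidean_space) r) x \<partial>lborel)
    \<le> ennreal (2 powr (s + 1) * ball_vol TYPE('a) * ((2 * r) powr (real DIM('a) - s) / (real DIM('a) - s)))"
proof -
  let ?N = "real DIM('a)"
  have "(\<integral>\<^sup>+ x. ennreal (norm x powr (-s)) * indicator (cball (0::'a::euclidean_space) r) x \<partial>lborel)
    \<le> ennreal (2 powr (s + 1) * ball_vol TYPE('a)) * (\<integral>\<^sup>+ l. ennreal (l powr (?N - s - 1)) * indicator ({0..} \<inter> {0<..2 * r}) l \<partial>lborel)"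
  proof (rule nn_integral_norm_powr_le)
    fix l :: real assume "0 < l"
    have "emeasure lborel (cball 0 r \<inter> cball (0::'a) l) \<le> emeasure lborel (cball (0::'a) l)"
      by (rule emeasure_mono) auto
    then show "emeasure lborel (cball 0 r \<inter> cball (0::'a) l) \<le> ennreal (ball_vol TYPE('a) * l powr ?N)"
      using emeasure_cball_eq_ball_vol(1)[OF \<open>0 < l\<close>, where 'a='a] by simp
  qed (use s emeasure_cball_eq_ball_vol(3)[of 1, where 'a='a] in \<open>auto simp: ball_vol_def\<close>)
  also have "(\<integral>\<^sup>+ l. ennreal (l powr (?N - s - 1)) * indicator ({0..} \<inter> {0<..2 * r}) l \<partial>lborel)
    = (\<integral>\<^sup>+ l. ennreal (l powr (?N - s - 1)) * indicator {0..2 * r} l \<partial>lborel)"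
    by (intro nn_integral_cong) (auto simp: indicator_def)
  also have "\<dots> = ennreal ((2 * r) powr (?N - s) / (?N - s))"
    using has_integral_powr_from_0[of "?N - s - 1" "2 * r"] s r
    by (intro nn_integral_has_integral_lebesgue') auto
  also have "ennreal (2 powr (s + 1) * ball_vol TYPE('a)) * \<dots> = ennreal (2 powr (s + 1) * ball_vol TYPE('a) * ((2 * r) powr (?N - s) / (?N - s)))"
    using s by (intro ennreal_mult[symmetric]) (auto simp: ball_vol_def)
  finally show ?thesis .
qed

text \<open>Translating by \<open>t e\<close> with \<open>0 \<le> t \<le> l\<close> keeps the set inside a ball of radius \<open>2 l\<close>, and each point
  of that ball is covered for a set of parameters of length at most \<open>2 h\<close>.\<close>

lemma emeasure_slab_cball_le:
  fixes e :: "'a::euclidean_space"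
  assumes e: "norm e = 1" and l: "l > 0" and h: "h \<ge> 0"
  shows "emeasure lborel {x \<in> cball 0 l. \<bar>x \<bullet> e + s\<bar> \<le> h}
    \<le> ennreal (2 * 2 powr real DIM('a) * ball_vol TYPE('a) * h * l powr (real DIM('a) - 1))"
proof -
  let ?N = "real DIM('a)" and ?V = "ball_vol TYPE('a)"
  let ?S = "{x::'a. norm x \<le> l \<and> \<bar>x \<bullet> e + s\<bar> \<le> h}"
  have [measurable]: "?S \<in> sets borel" by measurable
  have V: "?V \<ge> 0" by (simp add: ball_vol_def)
  have "ennreal l * (\<integral>\<^sup>+ x. indicator ?S x \<partial>lborel)
    = (\<integral>\<^sup>+ x. (\<integral>\<^sup>+ t. indicator ?S (x + t *\<^sub>R e) * indicator {0..l} t \<partial>lborel) \<partial>lborel)"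
    using l by (intro nn_integral_translation_average) auto
  also have "\<dots> \<le> (\<integral>\<^sup>+ x. ennreal (2 * h) * indicator (cball (0::'a) (2 * l)) x \<partial>lborel)"
  proof (rule nn_integral_mono)
    fix x :: 'a
    have "(\<integral>\<^sup>+ t. indicator ?S (x + t *\<^sub>R e) * indicator {0..l} t \<partial>lborel)
      \<le> (\<integral>\<^sup>+ t. indicator (cball 0 (2 * l)) x * indicator {- s - x \<bullet> e - h..- s - x \<bullet> e + h} t \<partial>lborel)"
    proof (rule nn_integral_mono)
      fix t
      have "norm x \<le> 2 * l" if "norm (x + t *\<^sub>R e) \<le> l" "0 \<le> t" "t \<le> l"
      proof -
        have "norm x \<le> norm (x + t *\<^sub>R e) + norm (t *\<^sub>R e)"
          by (metis add_diff_cancel_right' norm_triangle_ineq4)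
        then show ?thesis using that e by simp
      qed
      moreover have "e \<bullet> e = 1" using e by (simp add: norm_eq_1)
      ultimately show "indicator ?S (x + t *\<^sub>R e) * indicator {0..l} t
        \<le> (indicator (cball 0 (2 * l)) x * indicator {- s - x \<bullet> e - h..- s - x \<bullet> e + h} t :: ennreal)"
        by (auto simp: indicator_def inner_add_left dist_norm)
    qed
    also have "\<dots> = indicator (cball 0 (2 * l)) x * ennreal (2 * h)"
      using h by (simp add: nn_integral_cmult)
    finally show "(\<integral>\<^sup>+ t. indicator ?S (x + t *\<^sub>R e) * indicator {0..l} t \<partial>lborel) \<le> ennreal (2 * h) * indicator (cball 0 (2 * l)) x"
      by (simp add: mult.commute)
  qed
  also have "\<dots> = ennreal (2 * h) * ennreal (?V * (2 * l) powr ?N)"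
    using emeasure_cball_eq_ball_vol(1)[of "2 * l" "0::'a"] l by (subst nn_integral_cmult) auto
  also have "\<dots> = ennreal l * ennreal (2 * 2 powr ?N * ?V * h * l powr (?N - 1))"
    using l h V by (simp add: ennreal_mult[symmetric] powr_mult powr_diff)
  finally have "ennreal l * emeasure lborel ?S \<le> ennreal l * ennreal (2 * 2 powr ?N * ?V * h * l powr (?N - 1))"
    by simp
  then have "emeasure lborel ?S \<le> ennreal (2 * 2 powr ?N * ?V * h * l powr (?N - 1))"
    using l by (subst (asm) ennreal_mult_le_mult_iff) auto
  moreover have "{x \<in> cball 0 l. \<bar>x \<bullet> e + s\<bar> \<le> h} = ?S" by auto
  ultimately show ?thesis by simp
qed

section \<open>The projective reflection\<close>

text \<open>The substitution \<open>u = l / (1 + l s)\<close> maps the half-line onto an interval of length \<open>1 / s\<close>.  It is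
  first applied on \<open>[0, n]\<close>, and then \<open>n\<close> tends to infinity.\<close>

lemma nn_integral_moebius_halfline:
  fixes h :: "real \<Rightarrow> ennreal"
  assumes [measurable]: "h \<in> borel_measurable borel" and s: "s \<ge> 0"
  shows "(\<integral>\<^sup>+ u. h u * indicator {u. 0 \<le> u \<and> u * s < 1} u \<partial>lborel)
    = (\<integral>\<^sup>+ l. h (l / (1 + l * s)) * ennreal (1 / (1 + l * s)\<^sup>2) * indicator {0..} l \<partial>lborel)"
proof -
  let ?g = "\<lambda>l. l / (1 + l * s)"
  let ?A = "\<lambda>n::nat. {0..?g (real n)}" and ?B = "\<lambda>n::nat. {0..real n}"
  have pos: "1 + l * s > 0" if "l \<ge> 0" for l using that s by (simp add: add_pos_nonneg)
  have mono: "?g a \<le> ?g b" if "0 \<le> a" "a \<le> b" for a b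
  proof -
    have "0 \<le> b" using that by simp
    then show ?thesis using pos[OF that(1)] pos[of b] that s
      by (simp add: divide_simps) (simp add: algebra_simps)
  qed
  have UA: "(\<Union>n. ?A n) = {u. 0 \<le> u \<and> u * s < 1}"
  proof (intro set_eqI iffI)
    fix u assume "u \<in> (\<Union>n. ?A n)"
    then obtain n where n: "0 \<le> u" "u \<le> ?g (real n)" by auto
    have "u * s \<le> ?g (real n) * s" using n s by (intro mult_right_mono) auto
    also have "\<dots> < 1" using pos[of "real n"] by (simp add: divide_simps)
    finally show "u \<in> {u. 0 \<le> u \<and> u * s < 1}" using n by simp
  next
    fix u assume "u \<in> {u. 0 \<le> u \<and> u * s < 1}"
    then have u: "0 \<le> u" "u * s < 1" by auto
    obtain n :: nat where "u / (1 - u * s) \<le> real n" using real_arch_simple by blast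
    then have "u \<le> real n * (1 - u * s)" using u by (simp add: pos_divide_le_eq)
    then have "u \<le> ?g (real n)" using pos[of "real n"] by (simp add: pos_le_divide_eq algebra_simps)
    then show "u \<in> (\<Union>n. ?A n)" using u by auto
  qed
  have UB: "(\<Union>n. ?B n) = {0..}"
    by (auto simp: real_arch_simple)
  have eq: "emeasure (density lborel h) (?A n)
    = emeasure (density lborel (\<lambda>l. h (?g l) * ennreal (1 / (1 + l * s)\<^sup>2))) (?B n)" for n
  proof (cases "n = 0")
    case False
    have "(\<integral>\<^sup>+ u. h u * indicator {?g 0..?g (real n)} u \<partial>lborel)
      = (\<integral>\<^sup>+ l. h (?g l) * ennreal (1 / (1 + l * s)\<^sup>2) * indicator {0..real n} l \<partial>lborel)"
    proof (rule nn_integral_substitution_aux)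
      fix l assume l: "l \<in> {0..real n}"
      show "(?g has_real_derivative 1 / (1 + l * s)\<^sup>2) (at l)"
        using pos[of l] l by (auto intro!: derivative_eq_intros simp: power2_eq_square)
    next
      have "\<forall>x\<in>{0..real n}. 1 + x * s \<noteq> 0" using pos by force
      then show "continuous_on {0..real n} (\<lambda>l. 1 / (1 + l * s)\<^sup>2)"
        by (auto intro!: continuous_intros)
    qed (use False in auto)
    then show ?thesis by (simp add: emeasure_density)
  qed (simp add: emeasure_density nn_integral_null_set[where M=lborel] null_sets_def)
  have "emeasure (density lborel h) (\<Union>n. ?A n) = (SUP n. emeasure (density lborel h) (?A n))"
    by (rule SUP_emeasure_incseq[symmetric]) (auto simp: incseq_def intro: order_trans[OF _ mono])
  also have "\<dots> = (SUP n. emeasure (density lborel (\<lambda>l. h (?g l) * ennreal (1 / (1 + l * s)\<^sup>2))) (?B n))"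
    by (simp only: eq)
  also have "\<dots> = emeasure (density lborel (\<lambda>l. h (?g l) * ennreal (1 / (1 + l * s)\<^sup>2))) (\<Union>n. ?B n)"
    by (rule SUP_emeasure_incseq) (auto simp: incseq_def)
  finally have "emeasure (density lborel h) {u. 0 \<le> u \<and> u * s < 1}
    = emeasure (density lborel (\<lambda>l. h (?g l) * ennreal (1 / (1 + l * s)\<^sup>2))) {0..}"
    by (simp only: UA UB)
  then show ?thesis by (simp add: emeasure_density)
qed

text \<open>The map \<open>x \<mapsto> - x / (1 + x \<bullet> m)\<close> preserves every line through the origin and acts on it as a Moebius
  transformation, so its Jacobian \<open>(1 + x \<bullet> m)\<close> to the power \<open>- (N + 1)\<close> can be read off in polar form.\<close>

lemma nn_integral_projective_reflection:
  fixes f :: "'a::euclidean_space \<Rightarrow> ennreal"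
  assumes [measurable]: "f \<in> borel_measurable borel"
  shows "(\<integral>\<^sup>+ x. f x * indicator {x. -1 < x \<bullet> m \<and> x \<bullet> m \<le> 0} x \<partial>lborel)
    = (\<integral>\<^sup>+ x. f (- (1 / (1 + x \<bullet> m)) *\<^sub>R x) * ennreal (1 / (1 + x \<bullet> m) ^ (DIM('a) + 1))
         * indicator {x. 0 \<le> x \<bullet> m} x \<partial>lborel)"
proof -
  obtain n where D: "DIM('a) = Suc n" using DIM_positive gr0_implies_Suc by blast
  define F where "F = (\<lambda>x. f (- x) * indicator {x. 0 \<le> x \<bullet> m \<and> x \<bullet> m < 1} x)"
  define G where "G = (\<lambda>x. f (- (1 / (1 + x \<bullet> m)) *\<^sub>R x) * ennreal (1 / (1 + x \<bullet> m) ^ (DIM('a) + 1))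
         * indicator {x. 0 \<le> x \<bullet> m} x)"
  have [measurable]: "F \<in> borel_measurable borel" "G \<in> borel_measurable borel"
    unfolding F_def G_def by measurable
  have line: "(\<integral>\<^sup>+ l. ennreal (l ^ n) * F (l *\<^sub>R v) * indicator {0<..} l \<partial>lborel)
      = (\<integral>\<^sup>+ l. ennreal (l ^ n) * G (l *\<^sub>R v) * indicator {0<..} l \<partial>lborel)" for v
  proof (cases "v \<bullet> m \<ge> 0")
    case False
    then have "F (l *\<^sub>R v) = 0" "G (l *\<^sub>R v) = 0" if "l > 0" for l
      using that by (auto simp: F_def G_def indicator_def zero_le_mult_iff)
    then show ?thesis by (intro nn_integral_cong) (auto simp: indicator_def)
  next
    case True
    let ?s = "v \<bullet> m"
    let ?h = "\<lambda>u. ennreal (u ^ n) * f (- u *\<^sub>R v) * indicator {0<..} u"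
    have "(\<integral>\<^sup>+ l. ennreal (l ^ n) * F (l *\<^sub>R v) * indicator {0<..} l \<partial>lborel)
      = (\<integral>\<^sup>+ u. ?h u * indicator {u. 0 \<le> u \<and> u * ?s < 1} u \<partial>lborel)"
      using True by (intro nn_integral_cong) (auto simp: F_def indicator_def)
    also have "\<dots> = (\<integral>\<^sup>+ l. ?h (l / (1 + l * ?s)) * ennreal (1 / (1 + l * ?s)\<^sup>2) * indicator {0..} l \<partial>lborel)"
      by (rule nn_integral_moebius_halfline) (use True in measurable)
    also have "\<dots> = (\<integral>\<^sup>+ l. ennreal (l ^ n) * G (l *\<^sub>R v) * indicator {0<..} l \<partial>lborel)"
    proof (rule nn_integral_cong)
      fix l :: real
      show "?h (l / (1 + l * ?s)) * ennreal (1 / (1 + l * ?s)\<^sup>2) * indicator {0..} l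
        = ennreal (l ^ n) * G (l *\<^sub>R v) * indicator {0<..} l"
      proof (cases "l > 0")
        case l: True
        then have p: "1 + l * ?s > 0" using True by (simp add: add_pos_nonneg)
        have "ennreal ((l / (1 + l * ?s)) ^ n) * ennreal (1 / (1 + l * ?s)\<^sup>2)
          = ennreal (l ^ n) * ennreal (1 / (1 + l * ?s) ^ (DIM('a) + 1))"
        proof -
          have "(l / (1 + l * ?s)) ^ n * (1 / (1 + l * ?s)\<^sup>2) = l ^ n * (1 / (1 + l * ?s) ^ (DIM('a) + 1))"
            unfolding D by (simp add: power_divide power2_eq_square)
          then show ?thesis
            using p l by (simp only: ennreal_mult''[symmetric] zero_le_divide_1_iff zero_le_power less_imp_le)
        qed
        from arg_cong[OF this, of "\<lambda>a. a * X" for X]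
        have "ennreal ((l / (1 + l * ?s)) ^ n) * X * ennreal (1 / (1 + l * ?s)\<^sup>2)
          = ennreal (l ^ n) * (X * ennreal (1 / (1 + l * ?s) ^ (DIM('a) + 1)))" for X
          by (simp only: mult_ac)
        then show ?thesis
          using l True p by (simp add: G_def indicator_def)
      qed (auto simp: indicator_def)
    qed
    finally show ?thesis .
  qed
  have "(\<integral>\<^sup>+ x. f x * indicator {x. -1 < x \<bullet> m \<and> x \<bullet> m \<le> 0} x \<partial>lborel) = (\<integral>\<^sup>+ x. F x \<partial>lborel)"
    by (subst nn_integral_dilate[of _ "-1"]) (auto simp: F_def indicator_def intro!: nn_integral_cong)
  moreover have "ennreal (ln 2) * (\<integral>\<^sup>+ x. F x \<partial>lborel) = ennreal (ln 2) * (\<integral>\<^sup>+ x. G x \<partial>lborel)"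
    using nn_integral_polar[of F] nn_integral_polar[of G] by (simp add: line D)
  then have "(\<integral>\<^sup>+ x. F x \<partial>lborel) = (\<integral>\<^sup>+ x. G x \<partial>lborel)"
    by (subst (asm) ennreal_mult_cancel_left) auto
  ultimately show ?thesis by (simp add: G_def)
qed

section \<open>Moments of the kernel and polynomial test functions\<close>

lemma set_integrable_kernel_off_ball:
  fixes x :: "'a::euclidean_space"
  assumes S: "S \<in> sets borel" "bounded S" and r: "r > 0" and p: "p \<ge> 0"
    and g: "set_borel_measurable lborel S g" and B: "\<And>z. z \<in> S \<Longrightarrow> \<bar>g z\<bar> \<le> B"
  shows "set_integrable lborel (S - ball x r) (\<lambda>z. g z / norm (z - x) powr p)"
proof -
  have gm[measurable]: "(\<lambda>z. indicator S z * g z) \<in> borel_measurable borel"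
    using g by (simp add: set_borel_measurable_def)
  have Sm[measurable]: "S - ball x r \<in> sets borel" using S by simp
  have "emeasure lborel S < \<infinity>" using S by (intro emeasure_bounded_finite)
  then have fin: "emeasure lborel (S - ball x r) < \<infinity>"
    using emeasure_mono[of "S - ball x r" S lborel] S by (auto intro: le_less_trans)
  have eq: "indicator (S - ball x r) z * (indicator S z * g z / norm (z - x) powr p)
     = indicator (S - ball x r) z *\<^sub>R (g z / norm (z - x) powr p)" for z
    by (auto simp: indicator_def)
  have "integrable lborel (\<lambda>z. indicator (S - ball x r) z * (indicator S z * g z / norm (z - x) powr p))"
  proof (rule integrableI_bounded_set[where A="S - ball x r" and B="B / r powr p"])
    show "AE z in lborel. z \<in> S - ball x r \<longrightarrow> norm (indicator (S - ball x r) z * (indicator S z * g z / norm (z - x) powr p)) \<le> B / r powr p"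
    proof (rule AE_I2, rule impI)
      fix z assume z: "z \<in> S - ball x r"
      then have "\<bar>g z\<bar> \<le> B" "r \<le> norm (z - x)" using B by (auto simp: dist_norm norm_minus_commute)
      moreover have "r powr p \<le> norm (z - x) powr p" using \<open>r \<le> norm (z - x)\<close> r p by (intro powr_mono2) auto
      ultimately have "\<bar>g z\<bar> / norm (z - x) powr p \<le> B / r powr p"
        using r by (intro frac_le) auto
      then show "norm (indicator (S - ball x r) z * (indicator S z * g z / norm (z - x) powr p)) \<le> B / r powr p"
        using z by (simp add: abs_mult)
    qed
  qed (use fin in \<open>auto simp: Sm\<close>)
  then show ?thesis unfolding set_integrable_def by (simp only: eq)
qed

text \<open>Near the singularity the kernel is integrable against \<open>|z - x|\<^sup>2\<close>, with a bound that vanishes as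
  the radius tends to \<open>0\<close>.  This absorbs every second order error at the base point.\<close>

lemma second_moment:
  fixes x :: "'a::euclidean_space"
  assumes a: "0 < a" "a < 1" and r: "r > 0"
  defines "C \<equiv> 2 powr (real DIM('a) + 2 * a - 1) * ball_vol TYPE('a) * 2 powr (2 - 2 * a) / (2 - 2 * a)"
  shows "set_integrable lborel (ball x r) (\<lambda>z. (norm (z - x))\<^sup>2 / norm (z - x) powr (real DIM('a) + 2 * a))"
    and "(LINT z:ball x r|lborel. (norm (z - x))\<^sup>2 / norm (z - x) powr (real DIM('a) + 2 * a)) \<le> C * r powr (2 - 2 * a)"
    and "C \<ge> 0"
proof -
  let ?N = "real DIM('a)"
  show C: "C \<ge> 0" using a by (simp add: C_def ball_vol_def)
  let ?f = "\<lambda>z. indicator (ball x r) z * ((norm (z - x))\<^sup>2 / norm (z - x) powr (?N + 2 * a))"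
  have f: "?f \<in> borel_measurable lborel" by measurable
  have pw: "(norm y)\<^sup>2 / norm y powr (?N + 2 * a) = norm y powr (- (?N + 2 * a - 2))" for y :: 'a
  proof (cases "y = 0")
    case False
    then have "(norm y)\<^sup>2 = norm y powr 2" by simp
    then show ?thesis by (metis minus_diff_eq powr_diff)
  qed auto
  have N1: "?N + 2 * a - 2 \<ge> -1"
    using a DIM_positive[where 'a='a] by linarith
  have "(\<integral>\<^sup>+ z. ennreal (?f z) \<partial>lborel) \<le> (\<integral>\<^sup>+ z. ennreal (norm (z + - x) powr (- (?N + 2 * a - 2))) * indicator (cball 0 r) (z + - x) \<partial>lborel)"
    by (rule nn_integral_mono) (auto simp: indicator_def dist_norm norm_minus_commute pw)
  also have "\<dots> = (\<integral>\<^sup>+ z. ennreal (norm (z::'a) powr (- (?N + 2 * a - 2))) * indicator (cball 0 r) z \<partial>lborel)"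
    by (rule nn_integral_translate[where f="\<lambda>z. ennreal (norm z powr (- (?N + 2 * a - 2))) * indicator (cball 0 r) z"]) measurable
  also have "\<dots> \<le> ennreal (2 powr (?N + 2 * a - 2 + 1) * ball_vol TYPE('a) * ((2 * r) powr (?N - (?N + 2 * a - 2)) / (?N - (?N + 2 * a - 2))))"
    by (rule nn_integral_norm_powr_cball) (use a r N1 in auto)
  also have "2 powr (?N + 2 * a - 2 + 1) * ball_vol TYPE('a) * ((2 * r) powr (?N - (?N + 2 * a - 2)) / (?N - (?N + 2 * a - 2))) = C * r powr (2 - 2 * a)"
    using r by (simp add: C_def powr_mult)
  finally have le: "(\<integral>\<^sup>+ z. ennreal (?f z) \<partial>lborel) \<le> ennreal (C * r powr (2 - 2 * a))" .
  have int: "integrable lborel ?f"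
  proof (rule integrableI_bounded[OF f])
    have "(\<integral>\<^sup>+ z. ennreal (norm (?f z)) \<partial>lborel) = (\<integral>\<^sup>+ z. ennreal (?f z) \<partial>lborel)"
      by (intro nn_integral_cong) (auto simp: indicator_def)
    also have "\<dots> < \<infinity>" using le by (rule le_less_trans) simp
    finally show "(\<integral>\<^sup>+ z. ennreal (norm (?f z)) \<partial>lborel) < \<infinity>" .
  qed
  then show "set_integrable lborel (ball x r) (\<lambda>z. (norm (z - x))\<^sup>2 / norm (z - x) powr (?N + 2 * a))"
    by (simp add: set_integrable_def)
  have "ennreal (\<integral> z. ?f z \<partial>lborel) = (\<integral>\<^sup>+ z. ennreal (?f z) \<partial>lborel)"
    by (rule nn_integral_eq_integral[symmetric, OF int]) (auto simp: indicator_def)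
  then have "ennreal (\<integral> z. ?f z \<partial>lborel) \<le> ennreal (C * r powr (2 - 2 * a))" using le by simp
  then show "(LINT z:ball x r|lborel. (norm (z - x))\<^sup>2 / norm (z - x) powr (?N + 2 * a)) \<le> C * r powr (2 - 2 * a)"
    using C r by (subst (asm) ennreal_le_iff) (auto simp: set_lebesgue_integral_def)
qed

text \<open>The reflection in \<open>x\<close> changes the sign of the integrand.  A non-integrable integrand has the
  default integral \<open>0\<close>.\<close>

lemma annulus_odd_integral_zero:
  fixes x v :: "'a::euclidean_space"
  shows "(LINT z:ball x r - ball x s|lborel. (v \<bullet> (z - x)) / norm (z - x) powr p) = 0"
proof -
  let ?f = "\<lambda>z. indicator (ball x r - ball x s) z *\<^sub>R ((v \<bullet> (z - x)) / norm (z - x) powr p)"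
  have eq: "(lborel :: 'a measure) = distr lborel borel (\<lambda>z. 2 *\<^sub>R x + (-1) *\<^sub>R z)"
  proof -
    have "(lborel :: 'a measure) = density (distr lborel borel (\<lambda>z. 2 *\<^sub>R x + (-1) *\<^sub>R z)) (\<lambda>_. ennreal (\<bar>-1\<bar>^DIM('a)))"
      by (rule lborel_affine) simp
    also have "\<dots> = distr lborel borel (\<lambda>z. 2 *\<^sub>R x + (-1) *\<^sub>R z)"
      by (simp add: density_1)
    finally show ?thesis .
  qed
  have "(\<integral> z. ?f z \<partial>lborel) = (\<integral> z. ?f z \<partial>distr lborel borel (\<lambda>z. 2 *\<^sub>R x + (-1) *\<^sub>R z))"
    by (rule arg_cong[where f="\<lambda>M. \<integral> z. ?f z \<partial>M", OF eq])
  also have "\<dots> = (\<integral> z. ?f (2 *\<^sub>R x + (-1) *\<^sub>R z) \<partial>lborel)"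
    by (rule integral_distr) measurable
  also have "\<dots> = (\<integral> z. - ?f z \<partial>lborel)"
  proof (rule Bochner_Integration.integral_cong[OF refl])
    fix z
    have e: "2 *\<^sub>R x + (-1) *\<^sub>R z - x = - (z - x)" by (simp add: scaleR_2)
    have "norm (2 *\<^sub>R x + (-1) *\<^sub>R z - x) = norm (z - x)" unfolding e by (rule norm_minus_cancel)
    moreover have "v \<bullet> (2 *\<^sub>R x + (-1) *\<^sub>R z - x) = - (v \<bullet> (z - x))" unfolding e by (rule inner_minus_right)
    moreover have "2 *\<^sub>R x + (-1) *\<^sub>R z \<in> ball x r - ball x s \<longleftrightarrow> z \<in> ball x r - ball x s"
      unfolding Diff_iff mem_ball dist_norm using \<open>norm (2 *\<^sub>R x + (-1) *\<^sub>R z - x) = norm (z - x)\<close>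
      by (metis norm_minus_commute)
    ultimately show "?f (2 *\<^sub>R x + (-1) *\<^sub>R z) = - ?f z" by (simp add: indicator_def)
  qed
  also have "\<dots> = - (\<integral> z. ?f z \<partial>lborel)" by simp
  finally show ?thesis by (simp add: set_lebesgue_integral_def)
qed

text \<open>Polynomials are the only test functions that occur below.\<close>

lemma real_polynomial_function_C2:
  fixes p :: "real ^ 'n \<Rightarrow> real"
  assumes "real_polynomial_function p"
  shows "C2_upto_closure V p"
proof -
  define outer :: "real^'n \<Rightarrow> real^'n \<Rightarrow> real^'n^'n" where "outer = (\<lambda>a b. \<chi> i j. a $ i * b $ j)"
  have outer: "outer a b *v h = (b \<bullet> h) *\<^sub>R a" for a b h
    by (simp add: outer_def matrix_vector_mult_def vec_eq_iff inner_vec_def sum_distrib_left algebra_simps)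
  have cont_outer: "continuous_on UNIV (\<lambda>x. outer (a x) (b x))"
    if "continuous_on UNIV a" "continuous_on UNIV b" for a b :: "real^'n \<Rightarrow> real^'n"
    unfolding outer_def using that by (intro continuous_on_vec_lambda continuous_intros)
  have "\<exists>(g :: real ^ 'n \<Rightarrow> real ^ 'n) (H :: real ^ 'n \<Rightarrow> real ^ 'n ^ 'n).
      (\<forall>x. (p has_derivative (\<lambda>h. g x \<bullet> h)) (at x)) \<and>
      (\<forall>x. (g has_derivative (\<lambda>h. H x *v h)) (at x)) \<and> continuous_on UNIV H"
    using assms
  proof induction
    case (linear f)
    have l: "linear f" using linear.hyps by (rule bounded_linear.linear)
    have 1: "adjoint f 1 \<bullet> h = f h" for h
      using adjoint_works[OF l, of h 1] by (simp add: inner_commute)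
    show ?case
      by (rule exI[of _ "\<lambda>x. adjoint f 1"], rule exI[of _ "\<lambda>x. 0"])
         (auto simp: 1 intro!: bounded_linear_imp_has_derivative linear.hyps continuous_intros derivative_eq_intros)
  next
    case (const c)
    show ?case
      by (rule exI[of _ "\<lambda>x. 0"], rule exI[of _ "\<lambda>x. 0"]) (auto intro!: continuous_intros derivative_eq_intros)
  next
    case (add f1 f2)
    then obtain g1 H1 g2 H2 where *:
      "\<forall>x. (f1 has_derivative (\<lambda>h. g1 x \<bullet> h)) (at x)" "\<forall>x. (g1 has_derivative (\<lambda>h. H1 x *v h)) (at x)" "continuous_on UNIV H1"
      "\<forall>x. (f2 has_derivative (\<lambda>h. g2 x \<bullet> h)) (at x)" "\<forall>x. (g2 has_derivative (\<lambda>h. H2 x *v h)) (at x)" "continuous_on UNIV H2"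
      by blast
    have "((\<lambda>x. f1 x + f2 x) has_derivative (\<lambda>h. (g1 x + g2 x) \<bullet> h)) (at x)" for x
      using has_derivative_add[OF *(1)[rule_format, of x] *(4)[rule_format, of x]] by (simp add: inner_add_left)
    moreover have "((\<lambda>x. g1 x + g2 x) has_derivative (\<lambda>h. (H1 x + H2 x) *v h)) (at x)" for x
      using has_derivative_add[OF *(2)[rule_format, of x] *(5)[rule_format, of x]] by (simp add: matrix_vector_mult_add_rdistrib)
    moreover have "continuous_on UNIV (\<lambda>x. H1 x + H2 x)" using * by (intro continuous_intros)
    ultimately show ?case
      by (intro exI[of _ "\<lambda>x. g1 x + g2 x"] exI[of _ "\<lambda>x. H1 x + H2 x"] conjI allI)
  next
    case (mult f1 f2)
    then obtain g1 H1 g2 H2 where *: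
      "\<forall>x. (f1 has_derivative (\<lambda>h. g1 x \<bullet> h)) (at x)" "\<forall>x. (g1 has_derivative (\<lambda>h. H1 x *v h)) (at x)" "continuous_on UNIV H1"
      "\<forall>x. (f2 has_derivative (\<lambda>h. g2 x \<bullet> h)) (at x)" "\<forall>x. (g2 has_derivative (\<lambda>h. H2 x *v h)) (at x)" "continuous_on UNIV H2"
      by blast
    have c: "continuous_on UNIV f1" "continuous_on UNIV g1" "continuous_on UNIV f2" "continuous_on UNIV g2"
      using * by (auto simp: continuous_on_eq_continuous_at intro: has_derivative_continuous)
    let ?g = "\<lambda>x. f1 x *\<^sub>R g2 x + f2 x *\<^sub>R g1 x"
    let ?H = "\<lambda>x. f1 x *\<^sub>R H2 x + outer (g2 x) (g1 x) + (f2 x *\<^sub>R H1 x + outer (g1 x) (g2 x))"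
    have "((\<lambda>x. f1 x * f2 x) has_derivative (\<lambda>h. ?g x \<bullet> h)) (at x)" for x
      using has_derivative_mult[OF *(1)[rule_format, of x] *(4)[rule_format, of x]]
      by (simp add: inner_add_left mult.commute)
    moreover have "(?g has_derivative (\<lambda>h. ?H x *v h)) (at x)" for x
      using has_derivative_add[OF has_derivative_scaleR[OF *(1)[rule_format, of x] *(5)[rule_format, of x]]
             has_derivative_scaleR[OF *(4)[rule_format, of x] *(2)[rule_format, of x]]]
      by (simp add: matrix_vector_mult_add_rdistrib outer scaleR_matrix_vector_assoc)
    moreover have "continuous_on UNIV ?H" using * c by (intro continuous_intros cont_outer)
    ultimately show ?case
      by (intro exI[of _ ?g] exI[of _ ?H] conjI allI)
  qed
  then obtain g H where *: "\<forall>x. (p has_derivative (\<lambda>h. g x \<bullet> h)) (at x)"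
    "\<forall>x. (g has_derivative (\<lambda>h. H x *v h)) (at x)" "continuous_on UNIV H" by blast
  have "continuous_on UNIV p" "continuous_on UNIV g"
    using * by (auto simp: continuous_on_eq_continuous_at intro: has_derivative_continuous)
  then show ?thesis unfolding C2_upto_closure_def using *
    by (meson continuous_on_subset subset_UNIV)
qed

section \<open>Touching balls and the boundary distance in a smooth domain\<close>

text \<open>On a ball the Hessian is bounded by compactness, the gradient is Lipschitz, and the mean value
  theorem gives the quadratic remainder.\<close>

lemma C2_taylor_bound:
  fixes \<gamma> :: "real ^ 'n \<Rightarrow> real"
  assumes "C2_upto_closure UNIV \<gamma>"
  obtains g where "\<And>x. (\<gamma> has_derivative (\<lambda>h. g x \<bullet> h)) (at x)" "continuous_on UNIV g"
    "\<And>\<rho>. \<exists>K\<ge>0. \<forall>a\<in>ball 0 \<rho>. \<forall>b\<in>ball 0 \<rho>. \<bar>\<gamma> b - \<gamma> a - g a \<bullet> (b - a)\<bar> \<le> K * (norm (b - a))\<^sup>2"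
proof -
  obtain g H where g: "\<And>x. (\<gamma> has_derivative (\<lambda>h. g x \<bullet> h)) (at x)"
    and H: "\<And>x. (g has_derivative (\<lambda>h. H x *v h)) (at x)"
    and c: "continuous_on UNIV g" "continuous_on UNIV H"
    using assms unfolding C2_upto_closure_def by (auto simp: )
  have "\<exists>K\<ge>0. \<forall>a\<in>ball 0 \<rho>. \<forall>b\<in>ball 0 \<rho>. \<bar>\<gamma> b - \<gamma> a - g a \<bullet> (b - a)\<bar> \<le> K * (norm (b - a))\<^sup>2" for \<rho>
  proof -
    have "compact ((\<lambda>x. norm (H x)) ` cball 0 \<rho>)"
      by (intro compact_continuous_image continuous_on_norm continuous_on_subset[OF c(2)]) auto
    then have "bounded ((\<lambda>x. norm (H x)) ` cball 0 \<rho>)" by (rule compact_imp_bounded)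
    then obtain M where M: "M > 0" "\<And>x. x \<in> cball 0 \<rho> \<Longrightarrow> norm (H x) \<le> M"
      by (auto simp: bounded_pos)
    obtain B :: real where B: "B > 0" "\<And>(A::real^'n^'n) h. norm (A *v h) \<le> norm A * norm h * B"
      
    proof -
      have "bilinear ((*v) :: real^'n^'n \<Rightarrow> _)"
        unfolding bilinear_def linear_iff
        by (simp add: matrix_vector_mult_add_rdistrib matrix_vector_right_distrib scaleR_matrix_vector_assoc
            matrix_vector_mult_scaleR)
      then have "bounded_bilinear ((*v) :: real^'n^'n \<Rightarrow> _)" by (simp add: bilinear_conv_bounded_bilinear)
      then show ?thesis using that bounded_bilinear.pos_bounded by blast
    qed
    have lip: "norm (g b - g a) \<le> (M * B) * norm (b - a)" if "a \<in> ball 0 \<rho>" "b \<in> ball 0 \<rho>" for a b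
    proof (rule differentiable_bound[where S="ball 0 \<rho>" and f'="\<lambda>x h. H x *v h"])
      fix x :: "real^'n" assume x: "x \<in> ball 0 \<rho>"
      show "(g has_derivative (\<lambda>h. H x *v h)) (at x within ball 0 \<rho>)"
        using H by (rule has_derivative_at_withinI)
      show "onorm (\<lambda>h. H x *v h) \<le> M * B"
      proof (rule onorm_le)
        fix h
        have "norm (H x *v h) \<le> norm (H x) * norm h * B" by (rule B)
        also have "\<dots> \<le> M * norm h * B" using M(2)[of x] x B by (intro mult_right_mono) auto
        finally show "norm (H x *v h) \<le> M * B * norm h" by (simp add: mult_ac)
      qed
    qed (use that in auto)
    show ?thesis
    proof (intro exI[of _ "M * B"] conjI ballI)
      show "0 \<le> M * B" using M B by simp
      fix a b :: "real^'n" assume ab: "a \<in> ball 0 \<rho>" "b \<in> ball 0 \<rho>"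
      have seg: "closed_segment a b \<subseteq> ball 0 \<rho>" using ab by (intro closed_segment_subset) auto
      have "norm ((\<gamma> b - g a \<bullet> b) - (\<gamma> a - g a \<bullet> a)) \<le> (M * B * norm (b - a)) * norm (b - a)"
      proof (rule differentiable_bound[where S="closed_segment a b" and f'="\<lambda>x h. g x \<bullet> h - g a \<bullet> h"])
        fix x assume x: "x \<in> closed_segment a b"
        show "((\<lambda>x. \<gamma> x - g a \<bullet> x) has_derivative (\<lambda>h. g x \<bullet> h - g a \<bullet> h)) (at x within closed_segment a b)"
          by (intro has_derivative_diff has_derivative_at_withinI[OF g] bounded_linear_imp_has_derivative bounded_linear_inner_right)
        show "onorm (\<lambda>h. g x \<bullet> h - g a \<bullet> h) \<le> M * B * norm (b - a)"
        proof (rule onorm_le)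
          fix h
          have "norm (g x \<bullet> h - g a \<bullet> h) = \<bar>(g x - g a) \<bullet> h\<bar>" by (simp add: inner_diff_left)
          also have "\<dots> \<le> norm (g x - g a) * norm h" by (rule Cauchy_Schwarz_ineq2)
          also have "\<dots> \<le> (M * B * norm (x - a)) * norm h"
            using lip[of a x] ab x seg by (intro mult_right_mono) auto
          also have "\<dots> \<le> (M * B * norm (b - a)) * norm h"
            using M B segment_bound1[OF x] by (intro mult_right_mono mult_left_mono) (auto simp: norm_minus_commute)
          finally show "norm (g x \<bullet> h - g a \<bullet> h) \<le> M * B * norm (b - a) * norm h" .
        qed
      qed auto
      then show "\<bar>\<gamma> b - \<gamma> a - g a \<bullet> (b - a)\<bar> \<le> M * B * (norm (b - a))\<^sup>2"
        by (simp add: inner_diff_right power2_eq_square algebra_simps)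
    qed
  qed
  with g c show ?thesis using that by blast
qed

text \<open>The local description of the boundary by the function \<open>F(z) = z \<bullet> e - \<gamma>(P z)\<close>, with \<open>P\<close> the
  projection along \<open>e\<close>.  \<open>G\<close> is its gradient.  Translation along \<open>e\<close> adds to \<open>F\<close>, hence
  \<open>G \<bullet> e = 1\<close> and \<open>|G| \<ge> 1\<close>.\<close>

definition local_defining_function ::
  "(real ^ 'n) set \<Rightarrow> real ^ 'n \<Rightarrow> real \<Rightarrow> (real ^ 'n \<Rightarrow> real) \<Rightarrow> (real ^ 'n \<Rightarrow> real ^ 'n) \<Rightarrow> real ^ 'n \<Rightarrow> real \<Rightarrow> bool" where
  "local_defining_function \<Omega> x0 r F G e K \<longleftrightarrow>
     r > 0 \<and> K \<ge> 0 \<and> (\<forall>z\<in>ball x0 r. z \<in> \<Omega> \<longleftrightarrow> 0 < F z) \<and> continuous_on UNIV F \<and>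
     (\<forall>a\<in>ball x0 r. \<forall>b\<in>ball x0 r. \<bar>F b - F a - G a \<bullet> (b - a)\<bar> \<le> K * (norm (b - a))\<^sup>2) \<and>
     (\<forall>a\<in>ball x0 r. \<forall>b\<in>ball x0 r. \<bar>F b - F a\<bar> \<le> K * norm (b - a)) \<and>
     (\<forall>a. 1 \<le> norm (G a)) \<and> norm e = 1 \<and> (\<forall>z t. F (z + t *\<^sub>R e) = F z + t)"

lemma C2_boundary_local_defining_function:
  assumes "C2_boundary \<Omega>" "x0 \<in> frontier \<Omega>"
  obtains r F G e K where "local_defining_function \<Omega> x0 r F G e K"
proof -
  obtain r e \<gamma> where r: "r > 0" and e: "norm e = 1" and \<gamma>: "C2_upto_closure UNIV \<gamma>"
    and \<Omega>: "\<Omega> \<inter> ball x0 r = {y \<in> ball x0 r. \<gamma> (y - (y \<bullet> e) *\<^sub>R e) < y \<bullet> e}"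
    using assms unfolding C2_boundary_def by blast
  obtain g where g: "\<And>x. (\<gamma> has_derivative (\<lambda>h. g x \<bullet> h)) (at x)" "continuous_on UNIV g"
    and T: "\<And>\<rho>. \<exists>K\<ge>0. \<forall>a\<in>ball 0 \<rho>. \<forall>b\<in>ball 0 \<rho>. \<bar>\<gamma> b - \<gamma> a - g a \<bullet> (b - a)\<bar> \<le> K * (norm (b - a))\<^sup>2"
    using C2_taylor_bound[OF \<gamma>] by metis
  have ee: "e \<bullet> e = 1" using e by (simp add: norm_eq_1)
  define P where "P = (\<lambda>y. y - (y \<bullet> e) *\<^sub>R e)"
  define F where "F = (\<lambda>y. y \<bullet> e - \<gamma> (P y))"
  define G where "G = (\<lambda>y. e - P (g (P y)))"
  have Pdiff: "P b - P a = P (b - a)" for a b by (simp add: P_def inner_diff_left algebra_simps)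
  have Pnorm: "norm (P y) \<le> norm y" for y
  proof -
    have "(norm (P y))\<^sup>2 = (norm y)\<^sup>2 - (y \<bullet> e)\<^sup>2"
      by (simp only: P_def power2_norm_eq_inner) (simp add: inner_diff_left inner_diff_right ee inner_commute power2_eq_square)
    then have "(norm (P y))\<^sup>2 \<le> (norm y)\<^sup>2" by simp
    then show ?thesis by (rule power2_le_imp_le) simp
  qed
  have Psym: "P a \<bullet> b = a \<bullet> P b" for a b
    by (simp add: P_def inner_diff_left inner_diff_right inner_commute mult.commute)
  have cP: "continuous_on UNIV P" unfolding P_def by (intro continuous_intros)
  have c\<gamma>: "continuous_on UNIV \<gamma>" using g(1) by (auto simp: continuous_on_eq_continuous_at intro: has_derivative_continuous)
  have cF: "continuous_on UNIV F"
    unfolding F_def using continuous_on_compose2[OF c\<gamma> cP] by (intro continuous_intros) auto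
  have cG: "continuous_on UNIV G"
  proof -
    have "continuous_on UNIV (\<lambda>y. g (P y))" using continuous_on_compose2[OF g(2) cP] by auto
    then have "continuous_on UNIV (\<lambda>y. P (g (P y)))" using continuous_on_compose2[OF cP] by auto
    then show ?thesis unfolding G_def by (intro continuous_intros)
  qed
  obtain K where K: "K \<ge> 0" "\<And>a b. a \<in> ball 0 (norm x0 + r) \<Longrightarrow> b \<in> ball 0 (norm x0 + r) \<Longrightarrow> \<bar>\<gamma> b - \<gamma> a - g a \<bullet> (b - a)\<bar> \<le> K * (norm (b - a))\<^sup>2"
    using T by metis
  have ball: "P a \<in> ball 0 (norm x0 + r)" if "a \<in> ball x0 r" for a
  proof -
    have "norm a \<le> norm x0 + norm (a - x0)" by (metis add.commute diff_add_cancel norm_triangle_ineq)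
    then show ?thesis using that Pnorm[of a] by (simp add: dist_norm norm_minus_commute)
  qed
  have taylor: "\<bar>F b - F a - G a \<bullet> (b - a)\<bar> \<le> K * (norm (b - a))\<^sup>2" if "a \<in> ball x0 r" "b \<in> ball x0 r" for a b
  proof -
    have "F b - F a - G a \<bullet> (b - a) = - (\<gamma> (P b) - \<gamma> (P a) - g (P a) \<bullet> (P b - P a))"
      by (simp add: F_def G_def Pdiff inner_diff_left Psym) (simp add: inner_diff_right inner_commute)
    then have "\<bar>F b - F a - G a \<bullet> (b - a)\<bar> \<le> K * (norm (P b - P a))\<^sup>2"
      using K(2)[OF ball[OF that(1)] ball[OF that(2)]] by simp
    also have "\<dots> \<le> K * (norm (b - a))\<^sup>2"
      unfolding Pdiff by (intro mult_left_mono power_mono Pnorm K) auto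
    finally show ?thesis .
  qed
  have "bounded (G ` cball x0 r)"
    by (intro compact_imp_bounded compact_continuous_image continuous_on_subset[OF cG]) auto
  then obtain M where M: "M > 0" "\<And>a. a \<in> cball x0 r \<Longrightarrow> norm (G a) \<le> M"
    by (auto simp: bounded_pos)
  have lip: "\<bar>F b - F a\<bar> \<le> (M + K * (2 * r)) * norm (b - a)" if "a \<in> ball x0 r" "b \<in> ball x0 r" for a b
  proof -
    have "norm (b - a) \<le> 2 * r" using that dist_triangle_less_add[of b x0 r a r] by (simp add: dist_norm norm_minus_commute)
    have "\<bar>F b - F a\<bar> \<le> \<bar>G a \<bullet> (b - a)\<bar> + K * (norm (b - a))\<^sup>2" using taylor[OF that] by linarith
    also have "\<bar>G a \<bullet> (b - a)\<bar> \<le> norm (G a) * norm (b - a)" by (rule Cauchy_Schwarz_ineq2)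
    also have "\<dots> \<le> M * norm (b - a)" using M(2)[of a] that by (intro mult_right_mono) auto
    also have "K * (norm (b - a))\<^sup>2 \<le> K * (2 * r) * norm (b - a)"
      unfolding power2_eq_square mult.assoc[of K] using \<open>norm (b - a) \<le> 2 * r\<close> K(1) by (intro mult_left_mono mult_right_mono) auto
    finally show ?thesis by (simp add: algebra_simps)
  qed
  have Gn: "1 \<le> norm (G a)" for a
  proof -
    have "P y \<bullet> e = 0" for y by (simp add: P_def inner_diff_left ee)
    then have "G a \<bullet> e = 1" by (simp add: G_def inner_diff_left ee)
    then show ?thesis using Cauchy_Schwarz_ineq2[of "G a" e] e by simp
  qed
  have tr: "F (z + t *\<^sub>R e) = F z + t" for z t
  proof -
    have "P (z + t *\<^sub>R e) = P z" by (simp add: P_def inner_add_left ee algebra_simps)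
    then show ?thesis by (simp add: F_def inner_add_left ee)
  qed
  have \<Omega>F: "z \<in> \<Omega> \<longleftrightarrow> 0 < F z" if "z \<in> ball x0 r" for z
  proof -
    have "z \<in> \<Omega> \<inter> ball x0 r \<longleftrightarrow> z \<in> {y \<in> ball x0 r. \<gamma> (y - (y \<bullet> e) *\<^sub>R e) < y \<bullet> e}"
      by (simp only: \<Omega>)
    then show ?thesis using that by (simp add: F_def P_def)
  qed
  have Kr: "0 \<le> K * (2 * r)" using K(1) r by simp
  have K': "K \<le> K + (M + K * (2 * r))" "M + K * (2 * r) \<le> K + (M + K * (2 * r))" using K(1) M(1) Kr by linarith+
  have "local_defining_function \<Omega> x0 r F G e (K + (M + K * (2 * r)))"
    unfolding local_defining_function_def
  proof (intro conjI ballI allI)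
    show "0 \<le> K + (M + K * (2 * r))" using K(1) M(1) Kr by linarith
    fix a b assume ab: "a \<in> ball x0 r" "b \<in> ball x0 r"
    show "\<bar>F b - F a - G a \<bullet> (b - a)\<bar> \<le> (K + (M + K * (2 * r))) * (norm (b - a))\<^sup>2"
      using taylor[OF ab] mult_right_mono[OF K'(1), of "(norm (b - a))\<^sup>2"] by simp
    show "\<bar>F b - F a\<bar> \<le> (K + (M + K * (2 * r))) * norm (b - a)"
      using lip[OF ab] mult_right_mono[OF K'(2), of "norm (b - a)"] by simp
  qed (fact r cF Gn e tr \<Omega>F)+
  then show ?thesis by (rule that)
qed

text \<open>Whenever \<open>y\<close> is a nearest boundary point of some \<open>x \<in> \<Omega>\<close> at distance less than \<open>R\<close>, both balls of
  radius \<open>R\<close> that touch the boundary at \<open>y\<close> and are centred on the line through \<open>x\<close> and \<open>y\<close> lie on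
  their own sides of the boundary.\<close>

definition two_sided_ball :: "(real ^ 'n) set \<Rightarrow> real \<Rightarrow> bool" where
  "two_sided_ball \<Omega> R \<longleftrightarrow> (\<forall>x\<in>\<Omega>. \<forall>y. y \<notin> \<Omega> \<longrightarrow> dist x y = infdist x (- \<Omega>) \<longrightarrow> dist x y < R \<longrightarrow>
     ball (y + (R / dist x y) *\<^sub>R (x - y)) R \<subseteq> \<Omega> \<and> ball (y - (R / dist x y) *\<^sub>R (x - y)) R \<inter> \<Omega> = {})"

text \<open>The ball around \<open>x\<close> through \<open>y\<close> lies in \<open>\<Omega>\<close>, where \<open>F > 0 = F(y)\<close>.  This forces the gradient
  of \<open>F\<close> at \<open>y\<close> to point in the direction \<open>\<nu>\<close> of \<open>x - y\<close>.  In a ball of radius \<open>R\<close> touching at \<open>y\<close>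
  one has \<open>|z - y|\<^sup>2 < 2 R |(z - y) \<bullet> \<nu>|\<close>, so for small \<open>R\<close> the linear term decides the sign of \<open>F\<close>.\<close>

lemma two_sided_ball_local:
  fixes \<Omega> :: "(real ^ 'n) set"
  assumes F: "local_defining_function \<Omega> x0 r F G e K"
    and y: "y \<notin> \<Omega>" "y \<in> ball x0 (r / 4)" and x: "x \<in> \<Omega>" and d: "dist x y = infdist x (- \<Omega>)"
    and R: "0 < R" "8 * R \<le> r" "2 * K * R < 1"
  shows "ball (y + (R / dist x y) *\<^sub>R (x - y)) R \<subseteq> \<Omega>" (is ?t1)
    and "ball (y - (R / dist x y) *\<^sub>R (x - y)) R \<inter> \<Omega> = {}" (is ?t2)
proof -
  have r: "r > 0" "K \<ge> 0" and \<Omega>F: "\<And>z. z \<in> ball x0 r \<Longrightarrow> z \<in> \<Omega> \<longleftrightarrow> 0 < F z" and cF: "continuous_on UNIV F"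
    and T: "\<And>a b. a \<in> ball x0 r \<Longrightarrow> b \<in> ball x0 r \<Longrightarrow> \<bar>F b - F a - G a \<bullet> (b - a)\<bar> \<le> K * (norm (b - a))\<^sup>2"
    and Gn: "\<And>a. 1 \<le> norm (G a)"
    using F unfolding local_defining_function_def by auto
  let ?d = "dist x y"
  have d0: "?d > 0" using x y by auto
  define \<nu> where "\<nu> = (1 / ?d) *\<^sub>R (x - y)"
  have \<nu>: "norm \<nu> = 1" "x - y = ?d *\<^sub>R \<nu>" using d0 by (auto simp: \<nu>_def dist_norm)
  have \<nu>\<nu>: "\<nu> \<bullet> \<nu> = 1" using \<nu>(1) by (simp add: norm_eq_1)
  have inner: "ball x ?d \<subseteq> \<Omega>"
  proof
    fix z assume "z \<in> ball x ?d"
    then show "z \<in> \<Omega>" using infdist_le[of z "- \<Omega>" x] d by force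
  qed
  have yr: "y \<in> ball x0 r" using y(2) r by auto
  have near: "z \<in> ball x0 r" if "norm (z - y) \<le> r / 2" for z
    using that y(2) dist_triangle[of x0 z y] r by (simp add: dist_norm norm_minus_commute)
  have Fy0: "F y = 0"
  proof (rule antisym)
    show "F y \<le> 0" using \<Omega>F[OF yr] y(1) by simp
    show "0 \<le> F y"
    proof (rule ccontr)
      assume "\<not> 0 \<le> F y"
      have "open (F -` {..<0} \<inter> ball x0 r)"
        by (intro open_Int continuous_open_vimage) (use cF in \<open>auto simp: continuous_on_eq_continuous_at\<close>)
      moreover have "y \<in> F -` {..<0} \<inter> ball x0 r" using \<open>\<not> 0 \<le> F y\<close> yr by auto
      moreover have "y \<in> closure (ball x ?d)" using d0 by simp
      ultimately have "F -` {..<0} \<inter> ball x0 r \<inter> ball x ?d \<noteq> {}"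
        using open_Int_closure_eq_empty by blast
      then show False using inner \<Omega>F by fastforce
    qed
  qed
  have T0: "\<bar>F z - G y \<bullet> (z - y)\<bar> \<le> K * (norm (z - y))\<^sup>2" if "norm (z - y) \<le> r / 2" for z
    using T[OF yr near[OF that]] Fy0 by simp
  define p where "p = (1 / norm (G y)) *\<^sub>R G y"
  have Gp: "norm (G y) > 0" using Gn[of y] by linarith
  have p: "norm p = 1" "G y = norm (G y) *\<^sub>R p" using Gp by (auto simp: p_def)
  have pp: "p \<bullet> p = 1" using p(1) by (simp add: norm_eq_1)
  have "\<nu> = p"
  proof (rule ccontr)
    assume "\<nu> \<noteq> p"
    define h where "h = \<nu> - p"
    have hh: "(norm h)\<^sup>2 = 2 * (1 - \<nu> \<bullet> p)"
      by (simp only: h_def power2_norm_eq_inner) (simp add: inner_diff_left inner_diff_right \<nu>\<nu> pp inner_commute)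
    have hpos: "(norm h)\<^sup>2 > 0" using \<open>\<nu> \<noteq> p\<close> by (simp add: h_def)
    then have c: "1 - \<nu> \<bullet> p > 0" using hh by simp
    have h2: "norm h \<le> 2" using norm_triangle_ineq4[of \<nu> p] \<nu> p by (simp add: h_def)
    \<comment> \<open>A step from \<open>y\<close> along \<open>h\<close> enters the ball around \<open>x\<close> but decreases \<open>F\<close> to first order;
      \<open>s\<close> is small enough for the quadratic remainder not to matter.\<close>
    define s where "s = min (?d / 2) (min (r / 4) (1 / (4 * (K + 1))))"
    have s: "s > 0" "s < ?d" "s \<le> r / 4" "s \<le> 1 / (4 * (K + 1))" using d0 r by (auto simp: s_def min_less_iff_disj)
    have "2 * K * s < 1"
    proof -
      have "2 * K * s \<le> 2 * K * (1 / (4 * (K + 1)))" using r s by (intro mult_left_mono) auto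
      also have "\<dots> < 1" using r by (simp add: divide_simps)
      finally show ?thesis .
    qed
    let ?z = "y + s *\<^sub>R h"
    have hn: "h \<bullet> \<nu> = 1 - \<nu> \<bullet> p" unfolding h_def inner_diff_left \<nu>\<nu> by (simp add: inner_commute)
    have "(norm (?z - x))\<^sup>2 = (norm (s *\<^sub>R h - (x - y)))\<^sup>2" by (simp add: algebra_simps)
    also have "\<dots> = s\<^sup>2 * (norm h)\<^sup>2 - 2 * s * ?d * (h \<bullet> \<nu>) + ?d\<^sup>2"
      unfolding \<nu>(2) by (simp only: power2_norm_eq_inner) (simp add: inner_diff_left inner_diff_right \<nu>\<nu> inner_commute power2_eq_square algebra_simps)
    also have "\<dots> = ?d\<^sup>2 + 2 * s * (1 - \<nu> \<bullet> p) * (s - ?d)"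
      unfolding hh hn by (simp add: power2_eq_square algebra_simps)
    also have "\<dots> < ?d\<^sup>2"
    proof -
      have "2 * s * (1 - \<nu> \<bullet> p) * (s - ?d) < 0" using s c by (intro mult_pos_neg mult_pos_pos) auto
      then show ?thesis by linarith
    qed
    finally have "norm (?z - x) < ?d" by (rule power2_less_imp_less) simp
    then have "?z \<in> \<Omega>" using inner by (auto simp: dist_norm norm_minus_commute)
    have zn: "norm (?z - y) \<le> r / 2" 
    proof -
      have "norm (?z - y) = s * norm h" using s(1) by simp
      also have "\<dots> \<le> (r / 4) * 2" using s h2 r by (intro mult_mono) auto
      finally show ?thesis by simp
    qed
    have "F ?z \<le> G y \<bullet> (s *\<^sub>R h) + K * (norm (s *\<^sub>R h))\<^sup>2" using T0[OF zn] by simp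
    also have "G y \<bullet> (s *\<^sub>R h) = s * norm (G y) * (p \<bullet> h)" by (subst p(2)) simp
    also have "p \<bullet> h = - (1 - \<nu> \<bullet> p)" unfolding h_def inner_diff_right pp by (simp add: inner_commute)
    also have "K * (norm (s *\<^sub>R h))\<^sup>2 = s * (1 - \<nu> \<bullet> p) * (2 * K * s)"
    proof -
      have "(norm (s *\<^sub>R h))\<^sup>2 = s * s * (norm h)\<^sup>2" by (simp add: power2_eq_square mult_ac)
      then show ?thesis unfolding hh by (simp only: mult_ac)
    qed
    also have "s * norm (G y) * - (1 - \<nu> \<bullet> p) + s * (1 - \<nu> \<bullet> p) * (2 * K * s)
      = s * (1 - \<nu> \<bullet> p) * (2 * K * s - norm (G y))" by (simp add: algebra_simps)
    also have "\<dots> < 0" using s c \<open>2 * K * s < 1\<close> Gn[of y] by (intro mult_pos_neg mult_pos_pos) auto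
    finally show False using \<open>?z \<in> \<Omega>\<close> \<Omega>F[OF near[OF zn]] by simp
  qed
  then have Gy: "G y = norm (G y) *\<^sub>R \<nu>" using p(2) by simp
  have scale: "(R / ?d) *\<^sub>R (x - y) = R *\<^sub>R \<nu>" using d0 by (simp add: \<nu>_def)
  have quad: "(norm (a - R *\<^sub>R \<nu>))\<^sup>2 = (norm a)\<^sup>2 - 2 * R * (a \<bullet> \<nu>) + R\<^sup>2"
             "(norm (a + R *\<^sub>R \<nu>))\<^sup>2 = (norm a)\<^sup>2 + 2 * R * (a \<bullet> \<nu>) + R\<^sup>2" for a
    by (simp_all only: power2_norm_eq_inner) (simp_all add: inner_diff_left inner_diff_right inner_add_left inner_add_right \<nu>\<nu> inner_commute power2_eq_square algebra_simps)
  show ?t1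
  proof
    fix z assume "z \<in> ball (y + (R / ?d) *\<^sub>R (x - y)) R"
    then have z: "norm ((z - y) - R *\<^sub>R \<nu>) < R" unfolding scale by (simp add: dist_norm norm_minus_commute algebra_simps)
    then have "(norm ((z - y) - R *\<^sub>R \<nu>))\<^sup>2 < R\<^sup>2" by (intro power_strict_mono) auto
    then have q: "(norm (z - y))\<^sup>2 < 2 * R * ((z - y) \<bullet> \<nu>)" using quad(1)[of "z - y"] by linarith
    have "norm (z - y) \<le> norm ((z - y) - R *\<^sub>R \<nu>) + norm (R *\<^sub>R \<nu>)" 
      using norm_triangle_ineq[of "(z - y) - R *\<^sub>R \<nu>" "R *\<^sub>R \<nu>"] by simp
    then have zn: "norm (z - y) \<le> r / 2" using z \<nu> R by simp
    have "0 < 2 * R * ((z - y) \<bullet> \<nu>)" using q zero_le_power2[of "norm (z - y)"] by linarith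
    then have s: "(z - y) \<bullet> \<nu> > 0" using R by (simp add: zero_less_mult_iff)
    have "K * (norm (z - y))\<^sup>2 \<le> K * (2 * R * ((z - y) \<bullet> \<nu>))" using q r by (intro mult_left_mono) auto
    also have "\<dots> = (2 * K * R) * ((z - y) \<bullet> \<nu>)" by (simp add: mult_ac)
    also have "\<dots> < 1 * ((z - y) \<bullet> \<nu>)" using R s by (intro mult_strict_right_mono) auto
    also have "\<dots> \<le> norm (G y) * ((z - y) \<bullet> \<nu>)" using Gn[of y] s by (intro mult_right_mono) auto
    also have "\<dots> = G y \<bullet> (z - y)" using arg_cong[OF Gy, of "\<lambda>w. w \<bullet> (z - y)"] by (simp add: inner_commute)
    finally have "0 < F z" using T0[OF zn] by linarith
    then show "z \<in> \<Omega>" using \<Omega>F[OF near[OF zn]] by simp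
  qed
  show ?t2
  proof (rule ccontr)
    assume "ball (y - (R / ?d) *\<^sub>R (x - y)) R \<inter> \<Omega> \<noteq> {}"
    then obtain z where z\<Omega>: "z \<in> \<Omega>" and "z \<in> ball (y - (R / ?d) *\<^sub>R (x - y)) R" by auto
    then have z: "norm ((z - y) + R *\<^sub>R \<nu>) < R" unfolding scale by (simp add: dist_norm norm_minus_commute algebra_simps)
    then have "(norm ((z - y) + R *\<^sub>R \<nu>))\<^sup>2 < R\<^sup>2" by (intro power_strict_mono) auto
    then have q: "(norm (z - y))\<^sup>2 < 2 * R * (- ((z - y) \<bullet> \<nu>))" using quad(2)[of "z - y"] by linarith
    have "norm (z - y) \<le> norm ((z - y) + R *\<^sub>R \<nu>) + norm (R *\<^sub>R \<nu>)"
      using norm_triangle_ineq4[of "(z - y) + R *\<^sub>R \<nu>" "R *\<^sub>R \<nu>"] by simp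
    then have zn: "norm (z - y) \<le> r / 2" using z \<nu> R by simp
    have "0 < 2 * R * (- ((z - y) \<bullet> \<nu>))" using q zero_le_power2[of "norm (z - y)"] by linarith
    then have s: "- ((z - y) \<bullet> \<nu>) > 0" using R by (simp add: zero_less_mult_iff mult_less_0_iff)
    have "K * (norm (z - y))\<^sup>2 \<le> K * (2 * R * (- ((z - y) \<bullet> \<nu>)))" using q r by (intro mult_left_mono) auto
    also have "\<dots> = (2 * K * R) * (- ((z - y) \<bullet> \<nu>))" by (simp add: mult_ac)
    also have "\<dots> < 1 * (- ((z - y) \<bullet> \<nu>))" using R s by (intro mult_strict_right_mono) auto
    also have "\<dots> \<le> norm (G y) * (- ((z - y) \<bullet> \<nu>))" using Gn[of y] s by (intro mult_right_mono) auto
    also have "\<dots> = - (G y \<bullet> (z - y))" using arg_cong[OF Gy, of "\<lambda>w. w \<bullet> (z - y)"] by (simp add: inner_commute)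
    finally have "F z < 0" using T0[OF zn] by linarith
    then show False using \<Omega>F[OF near[OF zn]] z\<Omega> by simp
  qed
qed

lemma two_sided_ball_exists:
  fixes \<Omega> :: "(real ^ 'n) set"
  assumes \<Omega>: "open \<Omega>" "bounded \<Omega>" "\<Omega> \<noteq> {}" and C2: "C2_boundary \<Omega>"
  obtains R where "R > 0" "two_sided_ball \<Omega> R"
proof -
  have "\<exists>\<rho>>0. \<forall>y x R. y \<notin> \<Omega> \<longrightarrow> y \<in> ball x0 \<rho> \<longrightarrow> x \<in> \<Omega> \<longrightarrow> dist x y = infdist x (- \<Omega>) \<longrightarrow> 0 < R \<longrightarrow> R \<le> \<rho> \<longrightarrow>
     ball (y + (R / dist x y) *\<^sub>R (x - y)) R \<subseteq> \<Omega> \<and> ball (y - (R / dist x y) *\<^sub>R (x - y)) R \<inter> \<Omega> = {}"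
    if x0: "x0 \<in> frontier \<Omega>" for x0
  proof -
    obtain r F G e K where F: "local_defining_function \<Omega> x0 r F G e K"
      using C2_boundary_local_defining_function[OF C2 x0] .
    then have r: "r > 0" and K: "K \<ge> 0" by (auto simp: local_defining_function_def)
    define \<rho> where "\<rho> = min (r / 8) (1 / (4 * (K + 1)))"
    have \<rho>: "\<rho> > 0" "\<rho> \<le> r / 8" "\<rho> \<le> 1 / (4 * (K + 1))" using r K by (auto simp: \<rho>_def)
    have KR: "2 * K * R < 1" if "0 < R" "R \<le> \<rho>" for R
    proof -
      have "2 * K * R \<le> 2 * K * (1 / (4 * (K + 1)))" using that \<rho> K by (intro mult_left_mono) auto
      also have "\<dots> < 1" using K by (simp add: divide_simps)
      finally show ?thesis .
    qed
    have sub: "ball x0 \<rho> \<subseteq> ball x0 (r / 4)" using \<rho> r by (intro subset_ball) simp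
    show ?thesis
    proof (intro exI[of _ \<rho>] conjI allI impI)
      show "0 < \<rho>" by (rule \<rho>)
      fix y x R assume a: "y \<notin> \<Omega>" "y \<in> ball x0 \<rho>" "x \<in> \<Omega>" "dist x y = infdist x (- \<Omega>)" "0 < R" "R \<le> \<rho>"
      note * = two_sided_ball_local[OF F a(1) subsetD[OF sub a(2)] a(3,4,5) _ KR[OF a(5,6)]]
      show "ball (y + (R / dist x y) *\<^sub>R (x - y)) R \<subseteq> \<Omega>" using * a \<rho> by simp
      show "ball (y - (R / dist x y) *\<^sub>R (x - y)) R \<inter> \<Omega> = {}" using * a \<rho> by simp
    qed
  qed
  then obtain \<rho> where \<rho>: "\<And>x0. x0 \<in> frontier \<Omega> \<Longrightarrow> \<rho> x0 > 0"
    and good: "\<And>x0 y x R. x0 \<in> frontier \<Omega> \<Longrightarrow> y \<notin> \<Omega> \<Longrightarrow> y \<in> ball x0 (\<rho> x0) \<Longrightarrow> x \<in> \<Omega> \<Longrightarrow> dist x y = infdist x (- \<Omega>) \<Longrightarrow> 0 < R \<Longrightarrow> R \<le> \<rho> x0 \<Longrightarrow>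
     ball (y + (R / dist x y) *\<^sub>R (x - y)) R \<subseteq> \<Omega> \<and> ball (y - (R / dist x y) *\<^sub>R (x - y)) R \<inter> \<Omega> = {}"
    by metis
  have "compact (frontier \<Omega>)" using \<Omega>(2) compact_frontier_bounded by blast
  moreover have "frontier \<Omega> \<subseteq> (\<Union>x0\<in>frontier \<Omega>. ball x0 (\<rho> x0))"
    using \<rho> by (intro subsetI) (rule UN_I, assumption, simp)
  ultimately obtain C where C: "C \<subseteq> frontier \<Omega>" "finite C" "frontier \<Omega> \<subseteq> (\<Union>x0\<in>C. ball x0 (\<rho> x0))"
    by (elim compactE_image[where f="\<lambda>x0. ball x0 (\<rho> x0)"]) auto
  have "frontier \<Omega> \<noteq> {}" using \<Omega> frontier_eq_empty not_bounded_UNIV by metis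
  then have Cne: "C \<noteq> {}" using C by auto
  define R where "R = Min (\<rho> ` C)"
  have R: "R > 0" "\<And>x0. x0 \<in> C \<Longrightarrow> R \<le> \<rho> x0"
    using C Cne \<rho> by (auto simp: R_def)
  have "two_sided_ball \<Omega> R"
    unfolding two_sided_ball_def
  proof (intro ballI allI impI)
    fix x y assume a: "x \<in> \<Omega>" "y \<notin> \<Omega>" "dist x y = infdist x (- \<Omega>)" "dist x y < R"
    have "ball x (dist x y) \<subseteq> \<Omega>"
    proof
      fix z assume "z \<in> ball x (dist x y)"
      then show "z \<in> \<Omega>" using infdist_le[of z "- \<Omega>" x] a(3) by force
    qed
    moreover have "0 < dist x y" using a(1,2) by auto
    then have "y \<in> closure (ball x (dist x y))" by simp
    ultimately have "y \<in> closure \<Omega>" using closure_mono by blast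
    then have "y \<in> frontier \<Omega>" using a(2) \<Omega>(1) by (simp add: frontier_def interior_open)
    then obtain x0 where "x0 \<in> C" "y \<in> ball x0 (\<rho> x0)" using C by auto
    then show "ball (y + (R / dist x y) *\<^sub>R (x - y)) R \<subseteq> \<Omega> \<and> ball (y - (R / dist x y) *\<^sub>R (x - y)) R \<inter> \<Omega> = {}"
      using good[of x0 y x R] a R C by blast
  qed
  with R show ?thesis using that by blast
qed

lemma nn_integral_interval_inverse_sqrt_le:
  "(\<integral>\<^sup>+ t. ennreal ((a + t) powr (- 1 / 2)) * indicator {t. 0 < a + t} t * indicator {0..1} t \<partial>lborel) \<le> ennreal 3"
proof -
  have "(\<integral>\<^sup>+ t. ennreal ((a + t) powr (- 1 / 2)) * indicator {t. 0 < a + t} t * indicator {0..1} t \<partial>lborel)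
    \<le> (\<integral>\<^sup>+ t. indicator {0..1::real} t + ennreal ((t + a) powr (- 1 / 2)) * indicator {0..1} (t + a) \<partial>lborel)"
  proof (rule nn_integral_mono)
    fix t :: real
    have "ennreal ((a + t) powr (- 1 / 2)) \<le> 1" if "1 \<le> a + t"
      using powr_mono2'[of "- 1 / 2" 1 "a + t"] that by (simp add: ennreal_le_1)
    then show "ennreal ((a + t) powr (- 1 / 2)) * indicator {t. 0 < a + t} t * indicator {0..1} t
      \<le> indicator {0..1::real} t + ennreal ((t + a) powr (- 1 / 2)) * indicator {0..1} (t + a)"
      by (cases "a + t \<le> 1") (auto simp: indicator_def add.commute)
  qed
  also have "\<dots> = (\<integral>\<^sup>+ t. indicator {0..1::real} t \<partial>lborel) + (\<integral>\<^sup>+ t. ennreal ((t + a) powr (- 1 / 2)) * indicator {0..1} (t + a) \<partial>lborel)"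
    by (rule nn_integral_add) measurable
  also have "(\<integral>\<^sup>+ t. ennreal ((t + a) powr (- 1 / 2)) * indicator {0..1} (t + a) \<partial>lborel)
     = (\<integral>\<^sup>+ t. ennreal ((t::real) powr (- 1 / 2)) * indicator {0..1} t \<partial>lborel)"
    by (rule nn_integral_translate[where f="\<lambda>t::real. ennreal (t powr (- 1 / 2)) * indicator {0..1} t"]) measurable
  also have "\<dots> = ennreal 2"
    using has_integral_powr_from_0[of "- 1 / 2" 1] by (subst nn_integral_has_integral_lebesgue') auto
  finally show ?thesis by (simp flip: ennreal_plus ennreal_1 ennreal_numeral)
qed

text \<open>Since \<open>F\<close> is Lipschitz and nonpositive off \<open>\<Omega>\<close>, it is bounded by a multiple of the boundary
  distance.  Averaging over translations along \<open>e\<close>, which add to \<open>F\<close>, reduces the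
  integral of \<open>F powr (- 1 / 2)\<close> to a one-dimensional one.\<close>

lemma nn_integral_infdist_local:
  fixes \<Omega> :: "(real ^ 'n) set"
  assumes F: "local_defining_function \<Omega> x0 r F G e K" and x0: "x0 \<notin> \<Omega>" and \<Omega>: "open \<Omega>"
  shows "(\<integral>\<^sup>+ z. ennreal (infdist z (- \<Omega>) powr (- 1 / 2)) * indicator (\<Omega> \<inter> ball x0 (r / 2)) z \<partial>lborel) < \<infinity>"
proof -
  have r: "r > 0" "K \<ge> 0" and \<Omega>F: "\<And>z. z \<in> ball x0 r \<Longrightarrow> z \<in> \<Omega> \<longleftrightarrow> 0 < F z" and cF: "continuous_on UNIV F"
    and L: "\<And>a b. a \<in> ball x0 r \<Longrightarrow> b \<in> ball x0 r \<Longrightarrow> \<bar>F b - F a\<bar> \<le> K * norm (b - a)"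
    and e: "norm e = 1" and tr: "\<And>z t. F (z + t *\<^sub>R e) = F z + t"
    using F unfolding local_defining_function_def by auto
  have [measurable]: "F \<in> borel_measurable borel" using cF by (rule borel_measurable_continuous_onI)
  have ne: "- \<Omega> \<noteq> {}" using x0 by auto
  define M where "M = K + 1"
  have M: "M > 0" using r by (simp add: M_def)
  have key: "infdist z (- \<Omega>) powr (- 1 / 2) \<le> M powr (1 / 2) * F z powr (- 1 / 2)" and Fpos: "F z > 0"
    if z: "z \<in> \<Omega>" "z \<in> ball x0 (r / 2)" for z
  proof -
    obtain y where y: "y \<in> - \<Omega>" "infdist z (- \<Omega>) = dist z y"
      using infdist_attains_inf[of "- \<Omega>" z] \<Omega> ne by (auto simp: closed_def)
    have "dist z y \<le> dist z x0" using infdist_le[of x0 "- \<Omega>" z] x0 y by simp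
    then have yb: "y \<in> ball x0 r" using z(2) dist_triangle[of x0 y z] by (simp add: dist_commute)
    have zb: "z \<in> ball x0 r" using z(2) r by auto
    show Fz: "F z > 0" using \<Omega>F[OF zb] z by simp
    have "F y \<le> 0" using \<Omega>F[OF yb] y by simp
    then have "F z \<le> K * norm (z - y)" using L[OF yb zb] by linarith
    also have "\<dots> \<le> M * norm (z - y)" by (intro mult_right_mono) (auto simp: M_def)
    finally have "F z \<le> M * dist z y" by (simp add: dist_norm)
    then have "(M * dist z y) powr (- 1 / 2) \<le> F z powr (- 1 / 2)" using Fz by (intro powr_mono2') auto
    then have "M powr (1 / 2) * (M * dist z y) powr (- 1 / 2) \<le> M powr (1 / 2) * F z powr (- 1 / 2)" by (intro mult_left_mono) auto
    moreover have "M powr (1 / 2) * (M * dist z y) powr (- 1 / 2) = dist z y powr (- 1 / 2)"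
      using M by (simp add: powr_mult powr_minus)
    ultimately show "infdist z (- \<Omega>) powr (- 1 / 2) \<le> M powr (1 / 2) * F z powr (- 1 / 2)" using y by simp
  qed
  let ?f = "\<lambda>z. ennreal (F z powr (- 1 / 2)) * indicator {z. 0 < F z \<and> norm (z - x0) < r} z"
  have fm: "?f \<in> borel_measurable borel" by measurable
  have "(\<integral>\<^sup>+ z. ennreal (infdist z (- \<Omega>) powr (- 1 / 2)) * indicator (\<Omega> \<inter> ball x0 (r / 2)) z \<partial>lborel)
    \<le> (\<integral>\<^sup>+ z. ennreal (M powr (1 / 2)) * ?f z \<partial>lborel)"
  proof (rule nn_integral_mono)
    fix z
    show "ennreal (infdist z (- \<Omega>) powr (- 1 / 2)) * indicator (\<Omega> \<inter> ball x0 (r / 2)) z \<le> ennreal (M powr (1 / 2)) * ?f z"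
    proof (cases "z \<in> \<Omega> \<inter> ball x0 (r / 2)")
      case True
      then have "norm (z - x0) < r" using r by (auto simp: dist_norm norm_minus_commute)
      then show ?thesis using True key[of z] Fpos[of z]
        by (auto simp: ennreal_mult[symmetric] intro!: ennreal_leI)
    qed simp
  qed
  also have "\<dots> = ennreal (M powr (1 / 2)) * (\<integral>\<^sup>+ z. ?f z \<partial>lborel)" by (rule nn_integral_cmult) measurable
  also have "(\<integral>\<^sup>+ z. ?f z \<partial>lborel) = ennreal 1 * (\<integral>\<^sup>+ z. ?f z \<partial>lborel)" by simp
  also have "\<dots> = (\<integral>\<^sup>+ z. (\<integral>\<^sup>+ t. ?f (z + t *\<^sub>R e) * indicator {0..1} t \<partial>lborel) \<partial>lborel)"
    by (rule nn_integral_translation_average[OF fm]) simp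
  also have "\<dots> \<le> (\<integral>\<^sup>+ z. ennreal 3 * indicator (cball x0 (r + 1)) z \<partial>lborel)"
  proof (rule nn_integral_mono)
    fix z
    have "(\<integral>\<^sup>+ t. ?f (z + t *\<^sub>R e) * indicator {0..1} t \<partial>lborel)
      \<le> (\<integral>\<^sup>+ t. indicator (cball x0 (r + 1)) z * (ennreal ((F z + t) powr (- 1 / 2)) * indicator {t. 0 < F z + t} t * indicator {0..1} t) \<partial>lborel)"
    proof (rule nn_integral_mono)
      fix t :: real
      have "norm (z - x0) \<le> r + 1" if "norm (z + t *\<^sub>R e - x0) < r" "0 \<le> t" "t \<le> 1"
      proof -
        have "norm (z - x0) \<le> norm (z + t *\<^sub>R e - x0) + norm (t *\<^sub>R e)"
          using norm_triangle_ineq4[of "z + t *\<^sub>R e - x0" "t *\<^sub>R e"] by (simp add: algebra_simps)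
        then show ?thesis using that e by simp
      qed
      then show "?f (z + t *\<^sub>R e) * indicator {0..1} t
        \<le> indicator (cball x0 (r + 1)) z * (ennreal ((F z + t) powr (- 1 / 2)) * indicator {t. 0 < F z + t} t * indicator {0..1} t)"
        by (auto simp: indicator_def tr dist_norm norm_minus_commute)
    qed
    also have "\<dots> = indicator (cball x0 (r + 1)) z * (\<integral>\<^sup>+ t. ennreal ((F z + t) powr (- 1 / 2)) * indicator {t. 0 < F z + t} t * indicator {0..1} t \<partial>lborel)"
      by (rule nn_integral_cmult) measurable
    also have "\<dots> \<le> indicator (cball x0 (r + 1)) z * ennreal 3"
      by (intro mult_left_mono nn_integral_interval_inverse_sqrt_le) simp
    finally show "(\<integral>\<^sup>+ t. ?f (z + t *\<^sub>R e) * indicator {0..1} t \<partial>lborel) \<le> ennreal 3 * indicator (cball x0 (r + 1)) z"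
      by (simp add: mult.commute)
  qed
  also have "\<dots> = ennreal 3 * emeasure lborel (cball x0 (r + 1))"
    by (subst nn_integral_cmult) auto
  finally have le: "(\<integral>\<^sup>+ z. ennreal (infdist z (- \<Omega>) powr (- 1 / 2)) * indicator (\<Omega> \<inter> ball x0 (r / 2)) z \<partial>lborel)
     \<le> ennreal (M powr (1 / 2)) * (ennreal 3 * emeasure lborel (cball x0 (r + 1)))"
    by (simp add: mult_left_mono)
  also have "\<dots> < \<infinity>" using emeasure_lborel_cball_finite[of x0 "r + 1"] by (simp add: ennreal_mult_less_top)
  finally show ?thesis .
qed

text \<open>Integrability of this negative power of the distance makes all powers of the barrier integrable.\<close>

lemma nn_integral_infdist_finite:
  fixes \<Omega> :: "(real ^ 'n) set"
  assumes \<Omega>: "open \<Omega>" "bounded \<Omega>" and C2: "C2_boundary \<Omega>"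
  shows "(\<integral>\<^sup>+ z. ennreal (infdist z (- \<Omega>) powr (- 1 / 2)) * indicator \<Omega> z \<partial>lborel) < \<infinity>"
proof -
  let ?d = "\<lambda>z. ennreal (infdist z (- \<Omega>) powr (- 1 / 2))"
  have ne: "- \<Omega> \<noteq> {}" using \<Omega>(2) not_bounded_UNIV by (metis Compl_empty_eq double_compl)
  have [measurable]: "\<Omega> \<in> sets borel" using \<Omega> by simp
  have dm[measurable]: "(\<lambda>z. infdist z (- \<Omega>)) \<in> borel_measurable borel"
    by (intro borel_measurable_continuous_onI continuous_intros)
  have "\<exists>\<rho>>0. (\<integral>\<^sup>+ z. ?d z * indicator (\<Omega> \<inter> ball x0 \<rho>) z \<partial>lborel) < \<infinity>" if x0: "x0 \<in> closure \<Omega>" for x0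
  proof (cases "x0 \<in> \<Omega>")
    case False
    then have "x0 \<in> frontier \<Omega>" using x0 \<Omega> by (simp add: frontier_def interior_open)
    then obtain r F G e K where F: "local_defining_function \<Omega> x0 r F G e K"
      using C2_boundary_local_defining_function[OF C2] by metis
    then have "r / 2 > 0" by (auto simp: local_defining_function_def)
    then show ?thesis using nn_integral_infdist_local[OF F False \<Omega>(1)] by blast
  next
    case True
    then obtain \<rho> where \<rho>: "\<rho> > 0" "ball x0 \<rho> \<subseteq> \<Omega>" using \<Omega> openE by blast
    have "(\<integral>\<^sup>+ z. ?d z * indicator (\<Omega> \<inter> ball x0 (\<rho> / 2)) z \<partial>lborel) \<le> (\<integral>\<^sup>+ z. ennreal ((\<rho> / 2) powr (- 1 / 2)) * indicator (ball x0 (\<rho> / 2)) z \<partial>lborel)"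
    proof (rule nn_integral_mono)
      fix z
      have "\<rho> / 2 \<le> infdist z (- \<Omega>)" if "z \<in> ball x0 (\<rho> / 2)"
      proof (subst infdist_notempty[OF ne], rule cINF_greatest[OF ne])
        fix y assume "y \<in> - \<Omega>"
        then have "y \<notin> ball x0 \<rho>" using \<rho> by auto
        then show "\<rho> / 2 \<le> dist z y" using that dist_triangle[of x0 y z] by simp
      qed
      then have "infdist z (- \<Omega>) powr (- 1 / 2) \<le> (\<rho> / 2) powr (- 1 / 2)" if "z \<in> ball x0 (\<rho> / 2)"
        using that \<rho> by (intro powr_mono2') auto
      then show "?d z * indicator (\<Omega> \<inter> ball x0 (\<rho> / 2)) z \<le> ennreal ((\<rho> / 2) powr (- 1 / 2)) * indicator (ball x0 (\<rho> / 2)) z"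
        by (auto simp: indicator_def intro!: ennreal_leI)
    qed
    also have "\<dots> = ennreal ((\<rho> / 2) powr (- 1 / 2)) * emeasure lborel (ball x0 (\<rho> / 2))"
      by (subst nn_integral_cmult) auto
    also have "\<dots> < \<infinity>" using emeasure_lborel_ball_finite[of x0 "\<rho> / 2"] by (simp add: ennreal_mult_less_top)
    finally show ?thesis using \<rho> by (intro exI[of _ "\<rho> / 2"]) auto
  qed
  then have "\<exists>\<rho>. \<forall>x0\<in>closure \<Omega>. \<rho> x0 > 0 \<and> (\<integral>\<^sup>+ z. ?d z * indicator (\<Omega> \<inter> ball x0 (\<rho> x0)) z \<partial>lborel) < \<infinity>"
    by (intro bchoice) blast
  then obtain \<rho> where \<rho>: "\<And>x0. x0 \<in> closure \<Omega> \<Longrightarrow> \<rho> x0 > 0"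
    "\<And>x0. x0 \<in> closure \<Omega> \<Longrightarrow> (\<integral>\<^sup>+ z. ?d z * indicator (\<Omega> \<inter> ball x0 (\<rho> x0)) z \<partial>lborel) < \<infinity>"
    by blast
  have "compact (closure \<Omega>)" using \<Omega>(2) by simp
  moreover have "closure \<Omega> \<subseteq> (\<Union>x0\<in>closure \<Omega>. ball x0 (\<rho> x0))"
    using \<rho>(1) by (intro subsetI) (rule UN_I, assumption, simp)
  ultimately obtain C where C: "C \<subseteq> closure \<Omega>" "finite C" "closure \<Omega> \<subseteq> (\<Union>x0\<in>C. ball x0 (\<rho> x0))"
    by (elim compactE_image[where f="\<lambda>x0. ball x0 (\<rho> x0)"]) auto
  have "(\<integral>\<^sup>+ z. ?d z * indicator \<Omega> z \<partial>lborel) \<le> (\<integral>\<^sup>+ z. (\<Sum>x0\<in>C. ?d z * indicator (\<Omega> \<inter> ball x0 (\<rho> x0)) z) \<partial>lborel)"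
  proof (rule nn_integral_mono)
    fix z
    show "?d z * indicator \<Omega> z \<le> (\<Sum>x0\<in>C. ?d z * indicator (\<Omega> \<inter> ball x0 (\<rho> x0)) z)"
    proof (cases "z \<in> \<Omega>")
      case True
      then obtain x0 where x0: "x0 \<in> C" "z \<in> ball x0 (\<rho> x0)" using C closure_subset by blast
      have "?d z * indicator \<Omega> z = ?d z * indicator (\<Omega> \<inter> ball x0 (\<rho> x0)) z" using True x0 by simp
      also have "\<dots> \<le> (\<Sum>x0\<in>C. ?d z * indicator (\<Omega> \<inter> ball x0 (\<rho> x0)) z)"
        using x0 C(2) by (intro member_le_sum) auto
      finally show ?thesis .
    qed simp
  qed
  also have "\<dots> = (\<Sum>x0\<in>C. \<integral>\<^sup>+ z. ?d z * indicator (\<Omega> \<inter> ball x0 (\<rho> x0)) z \<partial>lborel)"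
    by (rule nn_integral_sum) measurable
  also have "\<dots> < \<infinity>" using \<rho>(2) C by (auto simp: less_top)
  finally show ?thesis .
qed

text \<open>In dimension one the graph functions are constants, so an interval satisfies the general boundary
  condition.\<close>

lemma C2_boundary_interval:
  fixes a b :: "real ^ 'n"
  assumes "CARD('n) = 1"
  shows "C2_boundary (box a b)"
proof -
  obtain k :: 'n where k: "UNIV = {k}" using assms card_1_singletonE by blast
  have allk: "(\<forall>i. Q i) \<longleftrightarrow> Q k" for Q :: "'n \<Rightarrow> bool"
    using k by (metis UNIV_I singletonD)
  define E where "E = (axis k 1 :: real ^ 'n)"
  have yE: "y = (y $ k) *\<^sub>R E" "y \<bullet> E = y $ k" for y :: "real ^ 'n"
    unfolding vec_eq_iff allk by (simp_all add: E_def axis_def inner_axis[unfolded axis_def])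
  have nE: "norm E = 1" by (simp add: E_def)
  have box: "y \<in> box a b \<longleftrightarrow> a $ k < y $ k \<and> y $ k < b $ k" for y
    by (simp only: mem_box_cart allk)
  have nrm: "dist x y = \<bar>x $ k - y $ k\<bar>" for x y :: "real ^ 'n"
  proof -
    have "x - y = (x $ k - y $ k) *\<^sub>R E" using yE(1)[of "x - y"] by simp
    then show ?thesis by (simp add: dist_norm nE)
  qed
  have const: "C2_upto_closure UNIV (\<lambda>y::real^'n. c)" for c
    unfolding C2_upto_closure_def
    by (intro exI[of _ "\<lambda>x. 0"]) (auto intro!: continuous_intros derivative_eq_intros)
  show ?thesis
    unfolding C2_boundary_def
  proof
    fix x0 assume x0: "x0 \<in> frontier (box a b)"
    then have ne: "box a b \<noteq> {}" by auto
    then have ab: "a $ k < b $ k" using box by fastforce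
    have "x0 \<in> cbox a b" "x0 \<notin> box a b"
      using x0 closure_box[OF ne] interior_open[OF open_box[of a b]] by (simp_all add: frontier_def)
    then have x0k: "x0 $ k = a $ k \<or> x0 $ k = b $ k" unfolding mem_box_cart allk by linarith
    let ?r = "b $ k - a $ k"
    show "\<exists>r e \<gamma>. r > 0 \<and> norm e = 1 \<and> C2_upto_closure UNIV \<gamma> \<and>
        box a b \<inter> ball x0 r = {y \<in> ball x0 r. \<gamma> (y - (y \<bullet> e) *\<^sub>R e) < y \<bullet> e}"
    proof (cases "x0 $ k = a $ k")
      case True
      show ?thesis
        by (rule exI[of _ ?r], rule exI[of _ E], rule exI[of _ "\<lambda>_. a $ k"])
           (use True ab in \<open>auto simp: nE const box nrm yE(2)\<close>)
    next
      case False
      then have "x0 $ k = b $ k" using x0k by simp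
      then show ?thesis
        by (intro exI[of _ ?r] exI[of _ "- E"] exI[of _ "\<lambda>_. - b $ k"])
           (use ab in \<open>auto simp: nE const box nrm yE(2)\<close>)
    qed
  qed
qed

section \<open>The barrier\<close>

text \<open>For \<open>D = infdist z (- \<Omega>) \<le> R\<close> this is \<open>D - D\<^sup>2 / (2 R)\<close>, and it is constant farther inside.  The
  correction is chosen so that on an inner ball of radius \<open>R\<close> the depth dominates the quadratic
  polynomial \<open>(R\<^sup>2 - |z - c|\<^sup>2) / (2 R)\<close>, which transforms nicely under projective maps.\<close>

definition collar_depth :: "real \<Rightarrow> (real ^ 'n) set \<Rightarrow> real ^ 'n \<Rightarrow> real" where
  "collar_depth R \<Omega> z = (R\<^sup>2 - (max 0 (R - infdist z (- \<Omega>)))\<^sup>2) / (2 * R)"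

text \<open>The factor \<open>e R\<close> keeps the inner logarithm at least \<open>1\<close>, because the depth is at most \<open>R / 2\<close>.\<close>

definition barrier :: "real \<Rightarrow> (real ^ 'n) set \<Rightarrow> real ^ 'n \<Rightarrow> real" where
  "barrier R \<Omega> z = ln (ln (exp 1 * R / collar_depth R \<Omega> z))"

lemma infdist_compl_pos:
  fixes \<Omega> :: "(real ^ 'n) set"
  assumes "open \<Omega>" "bounded \<Omega>" "z \<in> \<Omega>"
  shows "infdist z (- \<Omega>) > 0"
proof -
  have "- \<Omega> \<noteq> {}" using assms(2) not_bounded_UNIV by (metis Compl_empty_eq double_compl)
  then have "infdist z (- \<Omega>) \<noteq> 0"
    using assms in_closed_iff_infdist_zero[of "- \<Omega>" z] by (auto simp: closed_Compl)
  then show ?thesis using infdist_nonneg[of z "- \<Omega>"] by linarith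
qed

lemma collar_depth_bounds:
  fixes \<Omega> :: "(real ^ 'n) set"
  assumes R: "R > 0"
  shows "collar_depth R \<Omega> z \<le> R / 2" "collar_depth R \<Omega> z \<le> infdist z (- \<Omega>)"
    "min (infdist z (- \<Omega>)) R / 2 \<le> collar_depth R \<Omega> z"
    "infdist z (- \<Omega>) \<le> R \<Longrightarrow> R * collar_depth R \<Omega> z = R * infdist z (- \<Omega>) - (infdist z (- \<Omega>))\<^sup>2 / 2"
proof -
  let ?d = "infdist z (- \<Omega>)"
  have d: "?d \<ge> 0" by (rule infdist_nonneg)
  show "collar_depth R \<Omega> z \<le> R / 2"
    using R by (simp add: collar_depth_def divide_simps power2_eq_square)
  have a: "?d \<le> R \<Longrightarrow> collar_depth R \<Omega> z = ?d - ?d\<^sup>2 / (2 * R)"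
    using R by (simp add: collar_depth_def power2_eq_square field_simps)
  have b: "R \<le> ?d \<Longrightarrow> collar_depth R \<Omega> z = R / 2"
    using R by (simp add: collar_depth_def power2_eq_square field_simps)
  show "collar_depth R \<Omega> z \<le> ?d"
    using a b R d by (cases "?d \<le> R") auto
  show "min ?d R / 2 \<le> collar_depth R \<Omega> z"
  proof (cases "?d \<le> R")
    case True
    have "?d * ?d \<le> ?d * R" using True d by (intro mult_left_mono)
    then have "?d\<^sup>2 / (2 * R) \<le> ?d / 2" using R by (simp add: divide_simps power2_eq_square)
    then show ?thesis using a True by simp
  qed (use b in auto)
  show "R * collar_depth R \<Omega> z = R * ?d - ?d\<^sup>2 / 2" if "?d \<le> R"
    using a[OF that] R by (simp add: field_simps power2_eq_square)
qed

lemma one_le_ln_collar: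
  fixes R q :: real
  assumes "R > 0" "0 < q" "q \<le> R / 2"
  shows "1 \<le> ln (exp 1 * R / q)"
proof -
  have "exp 1 * q \<le> exp 1 * R" using assms by (intro mult_left_mono) auto
  then have "exp 1 \<le> exp 1 * R / q" using assms by (simp add: pos_le_divide_eq)
  then have "ln (exp 1) \<le> ln (exp 1 * R / q)" using assms by (subst ln_le_cancel_iff) auto
  then show ?thesis by simp
qed

context
  fixes \<Omega> :: "(real ^ 'n) set" and R :: real
  assumes \<Omega>: "open \<Omega>" "bounded \<Omega>" and R: "R > 0"
begin

lemma collar_depth_pos: "z \<in> \<Omega> \<Longrightarrow> collar_depth R \<Omega> z > 0"
  using collar_depth_bounds(3)[OF R, where \<Omega>=\<Omega> and z=z] infdist_compl_pos[OF \<Omega>, of z] R by linarith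

lemma barrier_nonneg:
  assumes "z \<in> \<Omega>"
  shows "0 \<le> barrier R \<Omega> z"
  using one_le_ln_collar[OF R collar_depth_pos[OF assms] collar_depth_bounds(1)[OF R]]
  by (simp add: barrier_def)

lemma continuous_on_barrier: "continuous_on \<Omega> (barrier R \<Omega>)"
proof -
  have "continuous_on \<Omega> (collar_depth R \<Omega>)"
    unfolding collar_depth_def[abs_def] using R by (intro continuous_intros) auto
  moreover have "0 < exp 1 * R / collar_depth R \<Omega> z" "0 < ln (exp 1 * R / collar_depth R \<Omega> z)" if "z \<in> \<Omega>" for z
  proof -
    show "0 < exp 1 * R / collar_depth R \<Omega> z" using collar_depth_pos[OF that] R by simp
    show "0 < ln (exp 1 * R / collar_depth R \<Omega> z)"
      using one_le_ln_collar[OF R collar_depth_pos[OF that] collar_depth_bounds(1)[OF R]] by linarith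
  qed
  ultimately show ?thesis
    unfolding barrier_def[abs_def] using collar_depth_pos by (intro continuous_intros) force+
qed

lemma barrier_large_near_boundary:
  obtains \<delta> where "\<delta> > 0" "\<And>z. z \<in> \<Omega> \<Longrightarrow> infdist z (- \<Omega>) < \<delta> \<Longrightarrow> M < barrier R \<Omega> z"
proof -
  define \<delta> where "\<delta> = exp 1 * R / exp (exp M)"
  have "M < barrier R \<Omega> z" if z: "z \<in> \<Omega>" "infdist z (- \<Omega>) < \<delta>" for z
  proof -
    have q: "0 < collar_depth R \<Omega> z" by (rule collar_depth_pos[OF z(1)])
    have "collar_depth R \<Omega> z < \<delta>" using z collar_depth_bounds(2)[OF R, where \<Omega>=\<Omega> and z=z] by simp
    then have "exp (exp M) < exp 1 * R / collar_depth R \<Omega> z"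
      using q by (simp add: \<delta>_def field_simps)
    then have "exp M < ln (exp 1 * R / collar_depth R \<Omega> z)"
      by (metis exp_gt_zero ln_exp ln_less_cancel_iff order_less_trans)
    then show ?thesis unfolding barrier_def by (metis exp_gt_zero ln_exp ln_less_cancel_iff order_less_trans)
  qed
  then show ?thesis using that[of \<delta>] R by (simp add: \<delta>_def)
qed

text \<open>A logarithm is dominated by every negative power of the depth; the power \<open>1 / (2 M)\<close> leads to the
  integrable function \<open>infdist z (- \<Omega>) powr (- 1 / 2)\<close>.\<close>

lemma barrier_powr_integral_finite:
  assumes fin: "(\<integral>\<^sup>+ z. ennreal (infdist z (- \<Omega>) powr (- 1 / 2)) * indicator \<Omega> z \<partial>lborel) < \<infinity>" and M: "M > 0"
  shows "(\<integral>\<^sup>+ z. ennreal (barrier R \<Omega> z powr M) * indicator \<Omega> z \<partial>lborel) < \<infinity>"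
proof -
  define \<beta> where "\<beta> = 1 / (2 * M)"
  have \<beta>: "\<beta> > 0" "\<beta> * M = 1 / 2" using M by (auto simp: \<beta>_def)
  define A where "A = (1 / \<beta>) powr M * (2 * exp 1 * R) powr (1 / 2)"
  have A: "A \<ge> 0" by (simp add: A_def)
  have pt: "barrier R \<Omega> z powr M \<le> A * (infdist z (- \<Omega>) powr (- 1 / 2) + R powr (- 1 / 2))" if z: "z \<in> \<Omega>" for z
  proof -
    let ?q = "collar_depth R \<Omega> z" and ?d = "infdist z (- \<Omega>)"
    have q: "?q > 0" and d: "?d > 0" using z collar_depth_pos infdist_compl_pos[OF \<Omega>] by auto
    have Y: "1 \<le> ln (exp 1 * R / ?q)" using one_le_ln_collar[OF R q collar_depth_bounds(1)[OF R]] .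
    have "barrier R \<Omega> z \<le> ln (exp 1 * R / ?q)"
      unfolding barrier_def using ln_le_minus_one[of "ln (exp 1 * R / ?q)"] Y by linarith
    also have "\<dots> \<le> (exp 1 * R / ?q) powr \<beta> / \<beta>"
      using ln_powr_bound[of "exp 1 * R / ?q" \<beta>] \<beta> Y q R
      by (metis divide_pos_pos exp_gt_zero ln_ge_zero_iff mult_pos_pos order_trans zero_le_one)
    finally have "barrier R \<Omega> z powr M \<le> ((exp 1 * R / ?q) powr \<beta> / \<beta>) powr M"
      using barrier_nonneg[OF z] M by (intro powr_mono2) auto
    also have "\<dots> = (1 / \<beta>) powr M * ((exp 1 * R / ?q) powr \<beta>) powr M"
      using \<beta> by (simp add: powr_mult[symmetric])
    also have "((exp 1 * R / ?q) powr \<beta>) powr M = (exp 1 * R / ?q) powr (1 / 2)"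
      by (simp only: powr_powr \<beta>(2))
    finally have s1: "barrier R \<Omega> z powr M \<le> (1 / \<beta>) powr M * (exp 1 * R / ?q) powr (1 / 2)" .
    have "exp 1 * R / ?q \<le> exp 1 * R / (min ?d R / 2)"
      using collar_depth_bounds(3)[OF R, where \<Omega>=\<Omega> and z=z] d R q by (intro divide_left_mono) auto
    also have "\<dots> = (2 * exp 1 * R) * (1 / min ?d R)" by simp
    finally have "(exp 1 * R / ?q) powr (1 / 2) \<le> ((2 * exp 1 * R) * (1 / min ?d R)) powr (1 / 2)"
      using q R by (intro powr_mono2) auto
    also have "\<dots> = (2 * exp 1 * R) powr (1 / 2) * (min ?d R) powr (- 1 / 2)"
    proof -
      have "(c * (1 / \<mu>)) powr (1 / 2) = c powr (1 / 2) * \<mu> powr (- 1 / 2)" if "c \<ge> 0" "\<mu> > 0" for c \<mu> :: real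
        using that by (subst powr_mult) (auto simp: powr_divide powr_minus_divide)
      then show ?thesis using R d by simp
    qed
    also have "\<dots> \<le> (2 * exp 1 * R) powr (1 / 2) * (?d powr (- 1 / 2) + R powr (- 1 / 2))"
      by (intro mult_left_mono) (auto simp: min_def)
    finally have "(1 / \<beta>) powr M * (exp 1 * R / ?q) powr (1 / 2)
      \<le> (1 / \<beta>) powr M * ((2 * exp 1 * R) powr (1 / 2) * (?d powr (- 1 / 2) + R powr (- 1 / 2)))"
      by (rule mult_left_mono) simp
    with s1 show ?thesis unfolding A_def by (simp only: mult.assoc)
  qed
  have [measurable]: "\<Omega> \<in> sets borel" using \<Omega> by simp
  have dm[measurable]: "(\<lambda>z. infdist z (- \<Omega>)) \<in> borel_measurable borel"
    by (intro borel_measurable_continuous_onI continuous_intros)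
  have "(\<integral>\<^sup>+ z. ennreal (barrier R \<Omega> z powr M) * indicator \<Omega> z \<partial>lborel)
    \<le> (\<integral>\<^sup>+ z. ennreal A * (ennreal (infdist z (- \<Omega>) powr (- 1 / 2)) * indicator \<Omega> z + ennreal (R powr (- 1 / 2)) * indicator \<Omega> z) \<partial>lborel)"
  proof (rule nn_integral_mono)
    fix z
    show "ennreal (barrier R \<Omega> z powr M) * indicator \<Omega> z
      \<le> ennreal A * (ennreal (infdist z (- \<Omega>) powr (- 1 / 2)) * indicator \<Omega> z + ennreal (R powr (- 1 / 2)) * indicator \<Omega> z)"
    proof (cases "z \<in> \<Omega>")
      case True
      have "ennreal (barrier R \<Omega> z powr M) \<le> ennreal (A * (infdist z (- \<Omega>) powr (- 1 / 2) + R powr (- 1 / 2)))"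
        by (rule ennreal_leI[OF pt[OF True]])
      also have "\<dots> = ennreal A * (ennreal (infdist z (- \<Omega>) powr (- 1 / 2)) + ennreal (R powr (- 1 / 2)))"
        using A by (subst ennreal_mult) auto
      finally show ?thesis using True by simp
    qed simp
  qed
  also have "\<dots> = ennreal A * ((\<integral>\<^sup>+ z. ennreal (infdist z (- \<Omega>) powr (- 1 / 2)) * indicator \<Omega> z \<partial>lborel)
      + (\<integral>\<^sup>+ z. ennreal (R powr (- 1 / 2)) * indicator \<Omega> z \<partial>lborel))"
    by (subst nn_integral_cmult, measurable, subst nn_integral_add, measurable)
  also have "(\<integral>\<^sup>+ z. ennreal (R powr (- 1 / 2)) * indicator \<Omega> z \<partial>lborel) = ennreal (R powr (- 1 / 2)) * emeasure lborel \<Omega>"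
    by (rule nn_integral_cmult_indicator) simp
  also have "ennreal A * ((\<integral>\<^sup>+ z. ennreal (infdist z (- \<Omega>) powr (- 1 / 2)) * indicator \<Omega> z \<partial>lborel)
      + ennreal (R powr (- 1 / 2)) * emeasure lborel \<Omega>) < \<infinity>"
    using fin emeasure_bounded_finite[OF \<Omega>(2)] by (simp add: ennreal_mult_less_top)
  finally show ?thesis .
qed

end

lemma integral_le_of_nn_integral_le:
  fixes h :: "'a \<Rightarrow> real"
  assumes h: "h \<in> borel_measurable M" "\<And>z. 0 \<le> h z" and le: "(\<integral>\<^sup>+ z. ennreal (h z) \<partial>M) \<le> ennreal c" and c: "0 \<le> c"
  shows "integrable M h" "(\<integral> z. h z \<partial>M) \<le> c"
proof -
  show i: "integrable M h"
    using h le by (intro integrableI_nonneg) (auto intro: le_less_trans)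
  have "ennreal (\<integral> z. h z \<partial>M) = (\<integral>\<^sup>+ z. ennreal (h z) \<partial>M)"
    using h by (intro nn_integral_eq_integral[symmetric] i) auto
  then show "(\<integral> z. h z \<partial>M) \<le> c" using le c by (metis ennreal_le_iff)
qed

lemma borel_measurable_barrier [measurable]: "barrier R \<Omega> \<in> borel_measurable borel"
proof -
  have [measurable]: "(\<lambda>z. infdist z (- \<Omega>)) \<in> borel_measurable borel"
    by (intro borel_measurable_continuous_onI continuous_intros)
  show ?thesis unfolding barrier_def[abs_def] collar_depth_def[abs_def] by measurable
qed

text \<open>This constant and \<open>lens_const\<close> collect the factors that \<open>nn_integral_norm_powr_le\<close> produces, with
  \<open>D\<close> a bound for the diameter of \<open>\<Omega>\<close>.  What matters is that they do not depend on the point near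
  the boundary.\<close>

definition defect_const :: "'n::finite itself \<Rightarrow> real \<Rightarrow> real \<Rightarrow> real \<Rightarrow> real" where
  "defect_const _ \<alpha> R D = 2 powr (real CARD('n) - \<alpha> + 1) * ball_vol TYPE(real ^ 'n) * ((2 * D) powr \<alpha> / \<alpha>)
     * (2 * R) powr (- (3 * \<alpha> / 2))"

definition lens_const :: "'n::finite itself \<Rightarrow> real \<Rightarrow> real \<Rightarrow> real \<Rightarrow> real" where
  "lens_const _ \<alpha> R D = 2 powr (real CARD('n) + 5 * \<alpha> / 2 + 1) *
     (2 * 2 powr real CARD('n) * ball_vol TYPE(real ^ 'n) * (2 / R) * (2 * D) powr (1 - \<alpha>))
     * (4 powr (3 * \<alpha> / 2) / (3 * \<alpha> / 2))"

section \<open>The barrier compared with its reflection\<close>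

text \<open>A point \<open>x\<close> near the boundary, its nearest boundary point \<open>y\<close>, and the two balls touching there.
  The factor \<open>20\<close> leaves room for the ball of \<open>gain_region\<close> below inside the reflectable ball.\<close>

definition tangent_balls :: "(real ^ 'n) set \<Rightarrow> real \<Rightarrow> real ^ 'n \<Rightarrow> real ^ 'n \<Rightarrow> bool" where
  "tangent_balls \<Omega> R x y \<longleftrightarrow> open \<Omega> \<and> bounded \<Omega> \<and> R > 0 \<and> x \<in> \<Omega> \<and> y \<notin> \<Omega> \<and>
     dist x y = infdist x (- \<Omega>) \<and> 20 * dist x y \<le> R \<and>
     ball (y + (R / dist x y) *\<^sub>R (x - y)) R \<subseteq> \<Omega> \<and> ball (y - (R / dist x y) *\<^sub>R (x - y)) R \<inter> \<Omega> = {}"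

context
  fixes \<Omega> :: "(real ^ 'n) set" and R :: real and x y :: "real ^ 'n"
  assumes tb: "tangent_balls \<Omega> R x y"
begin

lemma open_domain: "open \<Omega>" and bounded_domain: "bounded \<Omega>" and R_pos: "R > 0"
  and x_in: "x \<in> \<Omega>" and y_out: "y \<notin> \<Omega>" and nearest: "dist x y = infdist x (- \<Omega>)"
  and collar: "20 * dist x y \<le> R"
  and inner_ball: "ball (y + (R / dist x y) *\<^sub>R (x - y)) R \<subseteq> \<Omega>"
  and outer_ball: "ball (y - (R / dist x y) *\<^sub>R (x - y)) R \<inter> \<Omega> = {}"
  using tb unfolding tangent_balls_def by blast+

definition "d = dist x y"
definition "\<nu> = (1 / d) *\<^sub>R (x - y)"
definition "\<rho> = collar_depth R \<Omega> x"

text \<open>With this choice \<open>\<rho> * (1 + \<xi> \<bullet> m)\<close> is the affine part of \<open>q(x + \<xi>)\<close>, where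
  \<open>q(z) = (R\<^sup>2 - |z - c|\<^sup>2) / (2 R)\<close> and \<open>c = y + R \<nu>\<close> is the centre of the inner ball.\<close>

definition "m = ((R - d) / (R * \<rho>)) *\<^sub>R \<nu>"
definition "Y0 = ln (exp 1 * R / \<rho>)"

text \<open>The denominator of the projective involution \<open>x + \<xi> \<mapsto> x - \<xi> / tilt \<xi>\<close>, which maps the inner ball
  onto itself and fixes \<open>x\<close>.\<close>

definition "tilt \<xi> = 1 + \<xi> \<bullet> m"

text \<open>The relative deviation of \<open>q(x + \<xi>) = \<rho> * tilt \<xi> * (1 - defect \<xi>)\<close> from the affine function
  \<open>\<rho> * tilt \<xi>\<close>; it is invariant under the involution.\<close>

definition "defect \<xi> = (norm \<xi>)\<^sup>2 / (2 * R * \<rho> * tilt \<xi>)"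

text \<open>The points with \<open>defect \<xi> < 1 / 2\<close>.  They form a smaller ball that is invariant under the involution
  and on which \<open>q\<close> is comparable with \<open>\<rho> * tilt \<xi>\<close>, so that no logarithm degenerates.\<close>

definition "reflectable \<xi> \<longleftrightarrow> (norm \<xi>)\<^sup>2 < R * \<rho> * tilt \<xi>"
abbreviation "b \<equiv> barrier R \<Omega>"

lemma d_pos: "d > 0" and d_le: "20 * d \<le> R"
  using x_in y_out collar by (auto simp: d_def)

lemma norm_\<nu>: "norm \<nu> = 1" and \<nu>\<nu>: "\<nu> \<bullet> \<nu> = 1"
proof -
  show "norm \<nu> = 1" using d_pos by (simp add: \<nu>_def d_def dist_norm)
  then show "\<nu> \<bullet> \<nu> = 1" by (simp add: norm_eq_1)
qed

lemma x_eq: "x = y + d *\<^sub>R \<nu>"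
  using d_pos by (simp add: \<nu>_def)

lemma R\<rho>: "R * \<rho> = R * d - d\<^sup>2 / 2"
  using collar_depth_bounds(4)[OF R_pos, where \<Omega>=\<Omega> and z=x] nearest d_pos d_le by (simp add: \<rho>_def d_def)

lemma \<rho>_pos: "\<rho> > 0" and \<rho>_le: "\<rho> \<le> d" and \<rho>_ge: "d / 2 \<le> \<rho>" and \<rho>_R: "\<rho> \<le> R / 2"
  using collar_depth_pos[OF open_domain bounded_domain R_pos x_in]
    collar_depth_bounds(1-3)[OF R_pos, where \<Omega>=\<Omega> and z=x] nearest d_pos d_le by (auto simp: \<rho>_def d_def min_def split: if_splits)

lemma Y0_ge: "1 \<le> Y0"
  unfolding Y0_def by (rule one_le_ln_collar[OF R_pos \<rho>_pos \<rho>_R])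

lemma b_x: "b x = ln Y0" by (simp add: barrier_def Y0_def \<rho>_def)

lemma R\<rho>_tilt: "R * \<rho> * tilt \<xi> = R * \<rho> + (R - d) * (\<xi> \<bullet> \<nu>)"
  using R_pos \<rho>_pos by (simp add: tilt_def m_def field_simps)

lemma R\<rho>_tilt': "R * \<rho> * tilt \<xi> = R * d - d\<^sup>2 / 2 + (R - d) * (\<xi> \<bullet> \<nu>)"
  unfolding R\<rho>_tilt by (simp only: R\<rho>)

lemma reflectable_tilt_pos: assumes "reflectable \<xi>" shows "tilt \<xi> > 0"
proof -
  have "0 < (R * \<rho>) * tilt \<xi>" using assms by (auto simp: reflectable_def intro: le_less_trans[OF zero_le_power2])
  then show ?thesis by (rule zero_less_mult_pos) (use R_pos \<rho>_pos in simp)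
qed

lemma reflectable_defect: assumes "reflectable \<xi>" shows "0 \<le> defect \<xi>" "defect \<xi> < 1 / 2"
proof -
  have p: "R * \<rho> * tilt \<xi> > 0" using reflectable_tilt_pos[OF assms] R_pos \<rho>_pos by simp
  show "0 \<le> defect \<xi>" unfolding defect_def using p by (intro divide_nonneg_nonneg) auto
  show "defect \<xi> < 1 / 2" unfolding defect_def using p assms by (simp add: reflectable_def divide_simps mult.assoc)
qed

text \<open>Expanding \<open>|x + \<xi> - c|\<^sup>2\<close> around the centre \<open>c\<close> of the inner ball gives the factorisation
  \<open>q(x + \<xi>) = \<rho> * tilt \<xi> * (1 - defect \<xi>)\<close>.  The depth is at least \<open>q\<close>, and the barrier is a
  decreasing function of the depth.\<close>

lemma barrier_le_reflectable:
  assumes g: "reflectable \<xi>"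
  shows "x + \<xi> \<in> \<Omega>" "b (x + \<xi>) \<le> ln (Y0 + - ln (1 - defect \<xi>) - ln (tilt \<xi>))" "1 \<le> Y0 + - ln (1 - defect \<xi>) - ln (tilt \<xi>)"
proof -
  let ?c = "y + R *\<^sub>R \<nu>"
  have c: "y + (R / dist x y) *\<^sub>R (x - y) = ?c" using d_pos by (simp add: \<nu>_def d_def)
  have t: "tilt \<xi> > 0" by (rule reflectable_tilt_pos[OF g])
  define q where "q = \<rho> * tilt \<xi> * (1 - defect \<xi>)"
  have q: "q > 0" using t \<rho>_pos reflectable_defect[OF g] by (simp add: q_def)
  have Rq: "2 * R * q = 2 * (R * \<rho> * tilt \<xi>) - (norm \<xi>)\<^sup>2"
    using t R_pos \<rho>_pos by (simp add: q_def defect_def field_simps)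
  have xe: "x + \<xi> - ?c = \<xi> - (R - d) *\<^sub>R \<nu>" by (subst x_eq) (simp add: algebra_simps)
  have "(norm (x + \<xi> - ?c))\<^sup>2 = (norm (\<xi> - (R - d) *\<^sub>R \<nu>))\<^sup>2" by (simp only: xe)
  also have "\<dots> = (norm \<xi>)\<^sup>2 - 2 * ((R - d) * (\<xi> \<bullet> \<nu>)) + (R - d)\<^sup>2"
    by (simp only: power2_norm_eq_inner) (simp add: inner_diff_left inner_diff_right \<nu>\<nu> inner_commute power2_eq_square algebra_simps)
  also have "\<dots> = R\<^sup>2 - 2 * R * q"
    unfolding Rq R\<rho>_tilt' by (simp add: power2_eq_square algebra_simps)
  finally have nc: "(norm (x + \<xi> - ?c))\<^sup>2 = R\<^sup>2 - 2 * R * q" .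
  then have "(norm (x + \<xi> - ?c))\<^sup>2 < R\<^sup>2" using q R_pos by simp
  then have lt: "norm (x + \<xi> - ?c) < R" using R_pos by (intro power2_less_imp_less[of _ R]) auto
  have sub: "ball ?c R \<subseteq> \<Omega>" using inner_ball c by simp
  then show z: "x + \<xi> \<in> \<Omega>" using lt by (auto simp: dist_norm norm_minus_commute)
  have "R - norm (x + \<xi> - ?c) \<le> infdist (x + \<xi>) (- \<Omega>)"
  proof -
    have "- \<Omega> \<noteq> {}" using y_out by auto
    then show ?thesis
    proof (subst infdist_notempty, assumption, rule cINF_greatest)
      fix w assume "w \<in> - \<Omega>"
      then have "w \<notin> ball ?c R" using sub by auto
      then show "R - norm (x + \<xi> - ?c) \<le> dist (x + \<xi>) w"
        using dist_triangle[of ?c w "x + \<xi>"] by (simp add: dist_norm norm_minus_commute)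
    qed
  qed
  then have "max 0 (R - infdist (x + \<xi>) (- \<Omega>)) \<le> norm (x + \<xi> - ?c)" by simp
  then have "(max 0 (R - infdist (x + \<xi>) (- \<Omega>)))\<^sup>2 \<le> (norm (x + \<xi> - ?c))\<^sup>2" by (intro power_mono) auto
  then have "2 * R * q \<le> R\<^sup>2 - (max 0 (R - infdist (x + \<xi>) (- \<Omega>)))\<^sup>2" using nc by linarith
  then have qle: "q \<le> collar_depth R \<Omega> (x + \<xi>)"
    using R_pos by (simp add: collar_depth_def field_simps)
  then have q2: "q \<le> R / 2" using collar_depth_bounds(1)[OF R_pos, where \<Omega>=\<Omega> and z="x + \<xi>"] by linarith
  have Y: "ln (exp 1 * R / q) = Y0 + - ln (1 - defect \<xi>) - ln (tilt \<xi>)"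
    using R_pos \<rho>_pos t reflectable_defect[OF g] by (simp add: q_def Y0_def ln_div ln_mult)
  show "1 \<le> Y0 + - ln (1 - defect \<xi>) - ln (tilt \<xi>)" using one_le_ln_collar[OF R_pos q q2] Y by simp
  have q': "0 < collar_depth R \<Omega> (x + \<xi>)" using q qle by linarith
  have "ln (exp 1 * R / collar_depth R \<Omega> (x + \<xi>)) \<le> ln (exp 1 * R / q)"
    using q q' qle R_pos by (subst ln_le_cancel_iff) (auto intro!: divide_left_mono)
  moreover have "1 \<le> ln (exp 1 * R / collar_depth R \<Omega> (x + \<xi>))"
    by (rule one_le_ln_collar[OF R_pos q' collar_depth_bounds(1)[OF R_pos]])
  ultimately show "b (x + \<xi>) \<le> ln (Y0 + - ln (1 - defect \<xi>) - ln (tilt \<xi>))"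
    unfolding barrier_def Y[symmetric] by (subst ln_le_cancel_iff) auto
qed

lemma neg_ln_one_minus_defect_le: assumes "reflectable \<xi>"
  shows "0 \<le> - ln (1 - defect \<xi>)" "- ln (1 - defect \<xi>) \<le> 2 * defect \<xi>"
proof -
  note X = reflectable_defect[OF assms]
  show "0 \<le> - ln (1 - defect \<xi>)" using X by simp
  have "defect \<xi> * defect \<xi> \<le> defect \<xi> * (1 / 2)" using X by (intro mult_left_mono) auto
  then show "- ln (1 - defect \<xi>) \<le> 2 * defect \<xi>"
    using ln_one_minus_pos_lower_bound[of "defect \<xi>"] X by (simp add: power2_eq_square)
qed

text \<open>The involution inverts \<open>tilt\<close> and preserves \<open>defect\<close>; hence it divides \<open>q\<close> by the square of \<open>tilt\<close>.\<close>

lemma reflection_invariants: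
  assumes t: "tilt \<xi> > 0"
  defines "\<xi>' \<equiv> - (1 / tilt \<xi>) *\<^sub>R \<xi>"
  shows "tilt \<xi>' = 1 / tilt \<xi>" "defect \<xi>' = defect \<xi>" "reflectable \<xi>' \<longleftrightarrow> reflectable \<xi>" "norm \<xi>' = norm \<xi> / tilt \<xi>"
proof -
  show 1: "tilt \<xi>' = 1 / tilt \<xi>" using t by (simp add: \<xi>'_def tilt_def field_simps)
  show n: "norm \<xi>' = norm \<xi> / tilt \<xi>" using t by (simp add: \<xi>'_def)
  show "defect \<xi>' = defect \<xi>" unfolding defect_def n 1 using t by (simp add: power2_eq_square field_simps)
  have "(norm \<xi>' )\<^sup>2 = (norm \<xi>)\<^sup>2 / tilt \<xi> * (1 / tilt \<xi>)" unfolding n using t by (simp add: power2_eq_square)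
  then have "reflectable \<xi>' \<longleftrightarrow> (norm \<xi>)\<^sup>2 / tilt \<xi> * (1 / tilt \<xi>) < (R * \<rho>) * (1 / tilt \<xi>)" unfolding reflectable_def 1 by simp
  also have "\<dots> \<longleftrightarrow> (norm \<xi>)\<^sup>2 / tilt \<xi> < R * \<rho>" using t by (subst mult_less_cancel_right_pos) auto
  also have "\<dots> \<longleftrightarrow> reflectable \<xi>" unfolding reflectable_def using t by (simp add: pos_divide_less_eq)
  finally show "reflectable \<xi>' \<longleftrightarrow> reflectable \<xi>" .
qed

text \<open>Near \<open>x\<close> some points in the half \<open>tilt \<xi> \<ge> 1\<close> lose their partner to the excised ball.  They lie on
  the side where the barrier decreases, so only the defect remains.\<close>

lemma unpaired_le:
  assumes g: "reflectable \<xi>" and t: "tilt \<xi> \<ge> 1"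
  shows "b (x + \<xi>) - b x \<le> 2 * defect \<xi>"
proof -
  let ?e = "- ln (1 - defect \<xi>)" and ?l = "ln (tilt \<xi>)"
  have l: "?l \<ge> 0" using t by simp
  note e = neg_ln_one_minus_defect_le[OF g]
  have Y: "1 \<le> Y0 + ?e - ?l" using barrier_le_reflectable(3)[OF g] by simp
  have "b (x + \<xi>) - b x \<le> ln (Y0 + ?e - ?l) - ln Y0" using barrier_le_reflectable(2)[OF g] b_x by simp
  also have "\<dots> \<le> ln (Y0 + ?e) - ln Y0" using Y l by simp
  also have "\<dots> \<le> (Y0 + ?e - Y0) / Y0" using Y0_ge e(1) by (intro ln_diff_le) linarith+
  also have "\<dots> = ?e / Y0" by simp
  also have "\<dots> \<le> ?e / 1" using Y0_ge e by (intro divide_left_mono) auto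
  finally show ?thesis using e by simp
qed

text \<open>With \<open>l = ln (tilt \<xi>)\<close> and \<open>e = - ln (1 - defect \<xi>)\<close>, the two points contribute
  \<open>ln (Y0 + e - l) + ln (Y0 + e + l) - 2 * ln Y0\<close>, the logarithm of
  \<open>((Y0 + e)\<^sup>2 - l\<^sup>2) / Y0\<^sup>2\<close>, and \<open>ln s \<le> s - 1\<close> finishes.  The weight \<open>s\<close> of the reflected point
  multiplies a nonnegative quantity and is therefore replaced by \<open>1\<close>.\<close>

lemma paired_le:
  assumes g: "reflectable \<xi>" and t: "tilt \<xi> \<ge> 1" and s: "0 \<le> s" "s \<le> 1"
  shows "b (x + \<xi>) - b x + s * max 0 (b (x + - (1 / tilt \<xi>) *\<^sub>R \<xi>) - b x) \<le> 6 * defect \<xi> - (ln (tilt \<xi>))\<^sup>2 / Y0\<^sup>2"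
proof -
  let ?e = "- ln (1 - defect \<xi>)" and ?l = "ln (tilt \<xi>)"
  have tp: "tilt \<xi> > 0" using t by simp
  have l: "?l \<ge> 0" using t by simp
  note e = neg_ln_one_minus_defect_le[OF g] and r = reflection_invariants[OF tp]
  have g': "reflectable (- (1 / tilt \<xi>) *\<^sub>R \<xi>)" using r(3) g by simp
  have Y: "1 \<le> Y0 + ?e - ?l" using barrier_le_reflectable(3)[OF g] by simp
  have b1: "b (x + \<xi>) \<le> ln (Y0 + ?e - ?l)" using barrier_le_reflectable(2)[OF g] by simp
  have "ln (1 / tilt \<xi>) = - ?l" using tp by (simp add: ln_div)
  then have b2: "b (x + - (1 / tilt \<xi>) *\<^sub>R \<xi>) \<le> ln (Y0 + ?e + ?l)"
    using barrier_le_reflectable(2)[OF g'] unfolding r(1) r(2) by simp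
  have Y2: "ln Y0 \<le> ln (Y0 + ?e + ?l)" using Y0_ge e l by simp
  have "s * max 0 (b (x + - (1 / tilt \<xi>) *\<^sub>R \<xi>) - b x) \<le> 1 * (ln (Y0 + ?e + ?l) - ln Y0)"
    using s b2 Y2 b_x by (intro mult_mono) auto
  moreover have "b (x + \<xi>) - b x \<le> ln (Y0 + ?e - ?l) - ln Y0" using b1 b_x by linarith
  ultimately have "b (x + \<xi>) - b x + s * max 0 (b (x + - (1 / tilt \<xi>) *\<^sub>R \<xi>) - b x)
     \<le> (ln (Y0 + ?e - ?l) - ln Y0) + 1 * (ln (Y0 + ?e + ?l) - ln Y0)" by (intro add_mono)
  also have "\<dots> = ln (Y0 + ?e - ?l) + ln (Y0 + ?e + ?l) - 2 * ln Y0" by simp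
  also have "\<dots> = ln ((Y0 + ?e - ?l) * (Y0 + ?e + ?l) / Y0\<^sup>2)"
    using Y Y0_ge e l by (subst ln_div) (auto simp: ln_mult power2_eq_square)
  also have "\<dots> \<le> (Y0 + ?e - ?l) * (Y0 + ?e + ?l) / Y0\<^sup>2 - 1"
    using Y Y0_ge e l by (intro ln_le_minus_one divide_pos_pos mult_pos_pos) auto
  also have "\<dots> = 2 * ?e / Y0 + ?e\<^sup>2 / Y0\<^sup>2 - ?l\<^sup>2 / Y0\<^sup>2"
    using Y0_ge by (simp add: field_simps power2_eq_square)
  also have "\<dots> \<le> 2 * ?e + ?e - ?l\<^sup>2 / Y0\<^sup>2"
  proof -
    have "?e / Y0 \<le> ?e / 1" using Y0_ge e by (intro divide_left_mono) auto
    moreover have "?e\<^sup>2 / Y0\<^sup>2 \<le> ?e\<^sup>2 / 1" using Y0_ge by (intro divide_left_mono) (auto simp: one_le_power)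
    moreover have "?e * ?e \<le> 1 * ?e" using e reflectable_defect[OF g] by (intro mult_right_mono) auto
    ultimately show ?thesis by (simp add: power2_eq_square)
  qed
  finally show ?thesis using e by simp
qed

lemma reflectable_if_small: assumes "norm \<xi> < d / 4" shows "reflectable \<xi>"
proof -
  have "\<bar>\<xi> \<bullet> \<nu>\<bar> \<le> norm \<xi>" using Cauchy_Schwarz_ineq2[of \<xi> \<nu>] norm_\<nu> by simp
  then have "- (d / 4) \<le> \<xi> \<bullet> \<nu>" using assms by linarith
  then have "(R - d) * - (d / 4) \<le> (R - d) * (\<xi> \<bullet> \<nu>)" using d_le d_pos by (intro mult_left_mono) auto
  moreover have "(R - d) * - (d / 4) = d\<^sup>2 / 4 - R * d / 4" by (simp add: power2_eq_square field_simps)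
  moreover have "(norm \<xi>)\<^sup>2 \<le> (d / 4)\<^sup>2" using assms by (intro power_mono) auto
  moreover have "(d / 4)\<^sup>2 = d\<^sup>2 / 16" by (simp add: power_divide)
  moreover have "20 * d\<^sup>2 \<le> R * d" using mult_right_mono[OF d_le, of d] d_pos by (simp add: power2_eq_square)
  moreover have "0 < d\<^sup>2" using d_pos by simp
  ultimately have "(norm \<xi>)\<^sup>2 < R * d - d\<^sup>2 / 2 + (R - d) * (\<xi> \<bullet> \<nu>)" by linarith
  then show ?thesis unfolding reflectable_def R\<rho>_tilt' .
qed

text \<open>A point of \<open>\<Omega>\<close> outside the reflectable ball and outside the outer ball is squeezed between two
  spheres that are tangent at \<open>y\<close> up to second order in \<open>\<xi>\<close>; there \<open>\<xi> \<bullet> \<nu> + d\<close>, the height over the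
  tangent plane at \<open>y\<close>, is quadratically small.\<close>

lemma not_reflectable_in_lens:
  assumes nb: "\<not> reflectable \<xi>" and z: "x + \<xi> \<in> \<Omega>"
  shows "d / 4 \<le> norm \<xi>" "\<bar>\<xi> \<bullet> \<nu> + d\<bar> \<le> 2 / R * (norm \<xi>)\<^sup>2"
proof -
  show "d / 4 \<le> norm \<xi>" using reflectable_if_small[of \<xi>] nb by linarith
  have Rd: "R - d \<ge> R / 2" "R - d > 0" using d_le d_pos R_pos by auto
  have dd: "0 \<le> d\<^sup>2" by simp
  have "(R - d) * (\<xi> \<bullet> \<nu> + d) \<le> (norm \<xi>)\<^sup>2"
  proof -
    have "(R - d) * (\<xi> \<bullet> \<nu> + d) = R * \<rho> * tilt \<xi> - d\<^sup>2 / 2"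
      unfolding R\<rho>_tilt' by (simp add: power2_eq_square field_simps)
    then show ?thesis using nb dd unfolding reflectable_def by linarith
  qed
  then have "\<xi> \<bullet> \<nu> + d \<le> (norm \<xi>)\<^sup>2 / (R - d)" using Rd by (simp add: pos_le_divide_eq mult.commute)
  also have "\<dots> \<le> (norm \<xi>)\<^sup>2 / (R / 2)" using Rd R_pos by (intro divide_left_mono) auto
  finally have up: "\<xi> \<bullet> \<nu> + d \<le> 2 / R * (norm \<xi>)\<^sup>2" by (simp add: mult.commute)
  have c: "y - (R / dist x y) *\<^sub>R (x - y) = y - R *\<^sub>R \<nu>" using d_pos by (simp add: \<nu>_def d_def)
  have "x + \<xi> \<notin> ball (y - R *\<^sub>R \<nu>) R" using outer_ball z c by auto
  then have "R \<le> norm (x + \<xi> - (y - R *\<^sub>R \<nu>))" by (simp add: dist_norm norm_minus_commute)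
  moreover have "x + \<xi> - (y - R *\<^sub>R \<nu>) = \<xi> + (R + d) *\<^sub>R \<nu>" by (subst x_eq) (simp add: algebra_simps)
  ultimately have "R\<^sup>2 \<le> (norm (\<xi> + (R + d) *\<^sub>R \<nu>))\<^sup>2" using R_pos by (intro power_mono) auto
  also have "\<dots> = (norm \<xi>)\<^sup>2 + 2 * ((R + d) * (\<xi> \<bullet> \<nu>)) + (R + d)\<^sup>2"
    by (simp only: power2_norm_eq_inner) (simp add: inner_add_left inner_add_right \<nu>\<nu> inner_commute power2_eq_square algebra_simps)
  finally have "R\<^sup>2 \<le> (norm \<xi>)\<^sup>2 + 2 * ((R + d) * (\<xi> \<bullet> \<nu>)) + (R + d)\<^sup>2" .
  moreover have "2 * (R + d) * (\<xi> \<bullet> \<nu> + d) = 2 * ((R + d) * (\<xi> \<bullet> \<nu>)) + (R + d)\<^sup>2 - R\<^sup>2 + d\<^sup>2"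
    by (simp add: power2_eq_square algebra_simps)
  ultimately have "- (norm \<xi>)\<^sup>2 \<le> 2 * (R + d) * (\<xi> \<bullet> \<nu> + d)" using dd by linarith
  then have "- (norm \<xi>)\<^sup>2 / (2 * (R + d)) \<le> \<xi> \<bullet> \<nu> + d"
    using R_pos d_pos by (subst pos_divide_le_eq) (auto simp only: mult.commute mult_pos_pos add_pos_pos zero_less_numeral)
  moreover have "(norm \<xi>)\<^sup>2 / (2 * (R + d)) \<le> (norm \<xi>)\<^sup>2 / (R / 2)" using R_pos d_pos by (intro divide_left_mono) auto
  ultimately have "- (2 / R * (norm \<xi>)\<^sup>2) \<le> \<xi> \<bullet> \<nu> + d" by (simp add: mult.commute)
  then show "\<bar>\<xi> \<bullet> \<nu> + d\<bar> \<le> 2 / R * (norm \<xi>)\<^sup>2" using up by (simp add: abs_le_iff)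
qed

text \<open>A ball whose radius is comparable with the distance to the boundary, on which \<open>tilt\<close> stays away
  from \<open>1\<close>; it produces the gain.\<close>

lemma gain_region:
  assumes \<xi>: "norm (\<xi> - (2 * d) *\<^sub>R \<nu>) < d"
  shows "reflectable \<xi>" "3 / 2 \<le> tilt \<xi>" "tilt \<xi> \<le> 7" "d \<le> norm \<xi>" "norm \<xi> \<le> 3 * d"
proof -
  have "norm \<xi> \<le> norm (\<xi> - (2 * d) *\<^sub>R \<nu>) + norm ((2 * d) *\<^sub>R \<nu>)"
    using norm_triangle_ineq[of "\<xi> - (2 * d) *\<^sub>R \<nu>" "(2 * d) *\<^sub>R \<nu>"] by simp
  then show n: "norm \<xi> \<le> 3 * d" using \<xi> d_pos norm_\<nu> by simp
  have "\<bar>(\<xi> - (2 * d) *\<^sub>R \<nu>) \<bullet> \<nu>\<bar> \<le> norm (\<xi> - (2 * d) *\<^sub>R \<nu>)"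
    using Cauchy_Schwarz_ineq2[of "\<xi> - (2 * d) *\<^sub>R \<nu>" \<nu>] norm_\<nu> by simp
  then have "\<bar>\<xi> \<bullet> \<nu> - 2 * d\<bar> < d" using \<xi> by (simp add: inner_diff_left \<nu>\<nu>)
  then have s: "d \<le> \<xi> \<bullet> \<nu>" "\<xi> \<bullet> \<nu> \<le> 3 * d" by (auto simp: abs_less_iff)
  show "d \<le> norm \<xi>" using s Cauchy_Schwarz_ineq2[of \<xi> \<nu>] norm_\<nu> by simp
  have p: "R * \<rho> > 0" using R_pos \<rho>_pos by simp
  have dd: "20 * d * d \<le> R * d" "0 < d * d" using d_le d_pos by (auto intro!: mult_right_mono)
  have "(R - d) * d \<le> (R - d) * (\<xi> \<bullet> \<nu>)" using s d_le d_pos by (intro mult_left_mono) auto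
  moreover have "R * \<rho> \<le> R * d" using \<rho>_le R_pos by simp
  ultimately have "(R * \<rho>) * (3 / 2) \<le> R * \<rho> * tilt \<xi>"
    unfolding R\<rho>_tilt using dd by (simp add: algebra_simps)
  then show t: "3 / 2 \<le> tilt \<xi>" using p by (subst (asm) mult_le_cancel_left_pos) auto
  have "(R - d) * (\<xi> \<bullet> \<nu>) \<le> R * (3 * d)" using s d_le d_pos R_pos by (intro mult_mono) auto
  moreover have "R * (d / 2) \<le> R * \<rho>" using \<rho>_ge R_pos by (intro mult_left_mono) auto
  ultimately have "R * \<rho> * tilt \<xi> \<le> (R * \<rho>) * 7" unfolding R\<rho>_tilt by (simp add: algebra_simps)
  then show "tilt \<xi> \<le> 7" using p by (subst (asm) mult_le_cancel_left_pos) auto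
  have "(norm \<xi>)\<^sup>2 \<le> (3 * d)\<^sup>2" using n by (intro power_mono) auto
  moreover have "R * (d / 2) * (3 / 2) \<le> R * \<rho> * tilt \<xi>"
    using t \<rho>_ge R_pos d_pos \<rho>_pos by (intro mult_mono mult_left_mono) auto
  ultimately show "reflectable \<xi>" unfolding reflectable_def using dd by (simp add: power2_eq_square)
qed

text \<open>On the inner ball the barrier lies below an explicit smooth function, with equality at \<open>x\<close>; its
  second order Taylor expansion yields the paraboloid.\<close>

lemma barrier_touched_above:
  obtains v K r0 where "r0 > 0" "K \<ge> 0" "\<And>\<xi>. norm \<xi> < r0 \<Longrightarrow> b (x + \<xi>) - b x \<le> v \<bullet> \<xi> + K * (norm \<xi>)\<^sup>2"
proof -
  define C where "C = norm m + 1 / (2 * (R * \<rho>))"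
  have p: "R * \<rho> > 0" using R_pos \<rho>_pos by simp
  have C: "C > 0" using p by (simp add: C_def add_nonneg_pos)
  define r0 where "r0 = min (d / 4) (min 1 (1 / (2 * C)))"
  have r0: "r0 > 0" "r0 \<le> d / 4" "r0 \<le> 1" "r0 \<le> 1 / (2 * C)" using d_pos C by (auto simp: r0_def)
  define K where "K = 1 / (2 * (R * \<rho>)) + 2 * C\<^sup>2"
  have "b (x + \<xi>) - b x \<le> (- (1 / Y0)) *\<^sub>R m \<bullet> \<xi> + (K / Y0) * (norm \<xi>)\<^sup>2" if \<xi>: "norm \<xi> < r0" for \<xi>
  proof -
    have g: "reflectable \<xi>" using reflectable_if_small[of \<xi>] \<xi> r0 by simp
    have t: "tilt \<xi> > 0" by (rule reflectable_tilt_pos[OF g])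
    define Q where "Q = tilt \<xi> * (1 - defect \<xi>)"
    define h where "h = 1 - Q"
    have Q: "Q = 1 + \<xi> \<bullet> m - (norm \<xi>)\<^sup>2 / (2 * (R * \<rho>))"
      using t R_pos \<rho>_pos by (simp add: Q_def defect_def field_simps) (simp add: tilt_def field_simps)
    have "\<bar>h\<bar> \<le> \<bar>\<xi> \<bullet> m\<bar> + (norm \<xi>)\<^sup>2 / (2 * (R * \<rho>))"
    proof -
      have "0 \<le> (norm \<xi>)\<^sup>2 / (2 * (R * \<rho>))" using p by (intro divide_nonneg_pos) auto
      then show ?thesis unfolding h_def Q by linarith
    qed
    also have "\<bar>\<xi> \<bullet> m\<bar> \<le> norm \<xi> * norm m" by (rule Cauchy_Schwarz_ineq2)
    also have "(norm \<xi>)\<^sup>2 / (2 * (R * \<rho>)) \<le> norm \<xi> * (1 / (2 * (R * \<rho>)))"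
      using p \<xi> r0 by (simp add: power2_eq_square divide_right_mono mult_left_le)
    finally have h: "\<bar>h\<bar> \<le> C * norm \<xi>" by (simp add: C_def algebra_simps)
    have "C * norm \<xi> \<le> C * (1 / (2 * C))" using \<xi> r0 C by (intro mult_left_mono) auto
    then have h2: "\<bar>h\<bar> \<le> 1 / 2" using h C by simp
    then have Qp: "Q \<ge> 1 / 2" unfolding h_def by linarith
    have lnQ: "- ln Q \<le> h + 2 * h\<^sup>2"
    proof -
      have "- ln Q = ln (1 / Q)" using Qp by (simp add: ln_div)
      also have "\<dots> \<le> 1 / Q - 1" using Qp by (intro ln_le_minus_one) auto
      also have "\<dots> = h + h\<^sup>2 / Q" using Qp by (simp add: h_def field_simps power2_eq_square)
      also have "h\<^sup>2 / Q \<le> h\<^sup>2 / (1 / 2)" using Qp by (intro divide_left_mono) auto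
      finally show ?thesis by simp
    qed
    have "h\<^sup>2 \<le> (C * norm \<xi>)\<^sup>2" using h by (metis abs_ge_zero power2_abs power_mono)
    then have lnQ2: "- ln Q \<le> - (\<xi> \<bullet> m) + K * (norm \<xi>)\<^sup>2"
      using lnQ by (simp add: h_def Q K_def power_mult_distrib algebra_simps)
    have eq: "Y0 + - ln (1 - defect \<xi>) - ln (tilt \<xi>) = Y0 - ln Q"
      using t reflectable_defect[OF g] by (simp add: Q_def ln_mult)
    have "b (x + \<xi>) - b x \<le> ln (Y0 - ln Q) - ln Y0"
      using barrier_le_reflectable(2)[OF g] unfolding eq b_x by simp
    also have "\<dots> = ln ((Y0 - ln Q) / Y0)" using barrier_le_reflectable(3)[OF g] Y0_ge unfolding eq by (subst ln_div) auto
    also have "\<dots> \<le> (Y0 - ln Q) / Y0 - 1" using barrier_le_reflectable(3)[OF g] Y0_ge unfolding eq by (intro ln_le_minus_one) auto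
    also have "\<dots> = (- ln Q) / Y0" using Y0_ge by (simp add: field_simps)
    also have "\<dots> \<le> (- (\<xi> \<bullet> m) + K * (norm \<xi>)\<^sup>2) / Y0" using lnQ2 Y0_ge by (intro divide_right_mono) auto
    finally show ?thesis by (simp add: inner_commute add_divide_distrib diff_divide_distrib)
  qed
  moreover have "K / Y0 \<ge> 0" using Y0_ge p by (simp add: K_def)
  ultimately show ?thesis using that[of r0 "K / Y0" "- (1 / Y0) *\<^sub>R m"] r0(1) by auto
qed

section \<open>Integral estimates for the barrier\<close>

lemma measurable_reflectable [measurable]: "Measurable.pred borel reflectable"
  unfolding reflectable_def[abs_def] tilt_def by measurable

text \<open>Since \<open>defect \<xi> \<le> 1\<close> it can be replaced by its power \<open>3 \<alpha> / 2\<close>.  This is at most a multiple of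
  \<open>(|\<xi>|\<^sup>2 / \<rho>) powr (3 \<alpha> / 2)\<close> and makes the kernel integrable at the origin, because \<open>3 \<alpha> > 2 \<alpha>\<close>,
  at the price of \<open>\<rho> powr (- 3 \<alpha> / 2)\<close>, which is of lower order than the gain.\<close>

lemma defect_integral_le:
  assumes \<alpha>: "0 < \<alpha>" "\<alpha> \<le> 1 / 2" and D: "D > 0" "\<Omega> \<subseteq> cball x D"
  shows "(\<integral>\<^sup>+ \<xi>. ennreal (defect \<xi> / norm \<xi> powr (real CARD('n) + 2 * \<alpha>)) * indicator {\<xi>. reflectable \<xi> \<and> 1 \<le> tilt \<xi>} \<xi> \<partial>lborel)
    \<le> ennreal (defect_const TYPE('n) \<alpha> R D * \<rho> powr (- (3 * \<alpha> / 2)))"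
proof -
  let ?N = "real CARD('n)" and ?s = "3 * \<alpha> / 2"
  let ?c = "(2 * R * \<rho>) powr (- ?s)"
  have p: "2 * R * \<rho> > 0" using R_pos \<rho>_pos by simp
  have N1: "?N - \<alpha> \<ge> -1" using \<alpha> by simp
  have "(\<integral>\<^sup>+ \<xi>. ennreal (defect \<xi> / norm \<xi> powr (?N + 2 * \<alpha>)) * indicator {\<xi>. reflectable \<xi> \<and> 1 \<le> tilt \<xi>} \<xi> \<partial>lborel)
    \<le> (\<integral>\<^sup>+ \<xi>. ennreal ?c * (ennreal (norm \<xi> powr (- (?N - \<alpha>))) * indicator (cball (0 :: real ^ 'n) D) \<xi>) \<partial>lborel)"
  proof (rule nn_integral_mono)
    fix \<xi> :: "real ^ 'n"
    show "ennreal (defect \<xi> / norm \<xi> powr (?N + 2 * \<alpha>)) * indicator {\<xi>. reflectable \<xi> \<and> 1 \<le> tilt \<xi>} \<xi>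
      \<le> ennreal ?c * (ennreal (norm \<xi> powr (- (?N - \<alpha>))) * indicator (cball 0 D) \<xi>)"
    proof (cases "reflectable \<xi> \<and> 1 \<le> tilt \<xi> \<and> \<xi> \<noteq> 0")
      case True
      then have g: "reflectable \<xi>" and t: "1 \<le> tilt \<xi>" and nz: "norm \<xi> > 0" by auto
      have "x + \<xi> \<in> cball x D" using barrier_le_reflectable(1)[OF g] D by blast
      then have inD: "\<xi> \<in> cball 0 D" by (simp add: dist_norm)
      note X = reflectable_defect[OF g]
      have X1: "defect \<xi> \<le> (norm \<xi>)\<^sup>2 / (2 * R * \<rho>)"
      proof -
        have "2 * R * \<rho> * 1 \<le> 2 * R * \<rho> * tilt \<xi>" using p t by (intro mult_left_mono) auto
        then show ?thesis unfolding defect_def using p by (intro frac_le) auto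
      qed
      have "defect \<xi> = defect \<xi> powr 1" using X by simp
      also have "\<dots> \<le> defect \<xi> powr ?s" using X \<alpha> by (intro powr_mono') auto
      also have "\<dots> \<le> ((norm \<xi>)\<^sup>2 / (2 * R * \<rho>)) powr ?s" using X X1 \<alpha> by (intro powr_mono2) auto
      also have "\<dots> = ?c * norm \<xi> powr (3 * \<alpha>)"
      proof -
        have "(norm \<xi>)\<^sup>2 = norm \<xi> powr 2" using nz by simp
        then have "((norm \<xi>)\<^sup>2 / (2 * R * \<rho>)) powr ?s = (norm \<xi> powr 2) powr ?s / (2 * R * \<rho>) powr ?s"
          using p by (simp only: powr_divide powr_ge_zero less_imp_le)
        also have "(norm \<xi> powr 2) powr ?s = norm \<xi> powr (3 * \<alpha>)" by (simp only: powr_powr) simp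
        also have "norm \<xi> powr (3 * \<alpha>) / (2 * R * \<rho>) powr ?s = 1 / (2 * R * \<rho>) powr ?s * norm \<xi> powr (3 * \<alpha>)" by simp
        also have "1 / (2 * R * \<rho>) powr ?s = ?c" by (rule powr_minus_divide[symmetric])
        finally show ?thesis .
      qed
      finally have "defect \<xi> / norm \<xi> powr (?N + 2 * \<alpha>) \<le> ?c * norm \<xi> powr (3 * \<alpha>) / norm \<xi> powr (?N + 2 * \<alpha>)"
        by (intro divide_right_mono) auto
      also have "\<dots> = ?c * norm \<xi> powr (- (?N - \<alpha>))"
      proof -
        have "norm \<xi> powr (3 * \<alpha>) / norm \<xi> powr (?N + 2 * \<alpha>) = norm \<xi> powr (3 * \<alpha> - (?N + 2 * \<alpha>))"
          by (rule powr_diff[symmetric])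
        moreover have "3 * \<alpha> - (?N + 2 * \<alpha>) = - (?N - \<alpha>)" by simp
        ultimately show ?thesis by (simp only: times_divide_eq_right[symmetric])
      qed
      finally have "ennreal (defect \<xi> / norm \<xi> powr (?N + 2 * \<alpha>)) \<le> ennreal (?c * norm \<xi> powr (- (?N - \<alpha>)))"
        by (rule ennreal_leI)
      then show ?thesis using True inD by (simp add: ennreal_mult)
    qed (auto simp: indicator_def defect_def)
  qed
  also have "\<dots> = ennreal ?c * (\<integral>\<^sup>+ \<xi>. ennreal (norm (\<xi> :: real ^ 'n) powr (- (?N - \<alpha>))) * indicator (cball 0 D) \<xi> \<partial>lborel)"
    by (rule nn_integral_cmult) measurable
  also have "\<dots> \<le> ennreal ?c * ennreal (2 powr (?N - \<alpha> + 1) * ball_vol TYPE(real ^ 'n) * ((2 * D) powr (?N - (?N - \<alpha>)) / (?N - (?N - \<alpha>))))"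
    using nn_integral_norm_powr_cball[of "?N - \<alpha>" D, where 'a="real ^ 'n"] N1 \<alpha> D by (intro mult_left_mono) auto
  also have "\<dots> = ennreal (defect_const TYPE('n) \<alpha> R D * \<rho> powr (- ?s))"
  proof -
    have c: "?c = (2 * R) powr (- ?s) * \<rho> powr (- ?s)" by (rule powr_mult)
    have e: "?N - (?N - \<alpha>) = \<alpha>" by simp
    have gen: "ennreal (c1 * c2) * ennreal (a * v * (q / e)) = ennreal (a * v * (q / e) * c1 * c2)"
      if "c1 \<ge> 0" "c2 \<ge> 0" "a * v * (q / e) \<ge> 0" for c1 c2 a v q e :: real
      using that by (subst ennreal_mult[symmetric]) (simp_all add: mult_ac)
    show ?thesis unfolding defect_const_def c e by (rule gen) (use \<alpha> in \<open>auto simp: ball_vol_def\<close>)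
  qed
  finally show ?thesis .
qed

text \<open>The lens meets \<open>cball 0 l\<close> in a slab of thickness \<open>O(l\<^sup>2)\<close>, so its volume there is \<open>O(l\<close> to the power
  \<open>N + 1)\<close>.  The weaker exponent \<open>N + \<alpha>\<close> lets the radial integral converge at infinity for all
  \<open>\<alpha>\<close> at once.\<close>

lemma lens_kernel_integral_le:
  assumes \<alpha>: "0 < \<alpha>" "\<alpha> \<le> 1 / 2" and D: "D > 0" "\<Omega> \<subseteq> cball x D"
  shows "(\<integral>\<^sup>+ \<xi>. ennreal (norm \<xi> powr (- (real CARD('n) + 5 * \<alpha> / 2))) * indicator {\<xi>. x + \<xi> \<in> \<Omega> \<and> \<not> reflectable \<xi>} \<xi> \<partial>lborel)
    \<le> ennreal (lens_const TYPE('n) \<alpha> R D * d powr (- (3 * \<alpha> / 2)))"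
proof -
  let ?N = "real CARD('n)" and ?V = "ball_vol TYPE(real ^ 'n)"
  let ?S = "{\<xi>. x + \<xi> \<in> \<Omega> \<and> \<not> reflectable \<xi>}"
  let ?A = "2 * 2 powr ?N * ?V * (2 / R) * (2 * D) powr (1 - \<alpha>)"
  have V: "?V \<ge> 0" by (simp add: ball_vol_def)
  have [measurable]: "\<Omega> \<in> sets borel" using open_domain by simp
  have Sm: "?S \<in> sets borel" by measurable
  have A: "?A \<ge> 0" using R_pos V by simp
  have "(\<integral>\<^sup>+ \<xi>. ennreal (norm \<xi> powr (- (?N + 5 * \<alpha> / 2))) * indicator ?S \<xi> \<partial>lborel)
    \<le> ennreal (2 powr (?N + 5 * \<alpha> / 2 + 1) * ?A) * (\<integral>\<^sup>+ l. ennreal (l powr (?N + \<alpha> - (?N + 5 * \<alpha> / 2) - 1)) * indicator ({d / 4..} \<inter> {0<..2 * D}) l \<partial>lborel)"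
  proof (rule nn_integral_norm_powr_le[OF Sm])
    show "-1 \<le> ?N + 5 * \<alpha> / 2" using \<alpha> by simp
    show "0 \<le> ?A" by (rule A)
    show "0 \<le> d / 4" using d_pos by simp
    fix l assume l: "0 < l" "l \<le> 2 * D"
    have "?S \<inter> cball 0 l \<subseteq> {\<xi> \<in> cball 0 l. \<bar>\<xi> \<bullet> \<nu> + d\<bar> \<le> 2 / R * l\<^sup>2}"
    proof (intro subsetI)
      fix \<xi> assume \<xi>: "\<xi> \<in> ?S \<inter> cball 0 l"
      then have "norm \<xi> \<le> l" by (simp add: dist_norm)
      then have "(norm \<xi>)\<^sup>2 \<le> l\<^sup>2" by (intro power_mono) auto
      then have "2 / R * (norm \<xi>)\<^sup>2 \<le> 2 / R * l\<^sup>2" using R_pos by (intro mult_left_mono) auto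
      then show "\<xi> \<in> {\<xi> \<in> cball 0 l. \<bar>\<xi> \<bullet> \<nu> + d\<bar> \<le> 2 / R * l\<^sup>2}"
        using not_reflectable_in_lens(2)[of \<xi>] \<xi> by auto
    qed
    then have "emeasure lborel (?S \<inter> cball 0 l) \<le> emeasure lborel {\<xi> \<in> cball 0 l. \<bar>\<xi> \<bullet> \<nu> + d\<bar> \<le> 2 / R * l\<^sup>2}"
    proof (rule emeasure_mono)
      have "{\<xi> \<in> cball 0 l. \<bar>\<xi> \<bullet> \<nu> + d\<bar> \<le> 2 / R * l\<^sup>2} = cball 0 l \<inter> {\<xi>. \<bar>\<xi> \<bullet> \<nu> + d\<bar> \<le> 2 / R * l\<^sup>2}" by auto
      also have "\<dots> \<in> sets lborel" by measurable
      finally show "{\<xi> \<in> cball 0 l. \<bar>\<xi> \<bullet> \<nu> + d\<bar> \<le> 2 / R * l\<^sup>2} \<in> sets lborel" .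
    qed
    also have "\<dots> \<le> ennreal (2 * 2 powr real DIM(real ^ 'n) * ?V * (2 / R * l\<^sup>2) * l powr (real DIM(real ^ 'n) - 1))"
      using R_pos by (intro emeasure_slab_cball_le norm_\<nu> l) auto
    also have "\<dots> \<le> ennreal (?A * l powr (?N + \<alpha>))"
    proof (rule ennreal_leI)
      have "l\<^sup>2 * l powr (?N - 1) = l powr (?N + \<alpha>) * l powr (1 - \<alpha>)"
      proof -
        have "l\<^sup>2 = l powr 2" using l by simp
        then show ?thesis by (simp only: powr_add[symmetric]) (simp add: add.commute)
      qed
      also have "\<dots> \<le> l powr (?N + \<alpha>) * (2 * D) powr (1 - \<alpha>)"
        using l \<alpha> by (intro mult_left_mono powr_mono2) auto
      finally have "(2 * 2 powr ?N * ?V * (2 / R)) * (l\<^sup>2 * l powr (?N - 1)) \<le> (2 * 2 powr ?N * ?V * (2 / R)) * (l powr (?N + \<alpha>) * (2 * D) powr (1 - \<alpha>))"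
        using V R_pos by (intro mult_left_mono) auto
      then show "2 * 2 powr real DIM(real ^ 'n) * ?V * (2 / R * l\<^sup>2) * l powr (real DIM(real ^ 'n) - 1) \<le> ?A * l powr (?N + \<alpha>)"
        by (simp add: mult_ac)
    qed
    finally show "emeasure lborel (?S \<inter> cball 0 l) \<le> ennreal (?A * l powr (?N + \<alpha>))" .
  next
    fix \<xi> assume \<xi>: "\<xi> \<in> ?S"
    then have "x + \<xi> \<in> cball x D" using D by auto
    then show "d / 4 \<le> norm \<xi> \<and> norm \<xi> \<le> D" using not_reflectable_in_lens(1)[of \<xi>] \<xi> by (simp add: dist_norm)
  qed
  also have "\<dots> \<le> ennreal (2 powr (?N + 5 * \<alpha> / 2 + 1) * ?A) * ennreal ((d / 4) powr (- (3 * \<alpha> / 2)) / (3 * \<alpha> / 2))"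
  proof (rule mult_left_mono)
    have "(\<integral>\<^sup>+ l. ennreal (l powr (?N + \<alpha> - (?N + 5 * \<alpha> / 2) - 1)) * indicator ({d / 4..} \<inter> {0<..2 * D}) l \<partial>lborel)
      \<le> (\<integral>\<^sup>+ l. ennreal (l powr (- (3 * \<alpha> / 2) - 1)) * indicator {d / 4..} l \<partial>lborel)"
      by (rule nn_integral_mono) (auto simp: indicator_def)
    also have "\<dots> = ennreal ((d / 4) powr (- (3 * \<alpha> / 2)) / (3 * \<alpha> / 2))"
      using has_integral_powr_to_inf[of "- (3 * \<alpha> / 2) - 1" "d / 4"] \<alpha> d_pos
      by (intro nn_integral_has_integral_lebesgue') auto
    finally show "(\<integral>\<^sup>+ l. ennreal (l powr (?N + \<alpha> - (?N + 5 * \<alpha> / 2) - 1)) * indicator ({d / 4..} \<inter> {0<..2 * D}) l \<partial>lborel)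
      \<le> ennreal ((d / 4) powr (- (3 * \<alpha> / 2)) / (3 * \<alpha> / 2))" .
  qed simp
  also have "\<dots> = ennreal (lens_const TYPE('n) \<alpha> R D * d powr (- (3 * \<alpha> / 2)))"
  proof -
    have e: "(d / 4) powr (- (3 * \<alpha> / 2)) = 4 powr (3 * \<alpha> / 2) * d powr (- (3 * \<alpha> / 2))"
      using d_pos by (simp add: powr_divide powr_minus field_simps)
    have gen: "ennreal (c * a) * ennreal (q * e / s) = ennreal (c * a * (q / s) * e)"
      if "c \<ge> 0" "a \<ge> 0" "s \<ge> 0" "q \<ge> 0" "e \<ge> 0" for c a q e s :: real
      using that by (subst ennreal_mult[symmetric]) simp_all
    show ?thesis unfolding lens_const_def e by (rule gen) (use A \<alpha> in auto)
  qed
  finally show ?thesis .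
qed

text \<open>The barrier is unbounded on the lens, which may touch the boundary anywhere.  Young's inequality
  in the form \<open>u k \<le> u powr M + k powr (1 + \<sigma>)\<close> separates it from the kernel.\<close>

lemma lens_integral_le:
  assumes \<alpha>: "0 < \<alpha>" "\<alpha> \<le> 1 / 2" and D: "D > 0" "\<Omega> \<subseteq> cball x D"
  defines "M \<equiv> 1 + 2 * (real CARD('n) + 2 * \<alpha>) / \<alpha>"
  shows "(\<integral>\<^sup>+ \<xi>. ennreal (b (x + \<xi>) / norm \<xi> powr (real CARD('n) + 2 * \<alpha>)) * indicator {\<xi>. x + \<xi> \<in> \<Omega> \<and> \<not> reflectable \<xi>} \<xi> \<partial>lborel)
    \<le> (\<integral>\<^sup>+ z. ennreal (b z powr M) * indicator \<Omega> z \<partial>lborel) + ennreal (lens_const TYPE('n) \<alpha> R D * d powr (- (3 * \<alpha> / 2)))"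
proof -
  let ?p = "real CARD('n) + 2 * \<alpha>" and ?S = "{\<xi>. x + \<xi> \<in> \<Omega> \<and> \<not> reflectable \<xi>}"
  have [measurable]: "\<Omega> \<in> sets borel" using open_domain by simp
  have p: "?p > 0" using \<alpha> by (simp add: add_nonneg_pos)
  \<comment> \<open>This exponent turns the kernel into the one of \<open>lens_kernel_integral_le\<close>, and
    \<open>M\<close> is \<open>1 + 1 / \<sigma>\<close>.\<close>
  define \<sigma> where "\<sigma> = \<alpha> / (2 * ?p)"
  have \<sigma>: "\<sigma> > 0" "?p * (1 + \<sigma>) = real CARD('n) + 5 * \<alpha> / 2" "1 + 1 / \<sigma> = M"
    using \<alpha> p by (auto simp: \<sigma>_def M_def field_simps)
  \<comment> \<open>Compare \<open>u\<close> with \<open>k powr \<sigma>\<close>: the larger one absorbs the other.\<close>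
  have young: "u * k \<le> u powr M + k powr (1 + \<sigma>)" if "0 \<le> u" "0 \<le> k" for u k :: real
  proof (cases "u \<le> k powr \<sigma>")
    case True
    have "u * k \<le> k powr \<sigma> * k" using True that by (intro mult_right_mono)
    also have "\<dots> = k powr (1 + \<sigma>)" using that by (cases "k = 0") (auto simp: powr_add)
    finally show ?thesis using powr_ge_zero[of u M] by linarith
  next
    case False
    then have "(k powr \<sigma>) powr (1 / \<sigma>) \<le> u powr (1 / \<sigma>)" using \<sigma> by (intro powr_mono2) auto
    then have "k \<le> u powr (1 / \<sigma>)" using \<sigma> that by (simp add: powr_powr)
    then have "u * k \<le> u * u powr (1 / \<sigma>)" using that by (intro mult_left_mono)
    also have "\<dots> = u powr M" using that \<sigma>(3) by (cases "u = 0") (auto simp: powr_add simp flip: \<sigma>(3))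
    finally show ?thesis using powr_ge_zero[of k "1 + \<sigma>"] by linarith
  qed
  have "(\<integral>\<^sup>+ \<xi>. ennreal (b (x + \<xi>) / norm \<xi> powr ?p) * indicator ?S \<xi> \<partial>lborel)
    \<le> (\<integral>\<^sup>+ \<xi>. ennreal (b (\<xi> + x) powr M) * indicator \<Omega> (\<xi> + x) + ennreal (norm \<xi> powr (- (real CARD('n) + 5 * \<alpha> / 2))) * indicator ?S \<xi> \<partial>lborel)"
  proof (rule nn_integral_mono)
    fix \<xi>
    show "ennreal (b (x + \<xi>) / norm \<xi> powr ?p) * indicator ?S \<xi>
      \<le> ennreal (b (\<xi> + x) powr M) * indicator \<Omega> (\<xi> + x) + ennreal (norm \<xi> powr (- (real CARD('n) + 5 * \<alpha> / 2))) * indicator ?S \<xi>"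
    proof (cases "\<xi> \<in> ?S")
      case True
      then have z: "\<xi> + x \<in> \<Omega>" by (simp add: add.commute)
      have bn: "0 \<le> b (\<xi> + x)" by (rule barrier_nonneg[OF open_domain bounded_domain R_pos z])
      have "(norm \<xi> powr (- ?p)) powr (1 + \<sigma>) = norm \<xi> powr (- (?p * (1 + \<sigma>)))" by (simp only: powr_powr mult_minus_left)
      then have "b (\<xi> + x) * norm \<xi> powr (- ?p) \<le> b (\<xi> + x) powr M + norm \<xi> powr (- (real CARD('n) + 5 * \<alpha> / 2))"
        using young[OF bn powr_ge_zero, of "norm \<xi>" "- ?p"] \<sigma>(2) by simp
      then have "ennreal (b (\<xi> + x) / norm \<xi> powr ?p) \<le> ennreal (b (\<xi> + x) powr M + norm \<xi> powr (- (real CARD('n) + 5 * \<alpha> / 2)))"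
        by (intro ennreal_leI) (simp only: powr_minus divide_inverse)
      then have *: "ennreal (b (\<xi> + x) / norm \<xi> powr ?p) \<le> ennreal (b (\<xi> + x) powr M) + ennreal (norm \<xi> powr (- (real CARD('n) + 5 * \<alpha> / 2)))"
        by (subst ennreal_plus[symmetric]) auto
      have i: "indicator ?S \<xi> = (1 :: ennreal)" "indicator \<Omega> (\<xi> + x) = (1 :: ennreal)"
        using True z by (simp_all only: indicator_simps)
      show ?thesis unfolding i mult_1_right add.commute[of x \<xi>] by (rule *)
    qed simp
  qed
  also have "\<dots> = (\<integral>\<^sup>+ \<xi>. ennreal (b (\<xi> + x) powr M) * indicator \<Omega> (\<xi> + x) \<partial>lborel)
      + (\<integral>\<^sup>+ \<xi>. ennreal (norm \<xi> powr (- (real CARD('n) + 5 * \<alpha> / 2))) * indicator ?S \<xi> \<partial>lborel)"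
    by (rule nn_integral_add) measurable
  also have "(\<integral>\<^sup>+ \<xi>. ennreal (b (\<xi> + x) powr M) * indicator \<Omega> (\<xi> + x) \<partial>lborel) = (\<integral>\<^sup>+ z. ennreal (b z powr M) * indicator \<Omega> z \<partial>lborel)"
    by (rule nn_integral_translate[where f="\<lambda>z. ennreal (b z powr M) * indicator \<Omega> z"]) measurable
  also have "\<dots> + (\<integral>\<^sup>+ \<xi>. ennreal (norm \<xi> powr (- (real CARD('n) + 5 * \<alpha> / 2))) * indicator ?S \<xi> \<partial>lborel)
    \<le> \<dots> + ennreal (lens_const TYPE('n) \<alpha> R D * d powr (- (3 * \<alpha> / 2)))"
    by (intro add_left_mono lens_kernel_integral_le \<alpha> D)
  finally show ?thesis .
qed

text \<open>The positive part of the barrier's increment on the far half \<open>\<xi> \<bullet> m \<le> 0\<close> of the reflectable ball,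
  weighted with the kernel.\<close>

definition "reflected_excess \<alpha> r \<xi> =
  indicator {\<xi>. reflectable \<xi> \<and> \<xi> \<bullet> m \<le> 0 \<and> r \<le> norm \<xi>} \<xi> * max 0 (b (x + \<xi>) - b x) / norm \<xi> powr (real CARD('n) + 2 * \<alpha>)"

text \<open>The same function transported by the involution, Jacobian included, to the half \<open>0 \<le> \<xi> \<bullet> m\<close>.\<close>

definition "reflected_weight \<alpha> r \<xi> =
  indicator {\<xi>. 0 \<le> \<xi> \<bullet> m} \<xi> * reflected_excess \<alpha> r (- (1 / tilt \<xi>) *\<^sub>R \<xi>) / tilt \<xi> ^ (CARD('n) + 1)"

lemma reflected_nonneg: "0 \<le> reflected_excess \<alpha> r \<xi>" "0 \<le> reflected_weight \<alpha> r \<xi>"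
proof -
  show *: "0 \<le> reflected_excess \<alpha> r \<xi>" for \<xi> by (simp add: reflected_excess_def)
  show "0 \<le> reflected_weight \<alpha> r \<xi>"
    using * by (auto simp: reflected_weight_def indicator_def tilt_def intro!: divide_nonneg_nonneg)
qed

lemma reflected_measurable [measurable]:
  "reflected_excess \<alpha> r \<in> borel_measurable borel" "reflected_weight \<alpha> r \<in> borel_measurable borel"
proof -
  show [measurable]: "reflected_excess \<alpha> r \<in> borel_measurable borel"
    unfolding reflected_excess_def[abs_def] by measurable
  have [measurable]: "(\<lambda>\<xi>. - (1 / tilt \<xi>) *\<^sub>R \<xi>) \<in> borel_measurable borel" "tilt \<in> borel_measurable borel"
    unfolding tilt_def[abs_def] by measurable
  show "reflected_weight \<alpha> r \<in> borel_measurable borel"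
    unfolding reflected_weight_def[abs_def] by measurable
qed

lemma reflected_integral_eq:
  "(\<integral>\<^sup>+ \<xi>. ennreal (reflected_excess \<alpha> r \<xi>) \<partial>lborel) = (\<integral>\<^sup>+ \<xi>. ennreal (reflected_weight \<alpha> r \<xi>) \<partial>lborel)"
proof -
  have "(\<integral>\<^sup>+ \<xi>. ennreal (reflected_excess \<alpha> r \<xi>) \<partial>lborel)
    = (\<integral>\<^sup>+ \<xi>. ennreal (reflected_excess \<alpha> r \<xi>) * indicator {\<xi>. -1 < \<xi> \<bullet> m \<and> \<xi> \<bullet> m \<le> 0} \<xi> \<partial>lborel)"
  proof (rule nn_integral_cong)
    fix \<xi>
    show "ennreal (reflected_excess \<alpha> r \<xi>) = ennreal (reflected_excess \<alpha> r \<xi>) * indicator {\<xi>. -1 < \<xi> \<bullet> m \<and> \<xi> \<bullet> m \<le> 0} \<xi>"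
      using reflectable_tilt_pos[of \<xi>] by (auto simp: reflected_excess_def indicator_def tilt_def)
  qed
  also have "\<dots> = (\<integral>\<^sup>+ \<xi>. ennreal (reflected_excess \<alpha> r (- (1 / (1 + \<xi> \<bullet> m)) *\<^sub>R \<xi>)) * ennreal (1 / (1 + \<xi> \<bullet> m) ^ (DIM(real ^ 'n) + 1))
         * indicator {\<xi>. 0 \<le> \<xi> \<bullet> m} \<xi> \<partial>lborel)"
    by (rule nn_integral_projective_reflection) measurable
  also have "\<dots> = (\<integral>\<^sup>+ \<xi>. ennreal (reflected_weight \<alpha> r \<xi>) \<partial>lborel)"
  proof (rule nn_integral_cong)
    fix \<xi> :: "real ^ 'n"
    show "ennreal (reflected_excess \<alpha> r (- (1 / (1 + \<xi> \<bullet> m)) *\<^sub>R \<xi>)) * ennreal (1 / (1 + \<xi> \<bullet> m) ^ (DIM(real ^ 'n) + 1)) * indicator {\<xi>. 0 \<le> \<xi> \<bullet> m} \<xi>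
      = ennreal (reflected_weight \<alpha> r \<xi>)"
      using reflected_nonneg(1)[of \<alpha> r "- (1 / (1 + \<xi> \<bullet> m)) *\<^sub>R \<xi>"]
      by (auto simp: reflected_weight_def indicator_def tilt_def ennreal_mult[symmetric])
  qed
  finally show ?thesis .
qed

lemma reflected_weight_eq:
  assumes g: "reflectable \<xi>" and t: "1 \<le> tilt \<xi>" and n: "r * tilt \<xi> \<le> norm \<xi>"
  shows "reflected_weight \<alpha> r \<xi> = tilt \<xi> powr (2 * \<alpha> - 1) * max 0 (b (x + - (1 / tilt \<xi>) *\<^sub>R \<xi>) - b x) / norm \<xi> powr (real CARD('n) + 2 * \<alpha>)"
proof -
  have tp: "tilt \<xi> > 0" using t by simp
  note rg = reflection_invariants[OF tp]
  have c1: "0 \<le> \<xi> \<bullet> m" using t by (simp add: tilt_def)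
  then have c2: "(- (1 / tilt \<xi>) *\<^sub>R \<xi>) \<bullet> m \<le> 0" using tp by simp
  have c3: "r \<le> norm (- (1 / tilt \<xi>) *\<^sub>R \<xi>)" unfolding rg(4) using n tp by (simp add: pos_le_divide_eq)
  have k: "(1 / (norm \<xi> / tilt \<xi>) powr (real CARD('n) + 2 * \<alpha>)) / tilt \<xi> ^ (CARD('n) + 1) = tilt \<xi> powr (2 * \<alpha> - 1) / norm \<xi> powr (real CARD('n) + 2 * \<alpha>)"
  proof -
    have "tilt \<xi> ^ (CARD('n) + 1) = tilt \<xi> powr (real CARD('n) + 1)" using tp by (simp only: powr_realpow[symmetric] of_nat_add of_nat_1)
    moreover have "tilt \<xi> powr (real CARD('n) + 2 * \<alpha>) / tilt \<xi> powr (real CARD('n) + 1) = tilt \<xi> powr (2 * \<alpha> - 1)"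
      by (subst powr_diff[symmetric]) (simp add: algebra_simps)
    moreover have "(norm \<xi> / tilt \<xi>) powr (real CARD('n) + 2 * \<alpha>) = norm \<xi> powr (real CARD('n) + 2 * \<alpha>) / tilt \<xi> powr (real CARD('n) + 2 * \<alpha>)"
      by (rule powr_divide)
    moreover have "(1 / (K / u)) / v = (u / v) / K" for K u v :: real by simp
    ultimately show ?thesis by (simp only:)
  qed
  have "reflected_weight \<alpha> r \<xi> = (1 / (norm \<xi> / tilt \<xi>) powr (real CARD('n) + 2 * \<alpha>)) / tilt \<xi> ^ (CARD('n) + 1) * max 0 (b (x + - (1 / tilt \<xi>) *\<^sub>R \<xi>) - b x)"
    using c1 c2 c3 g tp rg(3) unfolding reflected_weight_def reflected_excess_def rg(4) by (simp add: indicator_def)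
  then show ?thesis unfolding k by simp
qed

lemma reflected_weight_eq_0:
  assumes "\<not> (reflectable \<xi> \<and> 1 \<le> tilt \<xi> \<and> r * tilt \<xi> \<le> norm \<xi>)"
  shows "reflected_weight \<alpha> r \<xi> = 0"
proof (cases "0 \<le> \<xi> \<bullet> m")
  case True
  then have t: "tilt \<xi> \<ge> 1" "tilt \<xi> > 0" by (auto simp: tilt_def)
  note rg = reflection_invariants[OF t(2)]
  have "\<not> (reflectable (- (1 / tilt \<xi>) *\<^sub>R \<xi>) \<and> r \<le> norm (- (1 / tilt \<xi>) *\<^sub>R \<xi>))"
    unfolding rg(3,4) using assms t by (simp add: pos_le_divide_eq)
  then have "reflected_excess \<alpha> r (- (1 / tilt \<xi>) *\<^sub>R \<xi>) = 0" unfolding reflected_excess_def by (simp add: indicator_def)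
  then show ?thesis by (simp add: reflected_weight_def)
qed (simp add: reflected_weight_def)

text \<open>On the ball of \<open>gain_region\<close> one has \<open>ln (tilt \<xi>) \<ge> 1 / 3\<close> and \<open>|\<xi>| \<le> 3 d\<close>, and this is the
  resulting lower bound for the gain \<open>(ln (tilt \<xi>))\<^sup>2 / Y0\<^sup>2\<close> times the kernel.\<close>

definition "gain_const \<alpha> = 1 / (9 * Y0\<^sup>2 * (3 * d) powr (real CARD('n) + 2 * \<alpha>))"

text \<open>The pointwise form of the estimate.  The transported weight on the left and the excess on the right
  have the same integral and cancel; what is left is the gain against the defect and the lens.\<close>

lemma excess_decomposition:
  assumes \<alpha>: "0 < \<alpha>" "\<alpha> \<le> 1 / 2" and r: "0 < r" "7 * r \<le> d" and z: "x + \<xi> \<in> \<Omega>" "r \<le> norm \<xi>"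
  shows "(b (x + \<xi>) - b x) / norm \<xi> powr (real CARD('n) + 2 * \<alpha>)
     + gain_const \<alpha> * indicator (ball ((2 * d) *\<^sub>R \<nu>) d) \<xi> + reflected_weight \<alpha> r \<xi>
    \<le> 6 * (indicator {\<xi>. reflectable \<xi> \<and> 1 \<le> tilt \<xi>} \<xi> * (defect \<xi> / norm \<xi> powr (real CARD('n) + 2 * \<alpha>)))
     + reflected_excess \<alpha> r \<xi>
     + indicator {\<xi>. x + \<xi> \<in> \<Omega> \<and> \<not> reflectable \<xi>} \<xi> * (b (x + \<xi>) / norm \<xi> powr (real CARD('n) + 2 * \<alpha>))"
proof -
  let ?k = "norm \<xi> powr (real CARD('n) + 2 * \<alpha>)" and ?G = "ball ((2 * d) *\<^sub>R \<nu>) d"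
  have k: "?k > 0" using z r by auto
  have p: "real CARD('n) + 2 * \<alpha> \<ge> 0" using \<alpha> by simp
  have inG: "norm (\<xi> - (2 * d) *\<^sub>R \<nu>) < d" if "\<xi> \<in> ?G" using that by (simp add: dist_norm norm_minus_commute)
  have bx: "0 \<le> b x" by (rule barrier_nonneg[OF open_domain bounded_domain R_pos x_in])
  consider (bad) "\<not> reflectable \<xi>" | (behind) "reflectable \<xi>" "tilt \<xi> < 1" | (single) "reflectable \<xi>" "1 \<le> tilt \<xi>" "norm \<xi> < r * tilt \<xi>"
    | (pair) "reflectable \<xi>" "1 \<le> tilt \<xi>" "r * tilt \<xi> \<le> norm \<xi>" by linarith
  then show ?thesis
  proof cases
    case bad
    then have "\<xi> \<notin> ?G" using gain_region(1)[OF inG] by blast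
    moreover have "(b (x + \<xi>) - b x) / ?k \<le> b (x + \<xi>) / ?k" using bx k by (intro divide_right_mono) auto
    ultimately show ?thesis using bad z reflected_weight_eq_0[of \<xi> r \<alpha>] reflected_nonneg(1)[of \<alpha> r \<xi>] by simp
  next
    case behind
    then have "\<xi> \<notin> ?G" using gain_region(2)[OF inG] by force
    moreover have "(b (x + \<xi>) - b x) / ?k \<le> reflected_excess \<alpha> r \<xi>"
      using behind z k by (auto simp: reflected_excess_def indicator_def tilt_def intro!: divide_right_mono)
    ultimately show ?thesis using behind reflected_weight_eq_0[of \<xi> r \<alpha>] by simp
  next
    case single
    have "\<xi> \<notin> ?G"
    proof
      assume "\<xi> \<in> ?G"
      note g = gain_region[OF inG[OF this]]
      have "r * tilt \<xi> \<le> r * 7" using g r by (intro mult_left_mono) auto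
      then show False using single g r by linarith
    qed
    moreover have "(b (x + \<xi>) - b x) / ?k \<le> 2 * defect \<xi> / ?k"
      using unpaired_le[OF single(1,2)] k by (intro divide_right_mono) auto
    moreover have "0 \<le> defect \<xi> / ?k" using reflectable_defect[OF single(1)] by simp
    ultimately show ?thesis using single reflected_weight_eq_0[of \<xi> r \<alpha>] reflected_nonneg(1)[of \<alpha> r \<xi>] by simp
  next
    case pair
    let ?s = "tilt \<xi> powr (2 * \<alpha> - 1)" and ?mx = "max 0 (b (x + - (1 / tilt \<xi>) *\<^sub>R \<xi>) - b x)"
    have s: "0 \<le> ?s" "?s \<le> 1"
      using pair \<alpha> powr_mono[of "2 * \<alpha> - 1" 0 "tilt \<xi>"] by auto
    have gain: "gain_const \<alpha> * indicator ?G \<xi> \<le> (ln (tilt \<xi>))\<^sup>2 / Y0\<^sup>2 / ?k"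
    proof (cases "\<xi> \<in> ?G")
      case True
      note g = gain_region[OF inG[OF True]]
      have "1 / 3 \<le> 1 - 1 / tilt \<xi>" using g by (simp add: field_simps)
      also have "\<dots> \<le> ln (tilt \<xi>)" using ln_le_minus_one[of "1 / tilt \<xi>"] g by (simp add: ln_div)
      finally have "(1 / 3)\<^sup>2 \<le> (ln (tilt \<xi>))\<^sup>2" by (intro power_mono) auto
      then have m1: "1 / 9 / Y0\<^sup>2 \<le> (ln (tilt \<xi>))\<^sup>2 / Y0\<^sup>2" by (intro divide_right_mono) (auto simp: power_divide)
      have m2: "?k \<le> (3 * d) powr (real CARD('n) + 2 * \<alpha>)" using g p by (intro powr_mono2) auto
      have "1 / 9 / Y0\<^sup>2 / (3 * d) powr (real CARD('n) + 2 * \<alpha>) \<le> (ln (tilt \<xi>))\<^sup>2 / Y0\<^sup>2 / ?k"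
        by (rule frac_le[OF _ m1 k m2]) simp
      then show ?thesis using True by (simp add: gain_const_def)
    qed simp
    have "(b (x + \<xi>) - b x + ?s * ?mx) / ?k \<le> (6 * defect \<xi> - (ln (tilt \<xi>))\<^sup>2 / Y0\<^sup>2) / ?k"
      using paired_le[OF pair(1,2) s] k by (intro divide_right_mono) auto
    then have "(b (x + \<xi>) - b x) / ?k + reflected_weight \<alpha> r \<xi> \<le> 6 * (defect \<xi> / ?k) - (ln (tilt \<xi>))\<^sup>2 / Y0\<^sup>2 / ?k"
      unfolding reflected_weight_eq[OF pair] by (simp add: add_divide_distrib diff_divide_distrib)
    then show ?thesis using gain pair reflected_nonneg(1)[of \<alpha> r \<xi>] by simp
  qed
qed

text \<open>This is \<open>excess_decomposition\<close> integrated: by \<open>reflected_integral_eq\<close> the transported terms cancel.\<close>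

lemma barrier_integral_le:
  assumes \<alpha>: "0 < \<alpha>" "\<alpha> \<le> 1 / 2" and D: "D > 0" "\<Omega> \<subseteq> cball x D" and r: "0 < r" "7 * r \<le> d"
    and b1: "(\<integral>\<^sup>+ z. ennreal (b z) * indicator \<Omega> z \<partial>lborel) < \<infinity>"
    and bM: "(\<integral>\<^sup>+ z. ennreal (b z powr (1 + 2 * (real CARD('n) + 2 * \<alpha>) / \<alpha>)) * indicator \<Omega> z \<partial>lborel) \<le> ennreal B" "0 \<le> B"
  shows "set_integrable lborel (\<Omega> - ball x r) (\<lambda>z. (b z - b x) / norm (z - x) powr (real CARD('n) + 2 * \<alpha>))"
    and "(LINT z:\<Omega> - ball x r|lborel. (b z - b x) / norm (z - x) powr (real CARD('n) + 2 * \<alpha>))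
      \<le> 6 * (defect_const TYPE('n) \<alpha> R D * \<rho> powr (- (3 * \<alpha> / 2)))
        + (B + lens_const TYPE('n) \<alpha> R D * d powr (- (3 * \<alpha> / 2)))
        - gain_const \<alpha> * (ball_vol TYPE(real ^ 'n) * d powr real CARD('n))"
proof -
  let ?p = "real CARD('n) + 2 * \<alpha>" and ?V = "ball_vol TYPE(real ^ 'n)"
  let ?k = "\<lambda>\<xi>. norm \<xi> powr ?p" and ?s = "3 * \<alpha> / 2"
  have p: "?p \<ge> 0" using \<alpha> by simp
  have \<Omega>m[measurable]: "\<Omega> \<in> sets borel" using open_domain by simp
  have bn: "0 \<le> b z" if "z \<in> \<Omega>" for z by (rule barrier_nonneg[OF open_domain bounded_domain R_pos that])
  have bint: "integrable lborel (\<lambda>z. indicator \<Omega> z * b z)"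
  proof (rule integrableI_nonneg)
    have "(\<integral>\<^sup>+ z. ennreal (indicator \<Omega> z * b z) \<partial>lborel) = (\<integral>\<^sup>+ z. ennreal (b z) * indicator \<Omega> z \<partial>lborel)"
      by (intro nn_integral_cong) (auto simp: indicator_def)
    then show "(\<integral>\<^sup>+ z. ennreal (indicator \<Omega> z * b z) \<partial>lborel) < \<infinity>" using b1 by simp
  qed (use bn in \<open>auto simp: indicator_def\<close>)
  have off: "r powr ?p \<le> ?k (z - x)" if "z \<notin> ball x r" for z
    using that r p by (intro powr_mono2) (auto simp: dist_norm norm_minus_commute)
  have rp: "r powr ?p > 0" using r by simp
  have bkint: "set_integrable lborel (\<Omega> - ball x r) (\<lambda>z. b z / ?k (z - x))"
    unfolding set_integrable_def
  proof (rule Bochner_Integration.integrable_bound)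
    show "integrable lborel (\<lambda>z. (1 / r powr ?p) * (indicator \<Omega> z * b z))" using bint by (rule integrable_mult_right)
    show "AE z in lborel. norm (indicator (\<Omega> - ball x r) z *\<^sub>R (b z / ?k (z - x))) \<le> norm ((1 / r powr ?p) * (indicator \<Omega> z * b z))"
    proof (rule AE_I2)
      fix z
      show "norm (indicator (\<Omega> - ball x r) z *\<^sub>R (b z / ?k (z - x))) \<le> norm ((1 / r powr ?p) * (indicator \<Omega> z * b z))"
      proof (cases "z \<in> \<Omega> - ball x r")
        case True
        then have "b z / ?k (z - x) \<le> b z / r powr ?p" using off[of z] bn[of z] rp by (intro divide_left_mono mult_pos_pos) auto
        then show ?thesis using True bn[of z] by simp
      qed simp
    qed
  qed measurable
  have cint: "set_integrable lborel (\<Omega> - ball x r) (\<lambda>z. b x / ?k (z - x))"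
    by (rule set_integrable_kernel_off_ball[OF \<Omega>m bounded_domain r(1) p, of _ "\<bar>b x\<bar>"]) (auto simp: set_borel_measurable_def)
  show int: "set_integrable lborel (\<Omega> - ball x r) (\<lambda>z. (b z - b x) / ?k (z - x))"
    using set_integral_diff(1)[OF bkint cint] by (simp add: diff_divide_distrib)
  let ?f = "\<lambda>z. indicator (\<Omega> - ball x r) z * ((b z - b x) / ?k (z - x))"
  have fint: "integrable lborel ?f" using int by (simp add: set_integrable_def)
  define h1 where "h1 = (\<lambda>\<xi>. indicator {\<xi>. reflectable \<xi> \<and> 1 \<le> tilt \<xi>} \<xi> * (defect \<xi> / ?k \<xi>))"
  define h2 where "h2 = (\<lambda>\<xi>. indicator (ball ((2 * d) *\<^sub>R \<nu>) d) \<xi> :: real)"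
  define h5 where "h5 = (\<lambda>\<xi>. indicator {\<xi>. x + \<xi> \<in> \<Omega> \<and> \<not> reflectable \<xi>} \<xi> * (b (x + \<xi>) / ?k \<xi>))"
  have hm[measurable]: "h1 \<in> borel_measurable borel" "h2 \<in> borel_measurable borel" "h5 \<in> borel_measurable borel"
    unfolding h1_def h2_def h5_def defect_def tilt_def by measurable
  have h1n: "0 \<le> h1 \<xi>" for \<xi> using reflectable_defect[of \<xi>] by (auto simp: h1_def indicator_def)
  have h5n: "0 \<le> h5 \<xi>" for \<xi> using bn[of "x + \<xi>"] by (auto simp: h5_def indicator_def)
  have shift: "(\<integral>\<^sup>+ z. ennreal (h (z - x)) \<partial>lborel) = (\<integral>\<^sup>+ \<xi>. ennreal (h \<xi>) \<partial>lborel)"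
    if "h \<in> borel_measurable borel" for h :: "real ^ 'n \<Rightarrow> real"
    using nn_integral_translate[of "\<lambda>\<xi>. ennreal (h \<xi>)" "- x"] that by simp
  have H1: "integrable lborel (\<lambda>z. h1 (z - x))" "(\<integral> z. h1 (z - x) \<partial>lborel) \<le> defect_const TYPE('n) \<alpha> R D * \<rho> powr (- ?s)"
  proof -
    have "(\<integral>\<^sup>+ z. ennreal (h1 (z - x)) \<partial>lborel) = (\<integral>\<^sup>+ \<xi>. ennreal (defect \<xi> / ?k \<xi>) * indicator {\<xi>. reflectable \<xi> \<and> 1 \<le> tilt \<xi>} \<xi> \<partial>lborel)"
      unfolding shift[OF hm(1)] by (intro nn_integral_cong) (auto simp: h1_def indicator_def)
    also have "\<dots> \<le> ennreal (defect_const TYPE('n) \<alpha> R D * \<rho> powr (- ?s))" by (rule defect_integral_le[OF \<alpha> D])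
    finally have le: "(\<integral>\<^sup>+ z. ennreal (h1 (z - x)) \<partial>lborel) \<le> ennreal (defect_const TYPE('n) \<alpha> R D * \<rho> powr (- ?s))" .
    have "0 \<le> defect_const TYPE('n) \<alpha> R D * \<rho> powr (- ?s)" using \<alpha> by (simp add: defect_const_def ball_vol_def)
    from integral_le_of_nn_integral_le[OF _ _ le this] h1n
    show "integrable lborel (\<lambda>z. h1 (z - x))" "(\<integral> z. h1 (z - x) \<partial>lborel) \<le> defect_const TYPE('n) \<alpha> R D * \<rho> powr (- ?s)"
      by auto
  qed
  have H5: "integrable lborel (\<lambda>z. h5 (z - x))" "(\<integral> z. h5 (z - x) \<partial>lborel) \<le> B + lens_const TYPE('n) \<alpha> R D * d powr (- ?s)"
  proof -
    have lc: "0 \<le> lens_const TYPE('n) \<alpha> R D" using \<alpha> R_pos by (simp add: lens_const_def ball_vol_def)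
    have "(\<integral>\<^sup>+ z. ennreal (h5 (z - x)) \<partial>lborel) = (\<integral>\<^sup>+ \<xi>. ennreal (b (x + \<xi>) / ?k \<xi>) * indicator {\<xi>. x + \<xi> \<in> \<Omega> \<and> \<not> reflectable \<xi>} \<xi> \<partial>lborel)"
      unfolding shift[OF hm(3)] by (intro nn_integral_cong) (auto simp: h5_def indicator_def)
    also have "\<dots> \<le> (\<integral>\<^sup>+ z. ennreal (b z powr (1 + 2 * ?p / \<alpha>)) * indicator \<Omega> z \<partial>lborel) + ennreal (lens_const TYPE('n) \<alpha> R D * d powr (- ?s))"
      by (rule lens_integral_le[OF \<alpha> D])
    also have "\<dots> \<le> ennreal B + ennreal (lens_const TYPE('n) \<alpha> R D * d powr (- ?s))" by (intro add_right_mono bM)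
    also have "\<dots> = ennreal (B + lens_const TYPE('n) \<alpha> R D * d powr (- ?s))" using bM lc by (intro ennreal_plus[symmetric]) auto
    finally have le: "(\<integral>\<^sup>+ z. ennreal (h5 (z - x)) \<partial>lborel) \<le> ennreal (B + lens_const TYPE('n) \<alpha> R D * d powr (- ?s))" .
    have "0 \<le> B + lens_const TYPE('n) \<alpha> R D * d powr (- ?s)" using bM lc by simp
    from integral_le_of_nn_integral_le[OF _ _ le this] h5n
    show "integrable lborel (\<lambda>z. h5 (z - x))" "(\<integral> z. h5 (z - x) \<partial>lborel) \<le> B + lens_const TYPE('n) \<alpha> R D * d powr (- ?s)"
      by auto
  qed
  have H2: "integrable lborel (\<lambda>z. h2 (z - x))" "(\<integral> z. h2 (z - x) \<partial>lborel) = ?V * d powr real CARD('n)"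
  proof -
    have V: "0 \<le> ?V * d powr real CARD('n)" by (simp add: ball_vol_def)
    have "(\<integral>\<^sup>+ z. ennreal (h2 (z - x)) \<partial>lborel) = emeasure lborel (ball ((2 * d) *\<^sub>R \<nu>) d)"
      unfolding shift[OF hm(2)] by (simp add: h2_def ennreal_indicator)
    also have "\<dots> = ennreal (?V * d powr real CARD('n))"
      using emeasure_cball_eq_ball_vol(2)[OF d_pos, of "(2 * d) *\<^sub>R \<nu>"] by simp
    finally have eq: "(\<integral>\<^sup>+ z. ennreal (h2 (z - x)) \<partial>lborel) = ennreal (?V * d powr real CARD('n))" .
    then show i: "integrable lborel (\<lambda>z. h2 (z - x))"
      by (intro integrableI_nonneg) (auto simp: h2_def)
    have "ennreal (\<integral> z. h2 (z - x) \<partial>lborel) = ennreal (?V * d powr real CARD('n))"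
      unfolding eq[symmetric] by (intro nn_integral_eq_integral[symmetric] i) (auto simp: h2_def)
    then show "(\<integral> z. h2 (z - x) \<partial>lborel) = ?V * d powr real CARD('n)"
      using V by (subst (asm) ennreal_inj) (auto simp: h2_def intro!: integral_nonneg_AE)
  qed
  \<comment> \<open>Off the excised ball the kernel is bounded, so integrability of the barrier suffices.\<close>
  have ex_le: "ennreal (reflected_excess \<alpha> r (z - x)) \<le> ennreal ((1 / r powr ?p) * (indicator \<Omega> z * b z))" for z
  proof (cases "reflectable (z - x) \<and> (z - x) \<bullet> m \<le> 0 \<and> r \<le> norm (z - x)")
    case True
    then have z\<Omega>: "z \<in> \<Omega>" using barrier_le_reflectable(1)[of "z - x"] by simp
    have k: "r powr ?p \<le> ?k (z - x)" using True by (intro off) (auto simp: dist_norm norm_minus_commute)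
    have "max 0 (b z - b x) / ?k (z - x) \<le> b z / r powr ?p"
      using bn[OF z\<Omega>] bn[OF x_in] k rp by (intro frac_le) auto
    then show ?thesis using True z\<Omega> by (intro ennreal_leI) (simp add: reflected_excess_def)
  qed (auto simp: reflected_excess_def)
  have H4: "integrable lborel (\<lambda>z. reflected_excess \<alpha> r (z - x))"
  proof (rule integrableI_nonneg)
    have "(\<integral>\<^sup>+ z. ennreal (reflected_excess \<alpha> r (z - x)) \<partial>lborel) \<le> (\<integral>\<^sup>+ z. ennreal ((1 / r powr ?p) * (indicator \<Omega> z * b z)) \<partial>lborel)"
      by (intro nn_integral_mono ex_le)
    also have "\<dots> = ennreal (\<integral> z. (1 / r powr ?p) * (indicator \<Omega> z * b z) \<partial>lborel)"
      using bn by (intro nn_integral_eq_integral integrable_mult_right bint) (auto simp: indicator_def)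
    also have "\<dots> < \<infinity>" by simp
    finally show "(\<integral>\<^sup>+ z. ennreal (reflected_excess \<alpha> r (z - x)) \<partial>lborel) < \<infinity>" .
  qed (use reflected_nonneg in auto)
  have eq34: "(\<integral>\<^sup>+ z. ennreal (reflected_weight \<alpha> r (z - x)) \<partial>lborel) = (\<integral>\<^sup>+ z. ennreal (reflected_excess \<alpha> r (z - x)) \<partial>lborel)"
    by (simp only: shift reflected_measurable reflected_integral_eq)
  have H3: "integrable lborel (\<lambda>z. reflected_weight \<alpha> r (z - x))"
  proof (rule integrableI_nonneg)
    have "(\<integral>\<^sup>+ z. ennreal (reflected_excess \<alpha> r (z - x)) \<partial>lborel) = ennreal (\<integral> z. reflected_excess \<alpha> r (z - x) \<partial>lborel)"
      by (intro nn_integral_eq_integral H4) (auto intro: reflected_nonneg)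
    then show "(\<integral>\<^sup>+ z. ennreal (reflected_weight \<alpha> r (z - x)) \<partial>lborel) < \<infinity>" unfolding eq34 by simp
  qed (use reflected_nonneg in auto)
  have H34: "(\<integral> z. reflected_weight \<alpha> r (z - x) \<partial>lborel) = (\<integral> z. reflected_excess \<alpha> r (z - x) \<partial>lborel)"
    using eq34 by (subst (1 2) integral_eq_nn_integral) (auto intro: reflected_nonneg)
  let ?g = "gain_const \<alpha>"
  have g0: "0 \<le> ?g" by (simp add: gain_const_def)
  have pt: "?f z + (?g * h2 (z - x) + reflected_weight \<alpha> r (z - x)) \<le> 6 * h1 (z - x) + reflected_excess \<alpha> r (z - x) + h5 (z - x)" for z
  proof (cases "z \<in> \<Omega> - ball x r")
    case True
    then have "x + (z - x) \<in> \<Omega>" "r \<le> norm (z - x)" by (auto simp: dist_norm norm_minus_commute)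
    from excess_decomposition[OF \<alpha> r this] show ?thesis
      using True by (simp add: h1_def h2_def h5_def algebra_simps)
  next
    case False
    have "\<not> (reflectable (z - x) \<and> r \<le> norm (z - x))"
      using False barrier_le_reflectable(1)[of "z - x"] by (auto simp: dist_norm norm_minus_commute)
    moreover have "r \<le> r * t" if "1 \<le> t" for t using that r mult_left_mono[of 1 t r] by simp
    ultimately have c: "\<not> (reflectable (z - x) \<and> 1 \<le> tilt (z - x) \<and> r * tilt (z - x) \<le> norm (z - x))"
      by (meson order_trans)
    have "z - x \<notin> ball ((2 * d) *\<^sub>R \<nu>) d"
    proof
      assume "z - x \<in> ball ((2 * d) *\<^sub>R \<nu>) d"
      then have "norm (z - x - (2 * d) *\<^sub>R \<nu>) < d" by (simp add: dist_norm norm_minus_commute)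
      from gain_region[OF this] show False using \<open>\<not> (reflectable (z - x) \<and> r \<le> norm (z - x))\<close> r by auto
    qed
    then show ?thesis
      using False reflected_weight_eq_0[OF c] h1n[of "z - x"] h5n[of "z - x"] reflected_nonneg(1)[of \<alpha> r "z - x"]
      by (simp add: h2_def)
  qed
  have i1: "integrable lborel (\<lambda>z. ?g * h2 (z - x) + reflected_weight \<alpha> r (z - x))"
    by (intro Bochner_Integration.integrable_add integrable_mult_right H2 H3)
  have i2: "integrable lborel (\<lambda>z. 6 * h1 (z - x) + reflected_excess \<alpha> r (z - x))"
    by (intro Bochner_Integration.integrable_add integrable_mult_right H1 H4)
  have "(\<integral> z. ?f z + (?g * h2 (z - x) + reflected_weight \<alpha> r (z - x)) \<partial>lborel)
    \<le> (\<integral> z. 6 * h1 (z - x) + reflected_excess \<alpha> r (z - x) + h5 (z - x) \<partial>lborel)"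
    by (rule integral_mono[OF Bochner_Integration.integrable_add[OF fint i1] Bochner_Integration.integrable_add[OF i2 H5(1)] pt])
  moreover have "(\<integral> z. ?f z + (?g * h2 (z - x) + reflected_weight \<alpha> r (z - x)) \<partial>lborel)
    = (\<integral> z. ?f z \<partial>lborel) + (?g * (?V * d powr real CARD('n)) + (\<integral> z. reflected_weight \<alpha> r (z - x) \<partial>lborel))"
    by (subst Bochner_Integration.integral_add[OF fint i1],
        subst Bochner_Integration.integral_add[OF integrable_mult_right[OF H2(1)] H3]) (simp add: H2(2))
  moreover have "(\<integral> z. 6 * h1 (z - x) + reflected_excess \<alpha> r (z - x) + h5 (z - x) \<partial>lborel)
    = 6 * (\<integral> z. h1 (z - x) \<partial>lborel) + (\<integral> z. reflected_excess \<alpha> r (z - x) \<partial>lborel) + (\<integral> z. h5 (z - x) \<partial>lborel)"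
    by (subst Bochner_Integration.integral_add[OF i2 H5(1)],
        subst Bochner_Integration.integral_add[OF integrable_mult_right[OF H1(1)] H4]) simp
  ultimately have "(\<integral> z. ?f z \<partial>lborel) \<le> 6 * (defect_const TYPE('n) \<alpha> R D * \<rho> powr (- ?s))
        + (B + lens_const TYPE('n) \<alpha> R D * d powr (- ?s)) - ?g * (?V * d powr real CARD('n))"
    using H1(2) H5(2) H34 by linarith
  then show "(LINT z:\<Omega> - ball x r|lborel. (b z - b x) / ?k (z - x))
      \<le> 6 * (defect_const TYPE('n) \<alpha> R D * \<rho> powr (- ?s))
        + (B + lens_const TYPE('n) \<alpha> R D * d powr (- ?s)) - ?g * (?V * d powr real CARD('n))"
    by (simp add: set_lebesgue_integral_def)
qed

text \<open>The gain is a multiple of \<open>d powr (- 2 * \<alpha>) / Y0\<^sup>2\<close>, and \<open>L\<close> is at least \<open>Y0\<close>.  Multiplied by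
  \<open>d powr (2 * \<alpha>) * L\<^sup>2\<close>, the errors become the left-hand side of the smallness hypothesis.\<close>

lemma barrier_integral_negative:
  assumes \<alpha>: "0 < \<alpha>" "\<alpha> \<le> 1 / 2" and D: "D > 0" "\<Omega> \<subseteq> cball x D"
    and b1: "(\<integral>\<^sup>+ z. ennreal (b z) * indicator \<Omega> z \<partial>lborel) < \<infinity>"
    and bM: "(\<integral>\<^sup>+ z. ennreal (b z powr (1 + 2 * (real CARD('n) + 2 * \<alpha>) / \<alpha>)) * indicator \<Omega> z \<partial>lborel) \<le> ennreal B" "0 \<le> B"
  defines "C \<equiv> 6 * defect_const TYPE('n) \<alpha> R D * 2 powr (3 * \<alpha> / 2) + lens_const TYPE('n) \<alpha> R D"
    and "\<kappa> \<equiv> ball_vol TYPE(real ^ 'n) / (9 * 3 powr (real CARD('n) + 2 * \<alpha>))"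
    and "L \<equiv> ln (2 * exp 1 * R / dist x y)"
  assumes small: "C * (dist x y powr (\<alpha> / 2) * L\<^sup>2) + B * (dist x y powr (2 * \<alpha>) * L\<^sup>2) < \<kappa>"
  shows "\<exists>\<gamma>>0. \<exists>r1>0. \<forall>r. 0 < r \<longrightarrow> r < r1 \<longrightarrow>
       set_integrable lborel (\<Omega> - ball x r) (\<lambda>z. (b z - b x) / norm (z - x) powr (real CARD('n) + 2 * \<alpha>)) \<and>
       (LINT z:\<Omega> - ball x r|lborel. (b z - b x) / norm (z - x) powr (real CARD('n) + 2 * \<alpha>)) \<le> - \<gamma>"
proof -
  let ?p = "real CARD('n) + 2 * \<alpha>" and ?s = "3 * \<alpha> / 2" and ?V = "ball_vol TYPE(real ^ 'n)"
  have V: "?V > 0" using emeasure_cball_eq_ball_vol(3)[of 1, where 'a="real ^ 'n"] by simp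
  have \<kappa>: "\<kappa> > 0" using V by (simp add: \<kappa>_def)
  let ?L = L
  have YL: "Y0 \<le> ?L"
  proof -
    have "exp 1 * R / \<rho> \<le> exp 1 * R / (d / 2)" using \<rho>_ge \<rho>_pos d_pos R_pos by (intro divide_left_mono) auto
    also have "\<dots> = 2 * exp 1 * R / dist x y" by (simp add: d_def)
    finally show ?thesis unfolding Y0_def L_def using \<rho>_pos R_pos d_pos[unfolded d_def] by (subst ln_le_cancel_iff) (auto simp del: zero_less_dist_iff)
  qed
  have gain: "gain_const \<alpha> * (?V * d powr real CARD('n)) = \<kappa> * d powr (- (2 * \<alpha>)) / Y0\<^sup>2"
  proof -
    have "(3 * d) powr ?p = 3 powr ?p * (d powr real CARD('n) * d powr (2 * \<alpha>))"
      by (simp add: powr_mult powr_add)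
    moreover have "d powr (- (2 * \<alpha>)) = 1 / d powr (2 * \<alpha>)" by (rule powr_minus_divide)
    moreover have "d powr real CARD('n) > 0" "d powr (2 * \<alpha>) > 0" using d_pos by auto
    moreover have "1 / (9 * Y * (q * (u * w))) * (V' * u) = V' / (9 * q) * (1 / w) / Y" if "u > 0" for Y q u w V' :: real
      using that by simp
    ultimately show ?thesis unfolding gain_const_def \<kappa>_def by (simp only:)
  qed
  define \<gamma> where "\<gamma> = \<kappa> * d powr (- (2 * \<alpha>)) / Y0\<^sup>2 - (C * d powr (- ?s) + B)"
  have "\<gamma> > 0"
  proof -
    have "(C * d powr (- ?s) + B) * (d powr (2 * \<alpha>) * ?L\<^sup>2) = C * (d powr (\<alpha> / 2) * ?L\<^sup>2) + B * (d powr (2 * \<alpha>) * ?L\<^sup>2)"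
    proof -
      have "d powr (- ?s) * d powr (2 * \<alpha>) = d powr (\<alpha> / 2)" by (subst powr_add[symmetric]) simp
      moreover have "(C * a + B) * (w * l) = C * ((a * w) * l) + B * (w * l)" for a w l by (simp add: algebra_simps)
      ultimately show ?thesis by (simp only:)
    qed
    also have "\<dots> < \<kappa>" using small by (simp only: d_def)
    finally have "(C * d powr (- ?s) + B) * (d powr (2 * \<alpha>) * ?L\<^sup>2) < \<kappa>" .
    moreover have pos: "d powr (2 * \<alpha>) * ?L\<^sup>2 > 0" using d_pos YL Y0_ge by (intro mult_pos_pos) auto
    ultimately have "C * d powr (- ?s) + B < \<kappa> / (d powr (2 * \<alpha>) * ?L\<^sup>2)" by (simp only: pos_less_divide_eq)
    also have "\<dots> = \<kappa> * d powr (- (2 * \<alpha>)) / ?L\<^sup>2" by (simp add: powr_minus_divide)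
    also have "\<dots> \<le> \<kappa> * d powr (- (2 * \<alpha>)) / Y0\<^sup>2"
      using YL Y0_ge \<kappa> by (intro divide_left_mono power_mono mult_pos_pos mult_nonneg_nonneg) auto
    finally show ?thesis by (simp add: \<gamma>_def)
  qed
  moreover have "set_integrable lborel (\<Omega> - ball x r) (\<lambda>z. (b z - b x) / norm (z - x) powr ?p) \<and>
      (LINT z:\<Omega> - ball x r|lborel. (b z - b x) / norm (z - x) powr ?p) \<le> - \<gamma>" if r: "0 < r" "r < d / 7" for r
  proof -
    have r7: "7 * r \<le> d" using r by simp
    note * = barrier_integral_le[OF \<alpha> D r(1) r7 b1 bM]
    have dc: "0 \<le> defect_const TYPE('n) \<alpha> R D" using \<alpha> V by (simp add: defect_const_def)
    have "\<rho> powr (- ?s) \<le> (d / 2) powr (- ?s)" using \<rho>_ge d_pos \<alpha> by (intro powr_mono2') auto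
    also have "(d / 2) powr (- ?s) = 2 powr ?s * d powr (- ?s)"
      by (simp add: powr_divide powr_minus_divide)
    finally have "6 * (defect_const TYPE('n) \<alpha> R D * \<rho> powr (- ?s)) \<le> 6 * (defect_const TYPE('n) \<alpha> R D * (2 powr ?s * d powr (- ?s)))"
      using dc by (intro mult_left_mono) auto
    then have "6 * (defect_const TYPE('n) \<alpha> R D * \<rho> powr (- ?s)) + (B + lens_const TYPE('n) \<alpha> R D * d powr (- ?s))
       \<le> C * d powr (- ?s) + B" by (simp add: C_def algebra_simps)
    then show ?thesis using * unfolding gain \<gamma>_def by linarith
  qed
  ultimately show ?thesis using d_pos by (intro exI[of _ \<gamma>] conjI exI[of _ "d / 7"]) auto
qed

end

hide_const (open) d \<nu> \<rho> m Y0 tilt defect reflectable b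

section \<open>Superharmonicity of the barrier\<close>

lemma powr_times_ln_square_tendsto_0:
  fixes \<beta> c :: real
  assumes "\<beta> > 0" "c > 0"
  shows "((\<lambda>d. d powr \<beta> * (ln (c / d))\<^sup>2) \<longlongrightarrow> 0) (at_right 0)"
proof (rule tendsto_sandwich)
  let ?C = "(4 / \<beta>)\<^sup>2 * c powr (\<beta> / 2)"
  show "eventually (\<lambda>d. 0 \<le> d powr \<beta> * (ln (c / d))\<^sup>2) (at_right 0)" by simp
  show "((\<lambda>d::real. 0::real) \<longlongrightarrow> 0) (at_right 0)" by simp
  have "((\<lambda>d. ?C * d powr (\<beta> / 2)) \<longlongrightarrow> ?C * 0 powr (\<beta> / 2)) (at_right 0)"
    using assms by (intro tendsto_intros) (auto simp: eventually_mono[OF eventually_at_right_less] less_imp_le)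
  then show "((\<lambda>d. ?C * d powr (\<beta> / 2)) \<longlongrightarrow> 0) (at_right 0)" by simp
  show "eventually (\<lambda>d. d powr \<beta> * (ln (c / d))\<^sup>2 \<le> ?C * d powr (\<beta> / 2)) (at_right 0)"
  proof (rule eventually_at_rightI)
    show "0 < c" by (rule assms)
    fix d assume d: "d \<in> {0<..<c}"
    then have cd: "1 \<le> c / d" "0 < d" by auto
    have "ln (c / d) \<le> (c / d) powr (\<beta> / 4) / (\<beta> / 4)" using assms cd by (intro ln_powr_bound) auto
    then have "(ln (c / d))\<^sup>2 \<le> ((c / d) powr (\<beta> / 4) / (\<beta> / 4))\<^sup>2" using cd by (intro power_mono) auto
    also have "\<dots> = (4 / \<beta>)\<^sup>2 * ((c / d) powr (\<beta> / 4) * (c / d) powr (\<beta> / 4))"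
      by (simp add: power2_eq_square)
    also have "(c / d) powr (\<beta> / 4) * (c / d) powr (\<beta> / 4) = (c / d) powr (\<beta> / 2)"
      by (subst powr_add[symmetric]) simp
    also have "(c / d) powr (\<beta> / 2) = c powr (\<beta> / 2) / d powr (\<beta> / 2)" by (rule powr_divide)
    finally have "d powr \<beta> * (ln (c / d))\<^sup>2 \<le> d powr \<beta> * ((4 / \<beta>)\<^sup>2 * (c powr (\<beta> / 2) / d powr (\<beta> / 2)))"
      by (intro mult_left_mono) auto
    also have "\<dots> = ?C * (d powr \<beta> / d powr (\<beta> / 2))" by simp
    also have "d powr \<beta> / d powr (\<beta> / 2) = d powr (\<beta> / 2)" by (subst powr_diff[symmetric]) simp
    finally show "d powr \<beta> * (ln (c / d))\<^sup>2 \<le> ?C * d powr (\<beta> / 2)" .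
  qed
qed

text \<open>As the distance \<open>d\<close> to the boundary tends to \<open>0\<close>, the gain of order
  \<open>d powr (- 2 \<alpha>) / (ln (c / d))\<^sup>2\<close> outweighs all errors, which are \<open>O(d powr (- 3 \<alpha> / 2))\<close>.\<close>

lemma barrier_strictly_superharmonic:
  fixes \<Omega> :: "(real ^ 'n) set"
  assumes \<Omega>: "open \<Omega>" "bounded \<Omega>" "\<Omega> \<noteq> {}" and R: "R > 0" and two: "two_sided_ball \<Omega> R"
    and fin: "(\<integral>\<^sup>+ z. ennreal (infdist z (- \<Omega>) powr (- 1 / 2)) * indicator \<Omega> z \<partial>lborel) < \<infinity>"
    and \<alpha>: "0 < \<alpha>" "\<alpha> \<le> 1 / 2"
  obtains \<delta> where "\<delta> > 0"
    "\<And>x. x \<in> \<Omega> \<Longrightarrow> infdist x (- \<Omega>) < \<delta> \<Longrightarrow> \<exists>\<gamma>>0. \<exists>r1>0. \<forall>r. 0 < r \<longrightarrow> r < r1 \<longrightarrow>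
       set_integrable lborel (\<Omega> - ball x r) (\<lambda>z. (barrier R \<Omega> z - barrier R \<Omega> x) / norm (z - x) powr (real CARD('n) + 2 * \<alpha>)) \<and>
       (LINT z:\<Omega> - ball x r|lborel. (barrier R \<Omega> z - barrier R \<Omega> x) / norm (z - x) powr (real CARD('n) + 2 * \<alpha>)) \<le> - \<gamma>"
    "\<And>x. x \<in> \<Omega> \<Longrightarrow> infdist x (- \<Omega>) < \<delta> \<Longrightarrow> \<exists>v K r0. r0 > 0 \<and> K \<ge> 0 \<and>
       (\<forall>\<xi>. norm \<xi> < r0 \<longrightarrow> barrier R \<Omega> (x + \<xi>) - barrier R \<Omega> x \<le> v \<bullet> \<xi> + K * (norm \<xi>)\<^sup>2)"
proof -
  let ?b = "barrier R \<Omega>" and ?p = "real CARD('n) + 2 * \<alpha>" and ?s = "3 * \<alpha> / 2" and ?V = "ball_vol TYPE(real ^ 'n)"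
  let ?M = "1 + 2 * ?p / \<alpha>"
  obtain x0 where x0: "x0 \<in> \<Omega>" using \<Omega>(3) by auto
  obtain e where e: "e > 0" "\<Omega> \<subseteq> ball x0 e" using \<Omega>(2) by (metis bounded_subset_ballD)
  define D where "D = 2 * e"
  have D: "D > 0" and sub: "\<And>x. x \<in> \<Omega> \<Longrightarrow> \<Omega> \<subseteq> cball x D"
  proof -
    show "D > 0" using e by (simp add: D_def)
    fix x assume "x \<in> \<Omega>"
    show "\<Omega> \<subseteq> cball x D"
    proof
      fix z assume "z \<in> \<Omega>"
      then have "dist x0 z < e" "dist x0 x < e" using e \<open>x \<in> \<Omega>\<close> by auto
      then show "z \<in> cball x D" using dist_triangle[of x z x0] by (simp add: D_def dist_commute)
    qed
  qed
  have M: "?M > 0" using \<alpha> by (simp add: add_pos_nonneg)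
  have bMfin: "(\<integral>\<^sup>+ z. ennreal (?b z powr ?M) * indicator \<Omega> z \<partial>lborel) < \<infinity>"
    by (rule barrier_powr_integral_finite[OF \<Omega>(1,2) R fin M])
  define B where "B = enn2real (\<integral>\<^sup>+ z. ennreal (?b z powr ?M) * indicator \<Omega> z \<partial>lborel)"
  have bM: "(\<integral>\<^sup>+ z. ennreal (?b z powr ?M) * indicator \<Omega> z \<partial>lborel) \<le> ennreal B" "0 \<le> B"
    using bMfin by (auto simp: B_def)
  have b1: "(\<integral>\<^sup>+ z. ennreal (?b z) * indicator \<Omega> z \<partial>lborel) < \<infinity>"
  proof -
    have "(\<integral>\<^sup>+ z. ennreal (?b z) * indicator \<Omega> z \<partial>lborel) = (\<integral>\<^sup>+ z. ennreal (?b z powr 1) * indicator \<Omega> z \<partial>lborel)"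
      using barrier_nonneg[OF \<Omega>(1,2) R] by (intro nn_integral_cong) (auto simp: indicator_def)
    also have "\<dots> < \<infinity>" by (rule barrier_powr_integral_finite[OF \<Omega>(1,2) R fin]) simp
    finally show ?thesis .
  qed
  define C where "C = 6 * defect_const TYPE('n) \<alpha> R D * 2 powr ?s + lens_const TYPE('n) \<alpha> R D"
  define \<kappa> where "\<kappa> = ?V / (9 * 3 powr ?p)"
  have V: "?V > 0" using emeasure_cball_eq_ball_vol(3)[of 1, where 'a="real ^ 'n"] by simp
  have \<kappa>: "\<kappa> > 0" using V by (simp add: \<kappa>_def)
  define c where "c = 2 * exp 1 * R"
  have c: "c > 0" using R by (simp add: c_def)
  have "((\<lambda>d. C * (d powr (\<alpha> / 2) * (ln (c / d))\<^sup>2) + B * (d powr (2 * \<alpha>) * (ln (c / d))\<^sup>2)) \<longlongrightarrow> C * 0 + B * 0) (at_right 0)"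
    using \<alpha> c by (intro tendsto_intros powr_times_ln_square_tendsto_0) auto
  then have "eventually (\<lambda>d. C * (d powr (\<alpha> / 2) * (ln (c / d))\<^sup>2) + B * (d powr (2 * \<alpha>) * (ln (c / d))\<^sup>2) < \<kappa>) (at_right 0)"
    using \<kappa> by (intro order_tendstoD(2)) auto
  then obtain \<delta>0 where \<delta>0: "\<delta>0 > 0" and small: "\<And>d. 0 < d \<Longrightarrow> d < \<delta>0 \<Longrightarrow>
      C * (d powr (\<alpha> / 2) * (ln (c / d))\<^sup>2) + B * (d powr (2 * \<alpha>) * (ln (c / d))\<^sup>2) < \<kappa>"
    unfolding eventually_at_right_field by blast
  define \<delta> where "\<delta> = min \<delta>0 (R / 20)"
  have \<delta>: "\<delta> > 0" using \<delta>0 R by (simp add: \<delta>_def)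
  have chart: "\<exists>y. tangent_balls \<Omega> R x y \<and> dist x y = infdist x (- \<Omega>)" if x: "x \<in> \<Omega>" "infdist x (- \<Omega>) < \<delta>" for x
  proof -
    have "- \<Omega> \<noteq> {}" using \<Omega>(2) not_bounded_UNIV by (metis Compl_empty_eq double_compl)
    then obtain y where y: "y \<notin> \<Omega>" "infdist x (- \<Omega>) = dist x y"
      using infdist_attains_inf[of "- \<Omega>" x] \<Omega>(1) by (auto simp: closed_Compl)
    have lt: "20 * dist x y \<le> R" "dist x y < R" using x y R by (auto simp: \<delta>_def)
    have "tangent_balls \<Omega> R x y"
      using two[unfolded two_sided_ball_def, rule_format, OF x(1) y(1) y(2)[symmetric] lt(2)] \<Omega> R x y lt
      unfolding tangent_balls_def by simp
    then show ?thesis using y by auto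
  qed
  show ?thesis
  proof (rule that[of \<delta>])
    show "\<delta> > 0" by (rule \<delta>)
    fix x assume x: "x \<in> \<Omega>" "infdist x (- \<Omega>) < \<delta>"
    from chart[OF x] obtain y where tb: "tangent_balls \<Omega> R x y" and y: "dist x y = infdist x (- \<Omega>)" by blast
    show "\<exists>v K r0. r0 > 0 \<and> K \<ge> 0 \<and> (\<forall>\<xi>. norm \<xi> < r0 \<longrightarrow> ?b (x + \<xi>) - ?b x \<le> v \<bullet> \<xi> + K * (norm \<xi>)\<^sup>2)"
      using barrier_touched_above[OF tb] by metis
    have "0 < dist x y" "dist x y < \<delta>0" using x y infdist_compl_pos[OF \<Omega>(1,2) x(1)] by (auto simp: \<delta>_def)
    from small[OF this]
    show "\<exists>\<gamma>>0. \<exists>r1>0. \<forall>r. 0 < r \<longrightarrow> r < r1 \<longrightarrow>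
       set_integrable lborel (\<Omega> - ball x r) (\<lambda>z. (?b z - ?b x) / norm (z - x) powr ?p) \<and>
       (LINT z:\<Omega> - ball x r|lborel. (?b z - ?b x) / norm (z - x) powr ?p) \<le> - \<gamma>"
      unfolding C_def \<kappa>_def c_def
      by (rule barrier_integral_negative[OF tb \<alpha> D sub[OF x(1)] b1 bM])
  qed
qed

section \<open>Testing a viscosity supersolution\<close>

lemma set_integral_nonneg_mono_set:
  fixes f :: "_ \<Rightarrow> real"
  assumes "set_integrable M A f" "B \<in> sets M" "B \<subseteq> A" "\<And>x. x \<in> A \<Longrightarrow> 0 \<le> f x"
  shows "(LINT x:B|M. f x) \<le> (LINT x:A|M. f x)"
  unfolding set_lebesgue_integral_def
proof (rule integral_mono)
  show "integrable M (\<lambda>x. indicator B x *\<^sub>R f x)" "integrable M (\<lambda>x. indicator A x *\<^sub>R f x)"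
    using assms set_integrable_subset[OF assms(1-3)] by (auto simp: set_integrable_def)
qed (use assms in \<open>auto simp: indicator_def\<close>)

lemma frac_laplacian_const_pos:
  assumes "0 < \<alpha>" "\<alpha> < 1"
  shows "frac_laplacian_const TYPE('n::finite) \<alpha> > 0"
proof -
  have "- \<alpha> \<notin> \<int>\<^sub>\<le>\<^sub>0"
  proof
    assume "- \<alpha> \<in> \<int>\<^sub>\<le>\<^sub>0"
    then obtain n :: nat where "- \<alpha> = - of_nat n" by (elim nonpos_Ints_cases')
    then have "0 < real n" "real n < 1" using assms by auto
    then show False by simp
  qed
  then have "Gamma (- \<alpha>) \<noteq> 0" by (simp add: Gamma_eq_zero_iff)
  moreover have "Gamma (real CARD('n) / 2 + \<alpha>) > 0" using assms by (intro Gamma_real_pos) (simp add: add_nonneg_pos)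
  ultimately show ?thesis by (simp add: frac_laplacian_const_def)
qed

lemma borel_measurable_continuous_on_open:
  fixes u :: "'a::euclidean_space \<Rightarrow> real"
  assumes "open S" "continuous_on S u"
  shows "set_borel_measurable lborel S u"
  using assms borel_measurable_continuous_on_indicator[of S u] by (simp add: set_borel_measurable_def borel_open)

lemma real_polynomial_function_norm_diff_sq:
  "real_polynomial_function (\<lambda>z::'a::euclidean_space. (norm (z - x))\<^sup>2)"
proof -
  have "(norm (z - x))\<^sup>2 = (\<Sum>b\<in>Basis. ((z \<bullet> b) - (x \<bullet> b))\<^sup>2)" for z
  proof -
    have "(norm (z - x))\<^sup>2 = (z - x) \<bullet> (z - x)" by (simp add: power2_norm_eq_inner)
    also have "\<dots> = (\<Sum>b\<in>Basis. ((z \<bullet> b) - (x \<bullet> b))\<^sup>2)"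
      by (subst euclidean_inner) (simp only: inner_diff_left power2_eq_square)
    finally show ?thesis .
  qed
  then show ?thesis
    by (auto intro!: real_polynomial_function_sum real_polynomial_function_power real_polynomial_function_diff
         real_polynomial_function.intros(2) real_polynomial_function.intros(1)[OF bounded_linear_inner_left])
qed

text \<open>Given a polynomial \<open>\<psi>\<close> that lies below \<open>u\<close> near \<open>x\<close>, there is a polynomial below \<open>u\<close> on all of \<open>A\<close>
  that is almost as large as \<open>\<psi>\<close> near \<open>x\<close> and almost as large as \<open>u\<close> elsewhere.  It has the form
  \<open>\<psi> + |z - x|\<^sup>2 Q\<close>, with \<open>Q\<close> a Weierstrass approximation from below of the
  quotient of \<open>u - \<psi>\<close> by \<open>|z - x|\<^sup>2\<close>, truncated near \<open>x\<close>.  The loss is then of second order at \<open>x\<close>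
  and harmless for the singular kernel.\<close>

lemma polynomial_minorant:
  fixes u :: "'a::euclidean_space \<Rightarrow> real"
  assumes A: "compact A" "continuous_on A u"
    and \<psi>: "real_polynomial_function \<psi>" and r: "r > 0"
    and below: "\<And>z. z \<in> A \<Longrightarrow> norm (z - x) < r \<Longrightarrow> \<psi> z \<le> u z" and \<delta>: "\<delta> > 0"
  obtains \<phi> where "real_polynomial_function \<phi>" "\<phi> x = \<psi> x" "\<And>z. z \<in> A \<Longrightarrow> \<phi> z \<le> u z"
    "\<And>z. z \<in> A \<Longrightarrow> norm (z - x) < r \<Longrightarrow> \<psi> z - \<delta> * (norm (z - x))\<^sup>2 \<le> \<phi> z"
    "\<And>z. z \<in> A \<Longrightarrow> r \<le> norm (z - x) \<Longrightarrow> u z - \<delta> * (norm (z - x))\<^sup>2 \<le> \<phi> z"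
proof -
  \<comment> \<open>Taking the maximum with \<open>r\<close> keeps the quotient continuous at \<open>x\<close>; near \<open>x\<close> it only makes the
    nonnegative quotient smaller.\<close>
  define g where "g = (\<lambda>z. (u z - \<psi> z) / (max (norm (z - x)) r)\<^sup>2)"
  have pos: "max (norm (z - x)) r > 0" for z using r by (simp add: less_max_iff_disj)
  have "continuous_on A g"
    unfolding g_def using A(2) continuous_on_polymonial_function[OF \<psi>[unfolded real_polynomial_function_eq], of A] pos
    by (intro continuous_intros) (auto simp: less_imp_neq[symmetric])
  then have "continuous_on A (\<lambda>z. g z - \<delta> / 2)" by (intro continuous_intros)
  from Stone_Weierstrass_real_polynomial_function[OF A(1) this, of "\<delta> / 2"] \<delta>
  obtain Q where Q: "real_polynomial_function Q" "\<And>z. z \<in> A \<Longrightarrow> \<bar>g z - \<delta> / 2 - Q z\<bar> < \<delta> / 2" by auto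
  define \<phi> where "\<phi> = (\<lambda>z. \<psi> z + (norm (z - x))\<^sup>2 * Q z)"
  have lo: "Q z \<le> g z" and up: "g z - \<delta> \<le> Q z" if "z \<in> A" for z
    using Q(2)[OF that] unfolding abs_less_iff by linarith+
  have inside: "0 \<le> g z" "(norm (z - x))\<^sup>2 * g z \<le> u z - \<psi> z" if "z \<in> A" "norm (z - x) < r" for z
  proof -
    have d: "0 \<le> u z - \<psi> z" using below[OF that] by simp
    then show "0 \<le> g z" by (simp add: g_def)
    have m: "max (norm (z - x)) r = r" using that by simp
    have "(norm (z - x))\<^sup>2 / r\<^sup>2 \<le> 1" using that r by (simp add: power_mono)
    then have "(norm (z - x))\<^sup>2 / r\<^sup>2 * (u z - \<psi> z) \<le> 1 * (u z - \<psi> z)" using d by (intro mult_right_mono)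
    then show "(norm (z - x))\<^sup>2 * g z \<le> u z - \<psi> z" by (simp add: g_def m)
  qed
  have outside: "(norm (z - x))\<^sup>2 * g z = u z - \<psi> z" if "r \<le> norm (z - x)" for z
    using that r by (cases "z = x") (auto simp: g_def max_def)
  show ?thesis
  proof
    show "real_polynomial_function \<phi>" unfolding \<phi>_def 
      by (intro real_polynomial_function.intros(3,4) \<psi> Q(1) real_polynomial_function_norm_diff_sq)
    show "\<phi> x = \<psi> x" by (simp add: \<phi>_def)
    fix z assume z: "z \<in> A"
    have 1: "(norm (z - x))\<^sup>2 * Q z \<le> (norm (z - x))\<^sup>2 * g z" using lo[OF z] by (intro mult_left_mono) auto
    have 2: "(norm (z - x))\<^sup>2 * (g z - \<delta>) \<le> (norm (z - x))\<^sup>2 * Q z" using up[OF z] by (intro mult_left_mono) auto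
    show "\<phi> z \<le> u z" using 1 inside(2)[OF z] outside[of z] by (cases "norm (z - x) < r") (auto simp: \<phi>_def)
    show "\<psi> z - \<delta> * (norm (z - x))\<^sup>2 \<le> \<phi> z" if "norm (z - x) < r"
    proof -
      have "0 \<le> (norm (z - x))\<^sup>2 * g z" using inside(1)[OF z that] by simp
      then show ?thesis using 2 by (simp add: \<phi>_def algebra_simps)
    qed
    show "u z - \<delta> * (norm (z - x))\<^sup>2 \<le> \<phi> z" if "r \<le> norm (z - x)"
      using 2 outside[OF that] by (simp add: \<phi>_def algebra_simps)
  qed
qed

text \<open>The neighbourhood in the definition of a supersolution is not under control, and the equation only
  sees the test function inside it.  Hence the test function must approximate \<open>u\<close> itself away from
  \<open>x\<close>; \<open>polynomial_minorant\<close> provides it.  The linear term drops out by symmetry, and the quadratic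
  one contributes \<open>O(r powr (2 - 2 \<alpha>))\<close> on \<open>ball x r\<close>, which leaves an inequality for \<open>u\<close> alone.\<close>

lemma supersolution_quadratic_test:
  fixes \<Omega> :: "(real ^ 'n) set"
  assumes \<alpha>: "0 < \<alpha>" "\<alpha> < 1" and \<Omega>: "open \<Omega>" "bounded \<Omega>"
    and super: "viscosity_supersolution \<Omega> \<alpha> f u" and x: "x \<in> \<Omega>" and fx: "f x \<ge> 0"
    and bd: "\<And>z. z \<in> \<Omega> \<Longrightarrow> \<bar>u z\<bar> \<le> B"
    and r0: "r0 > 0" and K: "K \<ge> 0"
    and touch: "\<And>z. z \<in> \<Omega> \<Longrightarrow> norm (z - x) < r0 \<Longrightarrow> u x + v \<bullet> (z - x) - K * (norm (z - x))\<^sup>2 \<le> u z"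
    and \<eta>: "\<eta> > 0"
  shows "\<exists>r1>0. \<forall>r. 0 < r \<longrightarrow> r < r1 \<longrightarrow>
    - \<eta> \<le> (LINT z:\<Omega> - ball x r|lborel. (u x - u z) / norm (z - x) powr (real CARD('n) + 2 * \<alpha>))"
proof -
  let ?p = "real CARD('n) + 2 * \<alpha>"
  let ?k = "\<lambda>z. norm (z - x) powr ?p"
  define C where "C = 2 powr (real CARD('n) + 2 * \<alpha> - 1) * ball_vol TYPE(real^'n) * 2 powr (2 - 2 * \<alpha>) / (2 - 2 * \<alpha>)"
  have mom: "set_integrable lborel (ball x r) (\<lambda>z. (norm (z - x))\<^sup>2 / ?k z)"
    "(LINT z:ball x r|lborel. (norm (z - x))\<^sup>2 / ?k z) \<le> C * r powr (2 - 2 * \<alpha>)" if "r > 0" for r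
    using second_moment(1,2)[OF \<alpha> that, of x] by (simp_all add: C_def)
  have C: "C \<ge> 0" using \<alpha> by (simp add: C_def ball_vol_def)
  have cu: "continuous_on \<Omega> u" using super by (simp add: viscosity_supersolution_def)
  from super x obtain V where V: "open V" "x \<in> V" "closure V \<subseteq> \<Omega>"
    and test: "\<And>\<phi>. C2_upto_closure V \<phi> \<Longrightarrow> u x = \<phi> x \<Longrightarrow> (\<And>y. y \<in> V \<Longrightarrow> \<phi> y \<le> u y) \<Longrightarrow>
           \<exists>L. has_regional_frac_laplacian \<Omega> \<alpha> (\<lambda>y. if y \<in> V then \<phi> y else u y) x L \<and> L \<ge> f x"
    unfolding viscosity_supersolution_def by fastforce
  have V\<Omega>: "V \<subseteq> \<Omega>" using V(3) closure_subset by blast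
  obtain r2 where r2: "r2 > 0" "ball x r2 \<subseteq> V" using V openE by blast
  obtain D where D: "D > 0" "\<Omega> \<subseteq> ball x D"
    using \<Omega>(2) by (metis bounded_subset_ballD)
  have \<Omega>m: "\<Omega> \<in> sets borel" using \<Omega> by simp
  have mom\<Omega>: "set_integrable lborel \<Omega> (\<lambda>z. (norm (z - x))\<^sup>2 / ?k z)"
    by (rule set_integrable_subset[OF mom(1)[OF D(1)]]) (use D \<Omega>m in auto)
  let ?I = "\<lambda>r. (LINT z:\<Omega> - ball x r|lborel. (u x - u z) / ?k z)"
  have inequ: "- (K * (C * r powr (2 - 2 * \<alpha>))) \<le> ?I r" if r: "0 < r" "r < min r0 r2" for r
  proof -
    have rV: "ball x r \<subseteq> V" "ball x r \<subseteq> \<Omega>"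
    proof -
      have "ball x r \<subseteq> ball x r2" using r by (intro subset_ball) simp
      then show "ball x r \<subseteq> V" "ball x r \<subseteq> \<Omega>" using r2 V\<Omega> by blast+
    qed
    define \<psi> where "\<psi> = (\<lambda>z. u x + v \<bullet> (z - x) - K * (norm (z - x))\<^sup>2)"
    have poly: "real_polynomial_function \<psi>"
      unfolding \<psi>_def inner_diff_right
      by (intro real_polynomial_function_norm_diff_sq real_polynomial_function_diff
         real_polynomial_function.intros(2-4) real_polynomial_function.intros(1)[OF bounded_linear_inner_right])
    have main: "- (\<delta> * (C * D powr (2 - 2 * \<alpha>))) - K * (C * r powr (2 - 2 * \<alpha>)) \<le> ?I r" if \<delta>: "\<delta> > 0" for \<delta>
    proof -
      have "compact (closure V)" using V(3) \<Omega>(2) bounded_subset compact_closure closure_closure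
        by (metis compact_eq_bounded_closed closed_closure)
      moreover have "continuous_on (closure V) u" using cu V(3) continuous_on_subset by blast
      moreover have "\<psi> z \<le> u z" if "z \<in> closure V" "norm (z - x) < r" for z
        using touch[of z] that V(3) r by (auto simp: \<psi>_def)
      ultimately obtain \<phi> where \<phi>: "real_polynomial_function \<phi>" "\<phi> x = \<psi> x" "\<And>z. z \<in> closure V \<Longrightarrow> \<phi> z \<le> u z"
        "\<And>z. z \<in> closure V \<Longrightarrow> norm (z - x) < r \<Longrightarrow> \<psi> z - \<delta> * (norm (z - x))\<^sup>2 \<le> \<phi> z"
        "\<And>z. z \<in> closure V \<Longrightarrow> r \<le> norm (z - x) \<Longrightarrow> u z - \<delta> * (norm (z - x))\<^sup>2 \<le> \<phi> z"
        using polynomial_minorant[of "closure V" u \<psi> r x \<delta>] poly r(1) \<delta> by metis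
      define w where "w = (\<lambda>y. if y \<in> V then \<phi> y else u y)"
      have \<phi>x: "\<phi> x = u x" by (simp add: \<phi>(2) \<psi>_def)
      have clV: "z \<in> closure V" if "z \<in> V" for z using that closure_subset by blast
      have "\<exists>L. has_regional_frac_laplacian \<Omega> \<alpha> w x L \<and> L \<ge> f x"
        unfolding w_def using \<phi>(3) clV
        by (intro test real_polynomial_function_C2[OF \<phi>(1)]) (auto simp: \<phi>x)
      then obtain L where L: "has_regional_frac_laplacian \<Omega> \<alpha> w x L" "L \<ge> 0" using fx by auto
      have wx: "w x = u x" using V \<phi>x by (simp add: w_def)
      let ?c = "frac_laplacian_const TYPE('n) \<alpha>"
      have c: "?c > 0" using \<alpha> by (rule frac_laplacian_const_pos)
      have winteg: "set_integrable lborel (\<Omega> - ball x \<epsilon>) (\<lambda>z. (u x - w z) / ?k z)" if "\<epsilon> > 0" for \<epsilon>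
        using L that by (simp add: has_regional_frac_laplacian_def wx)
      have lim: "((\<lambda>\<epsilon>. ?c * (LINT z:\<Omega> - ball x \<epsilon>|lborel. (u x - w z) / ?k z)) \<longlongrightarrow> L) (at_right 0)"
        using L by (simp add: has_regional_frac_laplacian_def wx)
      let ?bd = "?I r + \<delta> * (C * D powr (2 - 2 * \<alpha>)) + K * (C * r powr (2 - 2 * \<alpha>))"
      have le: "(LINT z:\<Omega> - ball x \<epsilon>|lborel. (u x - w z) / ?k z) \<le> ?bd" if \<epsilon>: "0 < \<epsilon>" "\<epsilon> < r" for \<epsilon>
      proof -
        let ?A = "\<Omega> - ball x r" and ?R = "ball x r - ball x \<epsilon>"
        have sets: "?A \<in> sets lborel" "?R \<in> sets lborel" "\<Omega> - ball x \<epsilon> \<in> sets lborel" using \<Omega>m by auto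
        have um: "set_borel_measurable lborel \<Omega> (\<lambda>z. u x - u z)"
          using \<Omega>(1) by (rule borel_measurable_continuous_on_open) (intro continuous_intros cu)
        have i1: "set_integrable lborel ?A (\<lambda>z. (u x - u z) / ?k z)"
          using \<alpha> by (intro set_integrable_kernel_off_ball[OF \<Omega>m \<Omega>(2) r(1) _ um, of _ "B + B"])
             (use abs_triangle_ineq4[of "u x"] bd bd[OF x] in \<open>fastforce+\<close>)
        have i2: "set_integrable lborel (\<Omega> - ball x \<epsilon>) (\<lambda>z. \<delta> * ((norm (z - x))\<^sup>2 / ?k z))"
          by (intro set_integrable_mult_right set_integrable_subset[OF mom\<Omega>]) (use sets in auto)
        have i3: "set_integrable lborel ?R (\<lambda>z. K * ((norm (z - x))\<^sup>2 / ?k z))"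
          by (intro set_integrable_mult_right set_integrable_subset[OF mom(1)[OF r(1)]]) (use sets in auto)
        have i4: "set_integrable lborel ?R (\<lambda>z. ((- v) \<bullet> (z - x)) / ?k z)"
        proof (rule set_integrable_kernel_off_ball)
          show "set_borel_measurable lborel (ball x r) (\<lambda>z. (- v) \<bullet> (z - x))"
            by (rule borel_measurable_continuous_on_open) (auto intro!: continuous_intros)
          show "\<bar>(- v) \<bullet> (z - x)\<bar> \<le> norm v * r" if "z \<in> ball x r" for z
          proof -
            have "\<bar>(- v) \<bullet> (z - x)\<bar> \<le> norm (- v) * norm (z - x)" by (rule Cauchy_Schwarz_ineq2)
            also have "\<dots> \<le> norm v * r" using that by (auto simp: dist_norm norm_minus_commute intro!: mult_left_mono)
            finally show ?thesis .
          qed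
        qed (use \<epsilon> \<alpha> in auto)
        have i34: "set_integrable lborel ?R (\<lambda>z. ((- v) \<bullet> (z - x)) / ?k z + K * ((norm (z - x))\<^sup>2 / ?k z))"
          by (rule set_integral_add(1)[OF i4 i3])
        let ?h = "\<lambda>z. indicator ?A z * ((u x - u z) / ?k z) + indicator ?R z * (((- v) \<bullet> (z - x)) / ?k z + K * ((norm (z - x))\<^sup>2 / ?k z))
             + indicator (\<Omega> - ball x \<epsilon>) z * (\<delta> * ((norm (z - x))\<^sup>2 / ?k z))"
        have hint: "integrable lborel ?h"
          using i1 i34 i2 unfolding set_integrable_def by (intro Bochner_Integration.integrable_add) auto
        have "(LINT z:\<Omega> - ball x \<epsilon>|lborel. (u x - w z) / ?k z) \<le> (\<integral> z. ?h z \<partial>lborel)"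
          unfolding set_lebesgue_integral_def
        proof (rule integral_mono)
          show "integrable lborel (\<lambda>z. indicator (\<Omega> - ball x \<epsilon>) z *\<^sub>R ((u x - w z) / ?k z))"
            using winteg[OF \<epsilon>(1)] by (simp add: set_integrable_def)
          show "integrable lborel ?h" by (rule hint)
          fix z
          show "indicator (\<Omega> - ball x \<epsilon>) z *\<^sub>R ((u x - w z) / ?k z) \<le> ?h z"
          proof (cases "z \<in> \<Omega> - ball x \<epsilon>")
            case False
            then have "z \<notin> ?A" "z \<notin> ?R" using \<epsilon> rV by auto
            then have "indicator ?A z = (0::real)" "indicator ?R z = (0::real)" "indicator (\<Omega> - ball x \<epsilon>) z = (0::real)"
              using False by - (rule indicator_simps(2), assumption)+
            then show ?thesis by (simp only: scaleR_zero_left mult_zero_left add_0_left order_refl)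
          next
            case True
            then have kpos: "?k z > 0" using \<epsilon> by (auto simp: dist_norm)
            have nn: "0 \<le> \<delta> * (norm (z - x))\<^sup>2" using \<delta> by simp
            show ?thesis
            proof (cases "z \<in> ball x r")
              case inr: True
              then have zV: "z \<in> V" and nz: "norm (z - x) < r" using rV by (auto simp: dist_norm norm_minus_commute)
              have "u x - w z \<le> (- v) \<bullet> (z - x) + K * (norm (z - x))\<^sup>2 + \<delta> * (norm (z - x))\<^sup>2"
                using \<phi>(4)[OF clV[OF zV] nz] zV by (simp add: w_def \<psi>_def)
              then have "(u x - w z) / ?k z \<le> ((- v) \<bullet> (z - x) + K * (norm (z - x))\<^sup>2 + \<delta> * (norm (z - x))\<^sup>2) / ?k z"
                using kpos by (intro divide_right_mono) auto
              moreover have "indicator ?A z = (0::real)" "indicator ?R z = (1::real)" "indicator (\<Omega> - ball x \<epsilon>) z = (1::real)"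
                using True inr by (auto simp: indicator_def)
              ultimately show ?thesis by (simp only:) (simp add: add_divide_distrib diff_divide_distrib)
            next
              case out: False
              then have nz: "r \<le> norm (z - x)" by (auto simp: dist_norm norm_minus_commute)
              have "u x - w z \<le> (u x - u z) + \<delta> * (norm (z - x))\<^sup>2"
                using \<phi>(5)[OF clV _ , of z] nz nn by (auto simp: w_def)
              then have "(u x - w z) / ?k z \<le> ((u x - u z) + \<delta> * (norm (z - x))\<^sup>2) / ?k z"
                using kpos by (intro divide_right_mono) auto
              moreover have "indicator ?A z = (1::real)" "indicator ?R z = (0::real)" "indicator (\<Omega> - ball x \<epsilon>) z = (1::real)"
                using True out by (auto simp: indicator_def)
              ultimately show ?thesis by (simp only:) (simp add: add_divide_distrib diff_divide_distrib)
            qed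
          qed
        qed
        also have "(\<integral> z. ?h z \<partial>lborel) = ?I r + (LINT z:?R|lborel. ((- v) \<bullet> (z - x)) / ?k z + K * ((norm (z - x))\<^sup>2 / ?k z))
            + (LINT z:\<Omega> - ball x \<epsilon>|lborel. \<delta> * ((norm (z - x))\<^sup>2 / ?k z))"
        proof -
          have a: "integrable lborel (\<lambda>z. indicator ?A z * ((u x - u z) / ?k z))"
            and b: "integrable lborel (\<lambda>z. indicator ?R z * (((- v) \<bullet> (z - x)) / ?k z + K * ((norm (z - x))\<^sup>2 / ?k z)))"
            and c: "integrable lborel (\<lambda>z. indicator (\<Omega> - ball x \<epsilon>) z * (\<delta> * ((norm (z - x))\<^sup>2 / ?k z)))"
            using i1 i34 i2 by (simp_all only: set_integrable_def real_scaleR_def)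
          show ?thesis unfolding set_lebesgue_integral_def real_scaleR_def
            by (subst Bochner_Integration.integral_add[OF Bochner_Integration.integrable_add[OF a b] c])
               (subst Bochner_Integration.integral_add[OF a b], rule refl)
        qed
        also have "(LINT z:?R|lborel. ((- v) \<bullet> (z - x)) / ?k z + K * ((norm (z - x))\<^sup>2 / ?k z))
           = (LINT z:?R|lborel. K * ((norm (z - x))\<^sup>2 / ?k z))"
          by (subst set_integral_add(2)[OF i4 i3]) (simp only: annulus_odd_integral_zero add_0_left)
        also have "\<dots> = K * (LINT z:?R|lborel. (norm (z - x))\<^sup>2 / ?k z)"
          by (rule set_integral_mult_right)
        also have "\<dots> \<le> K * (LINT z:ball x r|lborel. (norm (z - x))\<^sup>2 / ?k z)"
          by (intro mult_left_mono K set_integral_nonneg_mono_set[OF mom(1)[OF r(1)]]) (use sets in auto)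
        also have "\<dots> \<le> K * (C * r powr (2 - 2 * \<alpha>))"
          by (intro mult_left_mono K mom(2) r)
        also have "(LINT z:\<Omega> - ball x \<epsilon>|lborel. \<delta> * ((norm (z - x))\<^sup>2 / ?k z)) = \<delta> * (LINT z:\<Omega> - ball x \<epsilon>|lborel. (norm (z - x))\<^sup>2 / ?k z)"
          by (rule set_integral_mult_right)
        also have "\<dots> \<le> \<delta> * (LINT z:ball x D|lborel. (norm (z - x))\<^sup>2 / ?k z)"
          using \<delta> D by (intro mult_left_mono set_integral_nonneg_mono_set[OF mom(1)[OF D(1)]]) (use sets in auto)
        also have "\<dots> \<le> \<delta> * (C * D powr (2 - 2 * \<alpha>))"
          using \<delta> D by (intro mult_left_mono mom(2)) auto
        finally show ?thesis by simp
      qed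
      have "eventually (\<lambda>\<epsilon>. ?c * (LINT z:\<Omega> - ball x \<epsilon>|lborel. (u x - w z) / ?k z) \<le> ?c * ?bd) (at_right 0)"
        by (rule eventually_at_rightI[of 0 r]) (use le less_imp_le[OF c] r in \<open>auto intro!: mult_left_mono\<close>)
      then have "L \<le> ?c * ?bd"
        by (intro tendsto_upperbound[OF lim]) auto
      then have "0 \<le> ?c * ?bd" using L by simp
      then have "0 \<le> ?bd" using c by (simp add: zero_le_mult_iff)
      then show ?thesis by simp
    qed
    show ?thesis
    proof (rule field_le_epsilon)
      fix e :: real assume e: "e > 0"
      let ?E = "C * D powr (2 - 2 * \<alpha>)"
      have E: "?E \<ge> 0" using C by simp
      have "e / (?E + 1) * ?E \<le> e" using E e by (simp add: divide_simps)
      then show "- (K * (C * r powr (2 - 2 * \<alpha>))) \<le> ?I r + e"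
        using main[of "e / (?E + 1)"] E e by (simp add: add_nonneg_pos)
    qed
  qed
  have "((\<lambda>r. K * (C * r powr (2 - 2 * \<alpha>))) \<longlongrightarrow> K * (C * 0 powr (2 - 2 * \<alpha>))) (at_right 0)"
    using \<alpha> by (intro tendsto_intros) (auto simp: eventually_at_right_less less_imp_le eventually_mono[OF eventually_at_right_less])
  then have "eventually (\<lambda>r. K * (C * r powr (2 - 2 * \<alpha>)) < \<eta>) (at_right 0)"
    using \<eta> by (intro order_tendstoD(2)) auto
  then obtain b where b: "b > 0" "\<And>r. 0 < r \<Longrightarrow> r < b \<Longrightarrow> K * (C * r powr (2 - 2 * \<alpha>)) < \<eta>"
    unfolding eventually_at_right_field by blast
  show ?thesis
  proof (intro exI[of _ "min b (min r0 r2)"] conjI allI impI)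
    show "0 < min b (min r0 r2)" using b r0 r2 by simp
    fix r assume r: "0 < r" "r < min b (min r0 r2)"
    show "- \<eta> \<le> ?I r" using inequ[of r] b(2)[of r] r by simp
  qed
qed

section \<open>Positivity and nonexistence\<close>

text \<open>The function has a finite limit at each point of the compact set \<open>closure \<Omega>\<close>.\<close>

lemma vanishing_continuous_bounded:
  fixes u :: "real ^ 'n \<Rightarrow> real"
  assumes \<Omega>: "open \<Omega>" "bounded \<Omega>" and cu: "continuous_on \<Omega> u" and van: "vanishes_on_boundary \<Omega> u"
  obtains B where "\<And>z. z \<in> \<Omega> \<Longrightarrow> \<bar>u z\<bar> \<le> B"
proof -
  have "\<exists>\<rho> M. \<rho> > 0 \<and> (\<forall>w\<in>\<Omega> \<inter> ball z \<rho>. \<bar>u w\<bar> \<le> M)" if z: "z \<in> closure \<Omega>" for z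
  proof -
    have "\<exists>l. (u \<longlongrightarrow> l) (at z within \<Omega>)"
    proof (cases "z \<in> \<Omega>")
      case True then show ?thesis using cu by (auto simp: continuous_on_def)
    next
      case False
      then have "z \<in> frontier \<Omega>" using z \<Omega> by (simp add: frontier_def interior_open)
      then show ?thesis using van by (auto simp: vanishes_on_boundary_def)
    qed
    then obtain l where "(u \<longlongrightarrow> l) (at z within \<Omega>)" by blast
    then have "eventually (\<lambda>w. dist (u w) l < 1) (at z within \<Omega>)" by (rule tendstoD) simp
    then obtain \<rho> where \<rho>: "\<rho> > 0" "\<And>w. w \<in> \<Omega> \<Longrightarrow> w \<noteq> z \<Longrightarrow> dist w z < \<rho> \<Longrightarrow> dist (u w) l < 1"
      by (auto simp: eventually_at)
    have "\<bar>u w\<bar> \<le> max \<bar>u z\<bar> (\<bar>l\<bar> + 1)" if "w \<in> \<Omega> \<inter> ball z \<rho>" for w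
      using \<rho>(2)[of w] that by (cases "w = z") (auto simp: dist_commute dist_real_def)
    then show ?thesis using \<rho>(1) by blast
  qed
  then have "\<exists>\<rho>. \<forall>z\<in>closure \<Omega>. \<rho> z > 0 \<and> (\<exists>M. \<forall>w\<in>\<Omega> \<inter> ball z (\<rho> z). \<bar>u w\<bar> \<le> M)"
    by (intro bchoice) blast
  then obtain \<rho> where \<rho>: "\<And>z. z \<in> closure \<Omega> \<Longrightarrow> \<rho> z > 0"
    "\<And>z. z \<in> closure \<Omega> \<Longrightarrow> \<exists>M. \<forall>w\<in>\<Omega> \<inter> ball z (\<rho> z). \<bar>u w\<bar> \<le> M" by blast
  have "compact (closure \<Omega>)" using \<Omega>(2) by simp
  moreover have "closure \<Omega> \<subseteq> (\<Union>z\<in>closure \<Omega>. ball z (\<rho> z))"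
    using \<rho>(1) by (intro subsetI) (rule UN_I, assumption, simp)
  ultimately obtain Z where Z: "Z \<subseteq> closure \<Omega>" "finite Z" "closure \<Omega> \<subseteq> (\<Union>z\<in>Z. ball z (\<rho> z))"
    by (elim compactE_image[where f="\<lambda>z. ball z (\<rho> z)"]) auto
  have "bounded (\<Union>z\<in>Z. u ` (\<Omega> \<inter> ball z (\<rho> z)))"
  proof (intro bounded_UN ballI)
    fix z assume "z \<in> Z"
    then obtain M where "\<forall>w\<in>\<Omega> \<inter> ball z (\<rho> z). \<bar>u w\<bar> \<le> M" using \<rho>(2) Z by blast
    then show "bounded (u ` (\<Omega> \<inter> ball z (\<rho> z)))" by (auto simp: bounded_iff)
  qed (rule Z)
  then obtain B where B: "\<And>t. t \<in> (\<Union>z\<in>Z. u ` (\<Omega> \<inter> ball z (\<rho> z))) \<Longrightarrow> \<bar>t\<bar> \<le> B"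
    by (auto simp: bounded_iff)
  have "\<bar>u w\<bar> \<le> B" if "w \<in> \<Omega>" for w
  proof (rule B)
    have "w \<in> (\<Union>z\<in>Z. ball z (\<rho> z))"
      using subsetD[OF closure_subset that] by (rule subsetD[OF Z(3)])
    then obtain z where "z \<in> Z" "w \<in> ball z (\<rho> z)" by (elim UN_E)
    then show "u w \<in> (\<Union>z\<in>Z. u ` (\<Omega> \<inter> ball z (\<rho> z)))" using that by blast
  qed
  then show ?thesis by (rule that)
qed

text \<open>Strong minimum principle: at an interior zero the function \<open>u\<close> is touched from below by the constant \<open>0\<close>,
  and the nonlocal operator notices the mass near the point \<open>w\<close> where \<open>u\<close> is positive.\<close>

lemma supersolution_positive:
  fixes \<Omega> :: "(real ^ 'n) set"
  assumes \<alpha>: "0 < \<alpha>" "\<alpha> < 1" and \<Omega>: "open \<Omega>" "bounded \<Omega>"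
    and super: "viscosity_supersolution \<Omega> \<alpha> f u" and f: "\<And>x. x \<in> \<Omega> \<Longrightarrow> f x \<ge> 0"
    and bd: "\<And>z. z \<in> \<Omega> \<Longrightarrow> \<bar>u z\<bar> \<le> B" and nonneg: "\<And>z. z \<in> \<Omega> \<Longrightarrow> 0 \<le> u z"
    and w: "w \<in> \<Omega>" "u w \<noteq> 0" and x: "x \<in> \<Omega>"
  shows "u x > 0"
proof (rule ccontr)
  assume "\<not> u x > 0"
  then have ux: "u x = 0" using nonneg[OF x] by simp
  let ?p = "real CARD('n) + 2 * \<alpha>"
  have cu: "continuous_on \<Omega> u" using super by (simp add: viscosity_supersolution_def)
  have \<Omega>m[measurable]: "\<Omega> \<in> sets borel" using \<Omega> by simp
  have uw: "u w > 0" using w nonneg[OF w(1)] by simp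
  have "eventually (\<lambda>z. u z > u w / 2) (at w within \<Omega>)"
    using cu w uw by (intro order_tendstoD(1)) (auto simp: continuous_on_def)
  then obtain e where e: "e > 0" "\<And>z. z \<in> \<Omega> \<Longrightarrow> z \<noteq> w \<Longrightarrow> dist z w < e \<Longrightarrow> u z > u w / 2"
    by (auto simp: eventually_at)
  obtain e2 where e2: "e2 > 0" "ball w e2 \<subseteq> \<Omega>" using \<Omega> w openE by blast
  have xw: "dist x w > 0" using ux uw by auto
  define q where "q = min (min e e2) (dist x w / 2)"
  have q: "q > 0" "q \<le> e" "q \<le> e2" "q \<le> dist x w / 2" using e e2 xw by (auto simp: q_def)
  have qb: "z \<in> \<Omega>" "u w / 2 \<le> u z" "q \<le> norm (z - x)" "norm (z - x) \<le> 2 * dist x w" if "z \<in> ball w q" for z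
  proof -
    have zw: "dist z w < q" using that by (simp add: dist_commute)
    show "z \<in> \<Omega>" using zw q e2 by (auto simp: dist_commute)
    then show "u w / 2 \<le> u z" using e(2)[of z] zw q uw by (cases "z = w") auto
    have "dist x w \<le> dist x z + dist z w" "dist x z \<le> dist x w + dist w z" by (rule dist_triangle)+
    then have "dist x w \<le> norm (z - x) + dist z w" "norm (z - x) \<le> dist x w + dist z w"
      by (simp_all add: dist_norm norm_minus_commute)
    then show "q \<le> norm (z - x)" "norm (z - x) \<le> 2 * dist x w" using zw q xw by linarith+
  qed
  define k where "k = (u w / 2) / (2 * dist x w) powr ?p"
  have k: "k > 0" using uw xw by (simp add: k_def)
  define \<eta> where "\<eta> = k * measure lborel (ball w q) / 2"
  have vol: "measure lborel (ball w q) > 0" using content_ball_pos[OF q(1), of w] by simp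
  have \<eta>: "\<eta> > 0" using k vol by (simp add: \<eta>_def)
  have "\<exists>r1>0. \<forall>r. 0 < r \<longrightarrow> r < r1 \<longrightarrow> - \<eta> \<le> (LINT z:\<Omega> - ball x r|lborel. (u x - u z) / norm (z - x) powr ?p)"
    by (rule supersolution_quadratic_test[OF \<alpha> \<Omega> super x f[OF x] bd, where ?r0.0=1 and v=0 and K=0])
       (use nonneg \<eta> ux in auto)
  then obtain r1 where r1: "r1 > 0" "\<And>r. 0 < r \<Longrightarrow> r < r1 \<Longrightarrow> - \<eta> \<le> (LINT z:\<Omega> - ball x r|lborel. (u x - u z) / norm (z - x) powr ?p)"
    by blast
  define r where "r = min r1 q / 2"
  have r: "0 < r" "r < r1" "r < q" using r1 q by (auto simp: r_def min_def)
  have int: "set_integrable lborel (\<Omega> - ball x r) (\<lambda>z. (u x - u z) / norm (z - x) powr ?p)"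
    by (rule set_integrable_kernel_off_ball[OF \<Omega>m \<Omega>(2) r(1)])
       (use \<alpha> bd ux borel_measurable_continuous_on_open[OF \<Omega>(1), of "\<lambda>z. u x - u z"] cu in \<open>auto intro!: continuous_intros\<close>)
  have "(LINT z:\<Omega> - ball x r|lborel. (u x - u z) / norm (z - x) powr ?p) \<le> (\<integral> z. - k * indicator (ball w q) z \<partial>lborel)"
    unfolding set_lebesgue_integral_def
  proof (rule integral_mono)
    show "integrable lborel (\<lambda>z. indicator (\<Omega> - ball x r) z *\<^sub>R ((u x - u z) / norm (z - x) powr ?p))"
      using int by (simp add: set_integrable_def)
    show "integrable lborel (\<lambda>z. - k * indicator (ball w q) z)"
      using emeasure_lborel_ball_finite[of w q] by (intro integrable_mult_right) auto
    fix z
    show "indicator (\<Omega> - ball x r) z *\<^sub>R ((u x - u z) / norm (z - x) powr ?p) \<le> - k * indicator (ball w q) z"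
    proof (cases "z \<in> ball w q")
      case True
      note z = qb[OF True]
      have "norm (z - x) powr ?p \<le> (2 * dist x w) powr ?p" using z \<alpha> by (intro powr_mono2) auto
      moreover have "norm (z - x) powr ?p > 0" using z q by auto
      ultimately have "k \<le> u z / norm (z - x) powr ?p" unfolding k_def using z uw by (intro frac_le) auto
      moreover have "z \<in> \<Omega> - ball x r" using z r by (auto simp: dist_norm norm_minus_commute)
      ultimately show ?thesis using True ux by simp
    next
      case False
      have "indicator (\<Omega> - ball x r) z * (u z / norm (z - x) powr ?p) \<ge> 0"
        using nonneg[of z] by (auto simp: indicator_def)
      then show ?thesis using False ux by simp
    qed
  qed
  also have "\<dots> = - (2 * \<eta>)" by (simp add: \<eta>_def)
  finally show False using r1(2)[OF r(1,2)] \<eta> by linarith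
qed

theorem theorem1p2:
  fixes \<Omega> :: "(real ^ 'n) set" and \<alpha> :: real
  assumes "0 < \<alpha>" and "\<alpha> \<le> 1 / 2"
    and "open \<Omega>" and "connected \<Omega>" and "\<Omega> \<noteq> {}" and "bounded \<Omega>"
    and "CARD('n) \<ge> 2 \<Longrightarrow> C2_boundary \<Omega>"
    and "CARD('n) = 1 \<Longrightarrow> \<exists>a b. \<Omega> = box a b"
  shows "\<forall>p::real. p > 0 \<longrightarrow>
    \<not> (\<exists>u :: real ^ 'n \<Rightarrow> real.
          viscosity_solution \<Omega> \<alpha> (\<lambda>x. u x powr p) u \<and>
          vanishes_on_boundary \<Omega> u \<and>
          (\<forall>x\<in>\<Omega>. 0 \<le> u x) \<and>
          (\<exists>x\<in>\<Omega>. u x \<noteq> 0))"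
proof (intro allI impI notI)
  fix p :: real
  assume "p > 0" and "\<exists>u :: real ^ 'n \<Rightarrow> real. viscosity_solution \<Omega> \<alpha> (\<lambda>x. u x powr p) u \<and>
          vanishes_on_boundary \<Omega> u \<and> (\<forall>x\<in>\<Omega>. 0 \<le> u x) \<and> (\<exists>x\<in>\<Omega>. u x \<noteq> 0)"
  then obtain u :: "real ^ 'n \<Rightarrow> real" and w where super: "viscosity_supersolution \<Omega> \<alpha> (\<lambda>x. u x powr p) u"
    and van: "vanishes_on_boundary \<Omega> u" and nonneg: "\<And>x. x \<in> \<Omega> \<Longrightarrow> 0 \<le> u x"
    and w: "w \<in> \<Omega>" "u w \<noteq> 0"
    by (auto simp: viscosity_solution_def)
  note \<alpha> = assms(1,2) and \<Omega> = assms(3,6)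
  have \<alpha>1: "\<alpha> < 1" using \<alpha> by simp
  let ?k = "\<lambda>x z. norm (z - x) powr (real CARD('n) + 2 * \<alpha>)"
  have C2: "C2_boundary \<Omega>"
  proof (cases "CARD('n) = 1")
    case True
    then show ?thesis using assms(8) C2_boundary_interval by auto
  next
    case False
    moreover have "CARD('n) \<noteq> 0" by simp
    ultimately have "CARD('n) \<ge> 2" by linarith
    then show ?thesis by (rule assms(7))
  qed
  obtain R where R: "R > 0" "two_sided_ball \<Omega> R" using two_sided_ball_exists[OF \<Omega> assms(5) C2] .
  have fin: "(\<integral>\<^sup>+ z. ennreal (infdist z (- \<Omega>) powr (- 1 / 2)) * indicator \<Omega> z \<partial>lborel) < \<infinity>"
    by (rule nn_integral_infdist_finite[OF \<Omega> C2])
  let ?b = "barrier R \<Omega>"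
  obtain \<delta> where \<delta>: "\<delta> > 0"
    and gain: "\<And>x. x \<in> \<Omega> \<Longrightarrow> infdist x (- \<Omega>) < \<delta> \<Longrightarrow> \<exists>\<gamma>>0. \<exists>r1>0. \<forall>r. 0 < r \<longrightarrow> r < r1 \<longrightarrow>
       set_integrable lborel (\<Omega> - ball x r) (\<lambda>z. (?b z - ?b x) / ?k x z) \<and>
       (LINT z:\<Omega> - ball x r|lborel. (?b z - ?b x) / ?k x z) \<le> - \<gamma>"
    and touch: "\<And>x. x \<in> \<Omega> \<Longrightarrow> infdist x (- \<Omega>) < \<delta> \<Longrightarrow> \<exists>v K r0. r0 > 0 \<and> K \<ge> 0 \<and>
       (\<forall>\<xi>. norm \<xi> < r0 \<longrightarrow> ?b (x + \<xi>) - ?b x \<le> v \<bullet> \<xi> + K * (norm \<xi>)\<^sup>2)"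
    by (rule barrier_strictly_superharmonic[OF \<Omega> assms(5) R fin \<alpha>]) (rule that, assumption+)
  have cu: "continuous_on \<Omega> u" using super by (simp add: viscosity_supersolution_def)
  obtain B where B: "\<And>z. z \<in> \<Omega> \<Longrightarrow> \<bar>u z\<bar> \<le> B"
    by (rule vanishing_continuous_bounded[OF \<Omega> cu van]) (rule that, assumption+)
  have upos: "u x > 0" if "x \<in> \<Omega>" for x
    by (rule supersolution_positive[OF \<alpha>(1) \<alpha>1 \<Omega> super _ B nonneg w that]) auto
  have compact_core: "compact (\<Omega> \<inter> {z. s \<le> infdist z (- \<Omega>)})" if "s > 0" for s
  proof -
    have "z \<in> \<Omega>" if "s \<le> infdist z (- \<Omega>)" for z
      using that \<open>s > 0\<close> infdist_zero[of z "- \<Omega>"] by (cases "z \<in> \<Omega>") auto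
    then have "\<Omega> \<inter> {z. s \<le> infdist z (- \<Omega>)} = {z. s \<le> infdist z (- \<Omega>)}" by blast
    moreover have "closed {z. s \<le> infdist z (- \<Omega>)}" by (intro closed_Collect_le continuous_intros)
    moreover have "bounded (\<Omega> \<inter> {z. s \<le> infdist z (- \<Omega>)})" using \<Omega>(2) bounded_subset by blast
    ultimately show ?thesis by (simp add: compact_eq_bounded_closed)
  qed
  obtain m where m: "m > 0" "\<And>z. z \<in> \<Omega> \<Longrightarrow> \<delta> \<le> infdist z (- \<Omega>) \<Longrightarrow> m \<le> u z"
  proof (cases "\<Omega> \<inter> {z. \<delta> \<le> infdist z (- \<Omega>)} = {}")
    case True
    then show ?thesis using that[of 1] by auto
  next
    case False
    have "\<exists>z0\<in>\<Omega> \<inter> {z. \<delta> \<le> infdist z (- \<Omega>)}. \<forall>z\<in>\<Omega> \<inter> {z. \<delta> \<le> infdist z (- \<Omega>)}. u z0 \<le> u z"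
      by (rule continuous_attains_inf[OF compact_core[OF \<delta>] False continuous_on_subset[OF cu]]) auto
    then obtain z0 where "z0 \<in> \<Omega> \<inter> {z. \<delta> \<le> infdist z (- \<Omega>)}"
      "\<And>z. z \<in> \<Omega> \<inter> {z. \<delta> \<le> infdist z (- \<Omega>)} \<Longrightarrow> u z0 \<le> u z" by blast
    then show ?thesis using that[of "u z0"] upos by auto
  qed
  obtain z1 where z1: "z1 \<in> \<Omega>" "u z1 < m / 2"
  proof -
    have "frontier \<Omega> \<noteq> {}" using \<Omega> assms(5) frontier_eq_empty not_bounded_UNIV by metis
    then obtain y where y: "y \<in> frontier \<Omega>" by auto
    then have "(u \<longlongrightarrow> 0) (at y within \<Omega>)" using van by (simp add: vanishes_on_boundary_def)
    then have "eventually (\<lambda>z. u z < m / 2) (at y within \<Omega>)" using m(1) by (intro order_tendstoD(2)) auto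
    then obtain e where e: "e > 0" "\<And>z. z \<in> \<Omega> \<Longrightarrow> z \<noteq> y \<Longrightarrow> dist z y < e \<Longrightarrow> u z < m / 2"
      by (auto simp: eventually_at)
    have "y \<in> closure \<Omega>" "y \<notin> \<Omega>" using y \<Omega>(1) by (auto simp: frontier_def interior_open)
    then obtain z where "z \<in> \<Omega>" "dist z y < e" using e(1) by (auto simp: closure_approachable)
    then show ?thesis using that[of z] e(2) \<open>y \<notin> \<Omega>\<close> by auto
  qed
  \<comment> \<open>With this weight the value of \<open>u + \<epsilon> b\<close> at \<open>z1\<close> is below \<open>m\<close>, so the minimum point lies in the
    collar where the barrier is superharmonic.\<close>
  define \<epsilon> where "\<epsilon> = m / (2 * (?b z1 + 1))"
  have b0: "0 \<le> ?b z" if "z \<in> \<Omega>" for z by (rule barrier_nonneg[OF \<Omega> R(1) that])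
  have \<epsilon>: "\<epsilon> > 0" "\<epsilon> * ?b z1 \<le> m / 2" using m(1) b0[OF z1(1)] by (auto simp: \<epsilon>_def divide_simps)
  define g where "g = (\<lambda>z. u z + \<epsilon> * ?b z)"
  have cg: "continuous_on \<Omega> g"
    unfolding g_def using cu continuous_on_barrier[OF \<Omega> R(1)] by (intro continuous_intros)
  have g1: "g z1 < m" using z1 \<epsilon> by (simp add: g_def)
  obtain s where s: "s > 0" "\<And>z. z \<in> \<Omega> \<Longrightarrow> infdist z (- \<Omega>) < s \<Longrightarrow> g z1 / \<epsilon> < ?b z"
    by (rule barrier_large_near_boundary[OF \<Omega> R(1), of "g z1 / \<epsilon>"]) (rule that, assumption+)
  let ?core = "\<Omega> \<inter> {z. s \<le> infdist z (- \<Omega>)}"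
  have off_core: "g z1 < g z" if "z \<in> \<Omega>" "z \<notin> ?core" for z
  proof -
    have "g z1 / \<epsilon> < ?b z" using s(2)[of z] that by auto
    then have "g z1 < \<epsilon> * ?b z" using \<epsilon> by (simp add: pos_divide_less_eq mult.commute)
    then show ?thesis using nonneg[OF that(1)] by (simp add: g_def)
  qed
  have z1c: "z1 \<in> ?core" using off_core[OF z1(1)] by auto
  then have ne: "?core \<noteq> {}" by blast
  have "\<exists>x\<in>?core. \<forall>z\<in>?core. g x \<le> g z"
    by (rule continuous_attains_inf[OF compact_core[OF s(1)] ne continuous_on_subset[OF cg]]) auto
  then obtain x where x: "x \<in> ?core" "\<And>z. z \<in> ?core \<Longrightarrow> g x \<le> g z" by blast
  have x\<Omega>: "x \<in> \<Omega>" using x by simp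
  have min: "g x \<le> g z" if "z \<in> \<Omega>" for z
    using x(2)[of z] x(2)[OF z1c] off_core[OF that] by (cases "z \<in> ?core") auto
  have diff: "u x - u z \<le> \<epsilon> * (?b z - ?b x)" if "z \<in> \<Omega>" for z
    using min[OF that] by (simp add: g_def algebra_simps)
  have near: "infdist x (- \<Omega>) < \<delta>"
  proof (rule ccontr)
    assume "\<not> infdist x (- \<Omega>) < \<delta>"
    then have "m \<le> u x" using m(2)[OF x\<Omega>] by simp
    also have "\<dots> \<le> g x" using b0[OF x\<Omega>] \<epsilon> by (simp add: g_def)
    also have "\<dots> \<le> g z1" by (rule min[OF z1(1)])
    finally show False using g1 by simp
  qed
  obtain \<gamma> r1 where \<gamma>: "\<gamma> > 0" "r1 > 0"
    and int: "\<And>r. 0 < r \<Longrightarrow> r < r1 \<Longrightarrow> set_integrable lborel (\<Omega> - ball x r) (\<lambda>z. (?b z - ?b x) / ?k x z)"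
    and le: "\<And>r. 0 < r \<Longrightarrow> r < r1 \<Longrightarrow> (LINT z:\<Omega> - ball x r|lborel. (?b z - ?b x) / ?k x z) \<le> - \<gamma>"
    using gain[OF x\<Omega> near] by blast
  obtain v K r0 where v: "r0 > 0" "K \<ge> 0"
    "\<And>\<xi>. norm \<xi> < r0 \<Longrightarrow> ?b (x + \<xi>) - ?b x \<le> v \<bullet> \<xi> + K * (norm \<xi>)\<^sup>2"
    using touch[OF x\<Omega> near] by blast
  have below: "u x + (- \<epsilon> *\<^sub>R v) \<bullet> (z - x) - \<epsilon> * K * (norm (z - x))\<^sup>2 \<le> u z"
    if "z \<in> \<Omega>" "norm (z - x) < r0" for z
  proof -
    have "?b z - ?b x \<le> v \<bullet> (z - x) + K * (norm (z - x))\<^sup>2" using v(3)[OF that(2)] by simp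
    then have "\<epsilon> * (?b z - ?b x) \<le> \<epsilon> * (v \<bullet> (z - x) + K * (norm (z - x))\<^sup>2)" using \<epsilon> by (intro mult_left_mono) auto
    then show ?thesis using diff[OF that(1)] by (simp add: algebra_simps)
  qed
  have "0 \<le> \<epsilon> * K" "\<epsilon> * \<gamma> / 2 > 0" using \<epsilon> v \<gamma> by auto
  from supersolution_quadratic_test[OF \<alpha>(1) \<alpha>1 \<Omega> super x\<Omega> _ B v(1) this(1) below this(2)]
  obtain r2 where r2: "r2 > 0" "\<And>r. 0 < r \<Longrightarrow> r < r2 \<Longrightarrow> - (\<epsilon> * \<gamma> / 2) \<le> (LINT z:\<Omega> - ball x r|lborel. (u x - u z) / ?k x z)"
    by auto
  define r where "r = min r1 r2 / 2"
  have r: "0 < r" "r < r1" "r < r2" using \<gamma> r2 by (auto simp: r_def min_def)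
  have \<Omega>m: "\<Omega> \<in> sets borel" using \<Omega> by simp
  have um: "set_borel_measurable lborel \<Omega> (\<lambda>z. u x - u z)"
    by (intro borel_measurable_continuous_on_open \<Omega> continuous_intros cu)
  have uint: "set_integrable lborel (\<Omega> - ball x r) (\<lambda>z. (u x - u z) / ?k x z)"
    using \<alpha> by (intro set_integrable_kernel_off_ball[OF \<Omega>m \<Omega>(2) r(1) _ um, of _ "B + B"])
       (use abs_triangle_ineq4[of "u x"] B B[OF x\<Omega>] in \<open>fastforce+\<close>)
  have "- (\<epsilon> * \<gamma> / 2) \<le> (LINT z:\<Omega> - ball x r|lborel. (u x - u z) / ?k x z)" by (rule r2(2)[OF r(1,3)])
  also have "\<dots> \<le> (LINT z:\<Omega> - ball x r|lborel. \<epsilon> * ((?b z - ?b x) / ?k x z))"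
  proof (rule set_integral_mono[OF uint set_integrable_mult_right[OF int[OF r(1,2)]]])
    fix z assume "z \<in> \<Omega> - ball x r"
    then have "(u x - u z) / ?k x z \<le> \<epsilon> * (?b z - ?b x) / ?k x z"
      using diff[of z] by (intro divide_right_mono) auto
    then show "(u x - u z) / ?k x z \<le> \<epsilon> * ((?b z - ?b x) / ?k x z)" by simp
  qed
  also have "\<dots> = \<epsilon> * (LINT z:\<Omega> - ball x r|lborel. (?b z - ?b x) / ?k x z)"
    by (rule set_integral_mult_right)
  also have "\<dots> \<le> \<epsilon> * (- \<gamma>)" using le[OF r(1,2)] \<epsilon> by (intro mult_left_mono) auto
  finally have "\<epsilon> * \<gamma> \<le> 0" by simp
  then show False using \<epsilon> \<gamma> by (simp add: mult_le_0_iff)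
qed

end
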